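(* There are no genus $4$ curves in standard form over $\mathbb{F}_3$ with $p$-rank $0$ and $a$-number $3$ (where $p=3$).
   Context: Let $k$ be a field of odd characteristic $p$ (here $k=\mathbb{F}_3$), and fix a non-square $\epsilon\in k^\times\setminus (k^\times)^2$. Put $F_1=2xw+2yz$, $F_2=2xw+y^2-\epsilon z^2$, $F_d=2yw+z^2$ in $k[x,y,z,w]$; $V(F,G)\subset\mathbb{P}^3_k$ denotes the common zero locus. Below, $k^\times/(k^\times)^2$ stands for a fixed set of representatives of the square classes. A curve $X$ of genus $4$ over $k$ is in standard form if it is non-hyperelliptic, irreducible, smooth, and $X=V(F,G)$ with one of the following. (Case D) $F=F_d$ and $G=a_0x^3+(a_1y^2+a_2z^2+a_3w^2+a_4yz+a_5zw)x+a_6y^3+a_7z^3+a_8w^3+a_9yz^2+b_1z^2w+b_2zw^2$, with $a_i\in k$, $a_0,a_6\in k^\times$, $b_1,b_2\in\{0,1\}$, and $r=a_1y^2+a_2z^2+a_3w^2+a_4yz+a_5zw$ is either $0$ or has leading coefficient $1$ (graded lexicographic order with $x>y>z>w$). (Case N1i) $F=F_1$ and $G=(a_1y+a_2z)x^2+a_3yzx+y^3+a_4z^3+b_1y^2z+a_5yz^2+(a_6y^2+a_7yz+b_2z^2)w+(a_8y+a_9z)w^2+a_{10}w^3$, with $a_i\in k$, $a_1\ne0$, $a_2\neq 0$, $b_1\in\{0\}\cup k^\times/(k^\times)^2$, $b_2\in\{0,1\}$. (Case N1ii) $F=F_1$ and $G=(a_1y+a_2z)x^2+a_3yzx+b_1y^2z+b_2yz^2+(a_4y^2+a_5yz+b_3z^2)w+(a_6y+a_7z)w^2+a_8w^3$,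 with $a_i\in k$, $a_1a_2\neq0$, $b_1,b_3\in\{0,1\}$, $b_2\in\{0\}\cup k^\times/(k^\times)^2$. (Case N2) $F=F_2$ and $G=(a_1y+a_2z)x^2+a_3(y^2-\epsilon z^2)x+b_1y(y^2-\epsilon z^2)+a_4y(y^2+3\epsilon z^2)+a_5z(3y^2+\epsilon z^2)+(a_6y^2+a_7yz+b_2z^2)w+(a_8y+a_9z)w^2+a_{10}w^3$, with $a_i\in k$, $(a_1,a_2)\ne(0,0)$, $b_1,b_2\in\{0,1\}$. The Hasse--Witt matrix $H$ of a genus $g$ curve $X$ with respect to a basis $\xi_1,\dots,\xi_g$ of $H^1(X,\mathcal{O}_X)$ is $(a_{ij})$ where $\mathcal{F}_X(\xi_j)=\sum_i a_{ij}\xi_i$ and $\mathcal{F}_X$ is the $p$-linear map induced by the absolute Frobenius. The $a$-number of $X$ is $a=g-\operatorname{rank}(H)$, and the $p$-rank is $f=\operatorname{rank}(HH^{(p)}\cdots H^{(p^{g-1})})$, where $H^{(i)}$ is obtained by raising each entry of $H$ to the $i$-th power; equivalently the $p$-torsion of the Jacobian has $p^f$ points over $\overline{k}$. *)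

theory Defs
  imports
    "HOL-Analysis.Analysis"
    "HOL-Library.Poly_Mapping"
    "HOL-Algebra.Algebraic_Closure_Type"
begin

section \<open>Polynomials and Laurent polynomials in four variables\<close>

datatype coord = CX | CY | CZ | CW

instance coord :: finite
proof
  have "(UNIV :: coord set) = {CX, CY, CZ, CW}"
    using coord.exhaust by blast
  then show "finite (UNIV :: coord set)"
    by (metis finite.emptyI finite.insertI)
qed

type_synonym 'a poly4 = "(coord \<Rightarrow>\<^sub>0 nat) \<Rightarrow>\<^sub>0 'a"
type_synonym 'a laurent4 = "(coord \<Rightarrow>\<^sub>0 int) \<Rightarrow>\<^sub>0 'a"

definition const :: "'a::zero \<Rightarrow> ('e::zero \<Rightarrow>\<^sub>0 'a)" where
  "const c = Poly_Mapping.single 0 c"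

definition var :: "coord \<Rightarrow> 'a::{zero,one} poly4" where
  "var i = Poly_Mapping.single (Poly_Mapping.single i 1) 1"

abbreviation "px \<equiv> var CX"
abbreviation "py \<equiv> var CY"
abbreviation "pz \<equiv> var CZ"
abbreviation "pw \<equiv> var CW"

definition mdeg :: "(coord \<Rightarrow>\<^sub>0 'b) \<Rightarrow> 'b::comm_monoid_add" where
  "mdeg e = (\<Sum>i\<in>UNIV. Poly_Mapping.lookup e i)"

definition homogeneous ::
    "'b \<Rightarrow> ((coord \<Rightarrow>\<^sub>0 'b::comm_monoid_add) \<Rightarrow>\<^sub>0 'a::zero) \<Rightarrow> bool" where
  "homogeneous d f \<longleftrightarrow> (\<forall>e\<in>Poly_Mapping.keys f. mdeg e = d)"

definition pderiv4 :: "coord \<Rightarrow> 'a::comm_ring_1 poly4 \<Rightarrow> 'a poly4" where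
  "pderiv4 i f = (\<Sum>e\<in>Poly_Mapping.keys f.
     Poly_Mapping.single (e - Poly_Mapping.single i 1)
       (of_nat (Poly_Mapping.lookup e i) * Poly_Mapping.lookup f e))"

text \<open>Evaluation after mapping the coefficients by \<open>h\<close>.\<close>

definition eval4 :: "('a::zero \<Rightarrow> 'b::comm_ring_1) \<Rightarrow> 'a poly4 \<Rightarrow> 'b ^ coord \<Rightarrow> 'b" where
  "eval4 h f P = (\<Sum>e\<in>Poly_Mapping.keys f.
     h (Poly_Mapping.lookup f e) * (\<Prod>i\<in>UNIV. (P $ i) ^ Poly_Mapping.lookup e i))"

definition to_laurent :: "'a::comm_ring_1 poly4 \<Rightarrow> 'a laurent4" where
  "to_laurent f = (\<Sum>e\<in>Poly_Mapping.keys f.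
     Poly_Mapping.single (Poly_Mapping.map int e) (Poly_Mapping.lookup f e))"


section \<open>The projective scheme $V(F,G)$: geometric properties\<close>

text \<open>Geometric points of $V(F,G)$ are given by their nonzero homogeneous coordinate vectors
  over the algebraic closure of \<open>'a\<close>.\<close>

definition zeros :: "'a::field poly4 \<Rightarrow> 'a poly4 \<Rightarrow> ('a alg_closure ^ coord) set" where
  "zeros F G = {P. P \<noteq> 0 \<and> eval4 to_ac F P = 0 \<and> eval4 to_ac G P = 0}"

definition proj_point :: "'b::field ^ coord \<Rightarrow> ('b ^ coord) set" where
  "proj_point P = {c *s P |c. c \<noteq> 0}"

text \<open>Jacobian criterion for smoothness of pure dimension 1 at all geometric points.\<close>

definition smooth_curve :: "'a::field poly4 \<Rightarrow> 'a poly4 \<Rightarrow> bool" where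
  "smooth_curve F G \<longleftrightarrow> (\<forall>P\<in>zeros F G.
     rank (vector [\<chi> i. eval4 to_ac (pderiv4 i F) P,
                   \<chi> i. eval4 to_ac (pderiv4 i G) P] :: 'a alg_closure ^ coord ^ 2) = 2)"

text \<open>Irreducibility in the Zariski topology over \<open>'a\<close>: the zero locus is nonempty and is not
  covered by two proper closed subsets; it suffices to test closed subsets cut out by one
  homogeneous polynomial with coefficients in \<open>'a\<close>.\<close>

definition irreducible_curve :: "'a::field poly4 \<Rightarrow> 'a poly4 \<Rightarrow> bool" where
  "irreducible_curve F G \<longleftrightarrow> zeros F G \<noteq> {} \<and>
     (\<forall>(A :: 'a poly4) B d d'. homogeneous d A \<longrightarrow> homogeneous d' B \<longrightarrow>
        (\<forall>P\<in>zeros F G. eval4 to_ac A P = 0 \<or> eval4 to_ac B P = 0) \<longrightarrow>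
        (\<forall>P\<in>zeros F G. eval4 to_ac A P = 0) \<or> (\<forall>P\<in>zeros F G. eval4 to_ac B P = 0))"

text \<open>For a smooth irreducible curve of genus at least 2 in odd characteristic: there is a
  morphism of degree 2 to the projective line over the algebraic closure. Such a morphism is
  the extension of a rational function $A/B$ with $A,B$ homogeneous of the same degree, and its
  degree is read off as the number of points in a general fibre. Counting points gives the
  separable degree. In odd characteristic a map of degree 2 is separable, and a
  map of separable degree 2 is a map of degree 2 up to a power of Frobenius.\<close>

definition hyperelliptic :: "'a::field poly4 \<Rightarrow> 'a poly4 \<Rightarrow> bool" where
  "hyperelliptic F G \<longleftrightarrow>
     (\<exists>(A :: 'a alg_closure poly4) B d. homogeneous d A \<and> homogeneous d B \<and>
        finite {t. card (proj_point ` {P \<in> zeros F G.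
                      eval4 id B P \<noteq> 0 \<and> eval4 id A P = t * eval4 id B P}) \<noteq> 2})"


section \<open>Cech cohomology of the structure sheaf\<close>

text \<open>Let $S$ be the polynomial ring and $m_I$ the product of the variables in $I$. The localization
  $S_{m_I}$ is the ring of Laurent polynomials in which only the variables in \<open>I\<close> may occur with
  negative exponents. The ring of regular functions on the affine open
  subset $m_I \neq 0$ of $X = V(F,G)$ is the degree 0 part of $S_{m_I} / (F,G) S_{m_I}$; sections are
  represented by elements of \<open>sections I\<close>, and two of them agree on $X$ iff their difference lies
  in \<open>local_ideal F G I\<close>.\<close>

definition localized :: "coord set \<Rightarrow> 'a::comm_ring_1 laurent4 set" where
  "localized I = {f. \<forall>e\<in>Poly_Mapping.keys f. \<forall>i. i \<notin> I \<longrightarrow> 0 \<le> Poly_Mapping.lookup e i}"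

definition sections :: "coord set \<Rightarrow> 'a::comm_ring_1 laurent4 set" where
  "sections I = {f \<in> localized I. homogeneous 0 f}"

definition local_ideal ::
    "'a::comm_ring_1 poly4 \<Rightarrow> 'a poly4 \<Rightarrow> coord set \<Rightarrow> 'a laurent4 set" where
  "local_ideal F G I =
     {a * to_laurent F + b * to_laurent G |a b. a \<in> localized I \<and> b \<in> localized I}"

text \<open>Representatives of 1-cochains, cocycles and coboundaries for the covering of $X$ by the
  four affine open subsets where a coordinate does not vanish. Cochains are indexed by all pairs;
  the cocycle condition for all triples forces them to be alternating modulo $(F,G)$.
  $H^1(X,\mathcal{O}_X)$ is the quotient of \<open>cocycles\<close> by \<open>coboundaries\<close>.\<close>

type_synonym 'a cochain = "coord \<Rightarrow> coord \<Rightarrow> 'a laurent4"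

definition cocycles :: "'a::comm_ring_1 poly4 \<Rightarrow> 'a poly4 \<Rightarrow> 'a cochain set" where
  "cocycles F G = {c. (\<forall>i j. c i j \<in> sections {i, j}) \<and>
     (\<forall>i j k. c i j + c j k - c i k \<in> local_ideal F G {i, j, k})}"

definition coboundaries :: "'a::comm_ring_1 poly4 \<Rightarrow> 'a poly4 \<Rightarrow> 'a cochain set" where
  "coboundaries F G = {c. (\<forall>i j. c i j \<in> sections {i, j}) \<and>
     (\<exists>b. (\<forall>i. b i \<in> sections {i}) \<and>
          (\<forall>i j. c i j - (b j - b i) \<in> local_ideal F G {i, j}))}"

text \<open>\<open>residual \<xi> a c\<close> is $c - \sum_i a_i \xi_i$.\<close>

definition residual ::
    "('g::finite \<Rightarrow> 'a::comm_ring_1 cochain) \<Rightarrow> 'a ^ 'g \<Rightarrow> 'a cochain \<Rightarrow> 'a cochain" where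
  "residual \<xi> a c = (\<lambda>i j. c i j - (\<Sum>l\<in>UNIV. const (a $ l) * \<xi> l i j))"

text \<open>The classes of the cocycles \<open>\<xi> l\<close> form a basis of $H^1(X,\mathcal{O}_X)$.\<close>

definition H1_basis ::
    "'a::field poly4 \<Rightarrow> 'a poly4 \<Rightarrow> ('g::finite \<Rightarrow> 'a cochain) \<Rightarrow> bool" where
  "H1_basis F G \<xi> \<longleftrightarrow> (\<forall>l. \<xi> l \<in> cocycles F G) \<and>
     (\<forall>c\<in>cocycles F G. \<exists>!a. residual \<xi> a c \<in> coboundaries F G)"

definition H1_coords ::
    "'a::field poly4 \<Rightarrow> 'a poly4 \<Rightarrow> ('g::finite \<Rightarrow> 'a cochain) \<Rightarrow> 'a cochain \<Rightarrow> 'a ^ 'g" where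
  "H1_coords F G \<xi> c = (THE a. residual \<xi> a c \<in> coboundaries F G)"

definition genus_4 :: "'a::field poly4 \<Rightarrow> 'a poly4 \<Rightarrow> bool" where
  "genus_4 F G \<longleftrightarrow> (\<exists>\<xi> :: 4 \<Rightarrow> 'a cochain. H1_basis F G \<xi>)"


section \<open>Hasse--Witt matrix, $a$-number and $p$-rank\<close>

text \<open>The absolute Frobenius is the identity on $X$ and the $p$-th power map on functions.\<close>

definition frobenius_cochain :: "'a::field cochain \<Rightarrow> 'a cochain" where
  "frobenius_cochain c = (\<lambda>i j. c i j ^ CHAR('a))"

definition hasse_witt ::
    "'a::field poly4 \<Rightarrow> 'a poly4 \<Rightarrow> ('g::finite \<Rightarrow> 'a cochain) \<Rightarrow> 'a ^ 'g ^ 'g" where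
  "hasse_witt F G \<xi> = (\<chi> i j. H1_coords F G \<xi> (frobenius_cochain (\<xi> j)) $ i)"

definition entry_power :: "nat \<Rightarrow> 'a::field ^ 'g ^ 'g \<Rightarrow> 'a ^ 'g ^ 'g" where
  "entry_power n H = (\<chi> i j. (H $ i $ j) ^ n)"

definition a_number :: "'a::field ^ 'g ^ 'g \<Rightarrow> nat" where
  "a_number H = CARD('g) - rank H"

definition p_rank :: "'a::field ^ 'g ^ 'g \<Rightarrow> nat" where
  "p_rank H = rank (foldr (**) (map (\<lambda>n. entry_power (CHAR('a) ^ n) H) [0..<CARD('g)]) (mat 1))"


section \<open>Curves in standard form\<close>

definition square_class_reps :: "'a::field set \<Rightarrow> bool" where
  "square_class_reps R \<longleftrightarrow> 0 \<notin> R \<and>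
     (\<forall>a. a \<noteq> 0 \<longrightarrow> (\<exists>!r. r \<in> R \<and> (\<exists>c. c \<noteq> 0 \<and> a = r * c ^ 2)))"

definition grlex_less :: "(coord \<Rightarrow>\<^sub>0 nat) \<Rightarrow> (coord \<Rightarrow>\<^sub>0 nat) \<Rightarrow> bool" where
  "grlex_less e e' \<longleftrightarrow> mdeg e < mdeg e' \<or>
     (mdeg e = mdeg e' \<and>
      (map (Poly_Mapping.lookup e) [CX, CY, CZ, CW],
       map (Poly_Mapping.lookup e') [CX, CY, CZ, CW]) \<in> lex less_than)"

definition lead_coeff_one :: "'a::field poly4 \<Rightarrow> bool" where
  "lead_coeff_one r \<longleftrightarrow> (\<exists>e\<in>Poly_Mapping.keys r. Poly_Mapping.lookup r e = 1 \<and>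
     (\<forall>e'\<in>Poly_Mapping.keys r. e' \<noteq> e \<longrightarrow> grlex_less e' e))"

definition F_1 :: "'a::field poly4" where
  "F_1 = 2 * px * pw + 2 * py * pz"

definition F_2 :: "'a::field \<Rightarrow> 'a poly4" where
  "F_2 \<epsilon> = 2 * px * pw + py ^ 2 - const \<epsilon> * pz ^ 2"

definition F_d :: "'a::field poly4" where
  "F_d = 2 * py * pw + pz ^ 2"

definition case_D :: "'a::field poly4 \<Rightarrow> 'a poly4 \<Rightarrow> bool" where
  "case_D F G \<longleftrightarrow> F = F_d \<and>
     (\<exists>a0 a1 a2 a3 a4 a5 a6 a7 a8 a9 b1 b2 r.
        a0 \<noteq> 0 \<and> a6 \<noteq> 0 \<and> b1 \<in> {0, 1} \<and> b2 \<in> {0, 1} \<and>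
        r = const a1 * py ^ 2 + const a2 * pz ^ 2 + const a3 * pw ^ 2
              + const a4 * py * pz + const a5 * pz * pw \<and>
        (r = 0 \<or> lead_coeff_one r) \<and>
        G = const a0 * px ^ 3 + r * px
              + const a6 * py ^ 3 + const a7 * pz ^ 3 + const a8 * pw ^ 3
              + const a9 * py * pz ^ 2 + const b1 * pz ^ 2 * pw + const b2 * pz * pw ^ 2)"

definition case_N1i :: "'a::field set \<Rightarrow> 'a poly4 \<Rightarrow> 'a poly4 \<Rightarrow> bool" where
  "case_N1i R F G \<longleftrightarrow> F = F_1 \<and>
     (\<exists>a1 a2 a3 a4 a5 a6 a7 a8 a9 a10 b1 b2.
        a1 \<noteq> 0 \<and> a2 \<noteq> 0 \<and> b1 \<in> {0} \<union> R \<and> b2 \<in> {0, 1} \<and>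
        G = (const a1 * py + const a2 * pz) * px ^ 2 + const a3 * py * pz * px
              + py ^ 3 + const a4 * pz ^ 3 + const b1 * py ^ 2 * pz + const a5 * py * pz ^ 2
              + (const a6 * py ^ 2 + const a7 * py * pz + const b2 * pz ^ 2) * pw
              + (const a8 * py + const a9 * pz) * pw ^ 2 + const a10 * pw ^ 3)"

definition case_N1ii :: "'a::field set \<Rightarrow> 'a poly4 \<Rightarrow> 'a poly4 \<Rightarrow> bool" where
  "case_N1ii R F G \<longleftrightarrow> F = F_1 \<and>
     (\<exists>a1 a2 a3 a4 a5 a6 a7 a8 b1 b2 b3.
        a1 * a2 \<noteq> 0 \<and> b1 \<in> {0, 1} \<and> b2 \<in> {0} \<union> R \<and> b3 \<in> {0, 1} \<and>
        G = (const a1 * py + const a2 * pz) * px ^ 2 + const a3 * py * pz * px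
              + const b1 * py ^ 2 * pz + const b2 * py * pz ^ 2
              + (const a4 * py ^ 2 + const a5 * py * pz + const b3 * pz ^ 2) * pw
              + (const a6 * py + const a7 * pz) * pw ^ 2 + const a8 * pw ^ 3)"

definition case_N2 :: "'a::field \<Rightarrow> 'a poly4 \<Rightarrow> 'a poly4 \<Rightarrow> bool" where
  "case_N2 \<epsilon> F G \<longleftrightarrow> F = F_2 \<epsilon> \<and>
     (\<exists>a1 a2 a3 a4 a5 a6 a7 a8 a9 a10 b1 b2.
        (a1, a2) \<noteq> (0, 0) \<and> b1 \<in> {0, 1} \<and> b2 \<in> {0, 1} \<and>
        G = (const a1 * py + const a2 * pz) * px ^ 2
              + const a3 * (py ^ 2 - const \<epsilon> * pz ^ 2) * px
              + const b1 * py * (py ^ 2 - const \<epsilon> * pz ^ 2)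
              + const a4 * py * (py ^ 2 + 3 * const \<epsilon> * pz ^ 2)
              + const a5 * pz * (3 * py ^ 2 + const \<epsilon> * pz ^ 2)
              + (const a6 * py ^ 2 + const a7 * py * pz + const b2 * pz ^ 2) * pw
              + (const a8 * py + const a9 * pz) * pw ^ 2 + const a10 * pw ^ 3)"

definition standard_form :: "'a::field \<Rightarrow> 'a set \<Rightarrow> 'a poly4 \<Rightarrow> 'a poly4 \<Rightarrow> bool" where
  "standard_form \<epsilon> R F G \<longleftrightarrow>
     genus_4 F G \<and> \<not> hyperelliptic F G \<and> irreducible_curve F G \<and> smooth_curve F G \<and>
     (case_D F G \<or> case_N1i R F G \<or> case_N1ii R F G \<or> case_N2 \<epsilon> F G)"

end

theory Submission
  imports Defs
begin

text \<open>For $X = V(F, G)$ the Koszul resolution of $O_X$ gives a surjection from $H^1(X, O_X)$ onto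
  $H^3(P^3, O(-5))$ under which Frobenius becomes $e \mapsto e^3 (F G)^2$. Hence the Hasse--Witt
  matrix is conjugate to a matrix of coefficients of $(F G)^2$, quadratic in the coefficients of $G$.
  Over the field with three elements, $p$-rank 0 and $a$-number 3 say that this matrix has rank 1 and
  trace 0. Most coefficients of $G$ are then determined by the others, and each remaining $G$ has a
  singular point with coordinates in a field with 3, 9 or 27 elements.\<close>

text \<open>Rank at most one and nilpotency pass to quotients; this is what makes a surjection from
  H^1(X, O_X) enough. Its target has the basis 1/(x y z w u), u a coordinate, so the matrix is
  indexed by coordinates. Frobenius fixes the scalars, so all twists disappear and p-rank 0 means a
  nilpotent matrix.

  The connecting maps are made explicit: a cocycle is lifted to coefficients of F and G on triple
  overlaps, and the coboundary of the lift is a relation between F and G. This needs (G, -F) to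
  generate all relations in every localization, which follows once F is prime and does not divide G.
  Primality is cheap because F is linear in w with a monomial coefficient.

  The enumeration stays small because one entry of the matrix is a unit: a1^2 (once a1 is nonzero),
  a1 a2, or a1^2 + a2^2, a norm from the field with nine elements. Rank one then expresses every
  entry by the row and column of that unit, which eliminates several coefficients before any case
  split. The fields with 9 and 27 elements enter through i^2 = -1 and t^3 = t - 1.\<close>

primrec idx :: "coord \<Rightarrow> int" where
  "idx CX = 0" | "idx CY = 1" | "idx CZ = 2" | "idx CW = 3"

lemma idx_eq_iff: "idx i = idx j \<longleftrightarrow> i = j"
  by (cases i; cases j) auto

text \<open>A linear order on the variables induces one on exponents, which makes the Laurent
  polynomials over a field an integral domain.\<close>

instantiation coord :: linorder
begin

definition "i \<le> j \<longleftrightarrow> idx i \<le> idx j"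
definition "i < j \<longleftrightarrow> idx i < idx j"

instance
  by standard (auto simp: less_eq_coord_def less_coord_def idx_eq_iff[symmetric])

end

lemma UNIV_coord: "(UNIV :: coord set) = {CX, CY, CZ, CW}"
  using coord.exhaust by blast

lemma all_coord: "(\<forall>i. P i) \<longleftrightarrow> P CX \<and> P CY \<and> P CZ \<and> P CW"
  by (metis coord.exhaust)

section \<open>Restricting a Laurent polynomial to a set of monomials\<close>

definition part :: "('e \<Rightarrow> bool) \<Rightarrow> ('e \<Rightarrow>\<^sub>0 'a::zero) \<Rightarrow> ('e \<Rightarrow>\<^sub>0 'a)" where
  "part P f = Poly_Mapping.mapp (\<lambda>e c. c when P e) f"

lemma lookup_part: "Poly_Mapping.lookup (part P f) e = (Poly_Mapping.lookup f e when P e)"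
  by (simp add: part_def lookup_mapp when_def in_keys_iff)

lemma keys_part: "Poly_Mapping.keys (part P f) = {e \<in> Poly_Mapping.keys f. P e}"
  by (auto simp: in_keys_iff lookup_part)

lemma part_add: "part P (f + g) = part P f + part P (g :: 'e \<Rightarrow>\<^sub>0 'a::comm_monoid_add)"
  by (rule poly_mapping_eqI) (simp add: lookup_part lookup_add when_add_distrib)

lemma part_diff: "part P (f - g) = part P f - part P (g :: 'e \<Rightarrow>\<^sub>0 'a::ab_group_add)"
  by (rule poly_mapping_eqI) (simp add: lookup_part lookup_minus when_diff_distrib)

lemma part_zero [simp]: "part P 0 = 0"
  by (rule poly_mapping_eqI) (simp add: lookup_part)

lemma part_id: "(\<And>e. e \<in> Poly_Mapping.keys f \<Longrightarrow> P e) \<Longrightarrow> part P f = f"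
  by (rule poly_mapping_eqI) (auto simp: lookup_part when_def in_keys_iff)

lemma part_eq_0: "(\<And>e. e \<in> Poly_Mapping.keys f \<Longrightarrow> \<not> P e) \<Longrightarrow> part P f = 0"
  by (rule poly_mapping_eqI) (auto simp: lookup_part when_def in_keys_iff)

lemma keys_minus': "Poly_Mapping.keys (- f) = Poly_Mapping.keys (f :: 'e \<Rightarrow>\<^sub>0 'a::ab_group_add)"
  by (auto simp: in_keys_iff)

lemma keys_diff': "Poly_Mapping.keys (f - g) \<subseteq> Poly_Mapping.keys f \<union> Poly_Mapping.keys (g :: 'e \<Rightarrow>\<^sub>0 'a::ab_group_add)"
  by (auto simp: in_keys_iff lookup_minus)

lemma poly_mapping_sum_singles:
  "f = (\<Sum>e\<in>Poly_Mapping.keys f. Poly_Mapping.single e (Poly_Mapping.lookup f e))"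
proof (rule poly_mapping_eqI)
  fix e
  show "Poly_Mapping.lookup f e =
      Poly_Mapping.lookup (\<Sum>e\<in>Poly_Mapping.keys f. Poly_Mapping.single e (Poly_Mapping.lookup f e)) e"
    by (simp add: lookup_sum lookup_single when_def in_keys_iff)
qed

lemma lookup_single_mult:
  fixes f :: "'e::ab_group_add \<Rightarrow>\<^sub>0 'a::semiring_0"
  shows "Poly_Mapping.lookup (Poly_Mapping.single e c * f) k = c * Poly_Mapping.lookup f (k - e)"
proof -
  have "Poly_Mapping.lookup (Poly_Mapping.single e c * f) k =
     Sum_any (\<lambda>l. c * Sum_any (\<lambda>q. Poly_Mapping.lookup f q when k = l + q) when e = l)"
    by (simp add: lookup_mult lookup_single when_mult)
  also have "\<dots> = c * Sum_any (\<lambda>q. Poly_Mapping.lookup f q when k = e + q)"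
    by simp
  also have "(\<lambda>q. Poly_Mapping.lookup f q when k = e + q) = (\<lambda>q. Poly_Mapping.lookup f q when k - e = q)"
    by (auto simp: when_def algebra_simps fun_eq_iff)
  finally show ?thesis by simp
qed

section \<open>Localizations\<close>

lemma localized_0 [simp]: "0 \<in> localized I"
  by (simp add: localized_def)

lemma localized_add: "f \<in> localized I \<Longrightarrow> g \<in> localized I \<Longrightarrow> f + g \<in> localized I"
  using keys_add[of f g] unfolding localized_def by blast

lemma localized_uminus: "f \<in> localized I \<Longrightarrow> - f \<in> localized I"
  unfolding localized_def by (simp add: keys_minus')

lemma localized_diff: "f \<in> localized I \<Longrightarrow> g \<in> localized I \<Longrightarrow> f - g \<in> localized I"
  using keys_diff'[of f g] unfolding localized_def by blast

lemma localized_mult: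
  assumes "f \<in> localized I" "g \<in> localized I"
  shows "f * g \<in> localized I"
  unfolding localized_def
proof (clarify)
  fix q i assume i: "i \<notin> I" and "q \<in> Poly_Mapping.keys (f * g)"
  then obtain u v where "q = u + v" "u \<in> Poly_Mapping.keys f" "v \<in> Poly_Mapping.keys g"
    using keys_mult by blast
  with assms i show "0 \<le> Poly_Mapping.lookup q i"
    by (simp add: localized_def lookup_add)
qed

lemma localized_mono: "I \<subseteq> J \<Longrightarrow> localized I \<subseteq> localized J"
  by (auto simp: localized_def)

lemma localized_UNIV [simp]: "f \<in> localized UNIV"
  by (simp add: localized_def)

lemma localized_one [simp]: "1 \<in> localized I"
  by (simp add: localized_def)

lemma localized_power: "f \<in> localized I \<Longrightarrow> f ^ n \<in> localized I"
  by (induction n) (auto intro: localized_mult)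

lemma localized_sum: "(\<And>a. a \<in> A \<Longrightarrow> f a \<in> localized I) \<Longrightarrow> sum f A \<in> localized I"
  by (induction A rule: infinite_finite_induct) (auto intro: localized_add)

lemma localized_const: "const c \<in> localized I"
  by (auto simp: localized_def const_def)

lemma to_laurent_localized: "to_laurent f \<in> localized {}"
  unfolding to_laurent_def
  by (rule localized_sum) (auto simp: localized_def Poly_Mapping.map.rep_eq when_def)

section \<open>Homogeneous components and elimination of a variable\<close>

text \<open>The grading \<open>\<mu>\<close> is an arbitrary additive function because two kinds
  occur: the exponent of one variable, and the difference of the exponents of x and w.\<close>

lemma part_homogeneous_mult:
  fixes f g :: "'a::comm_ring_1 laurent4"
  assumes add: "\<And>e e'. \<mu> (e + e') = \<mu> e + (\<mu> e' :: int)"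
    and f: "\<And>e. e \<in> Poly_Mapping.keys f \<Longrightarrow> \<mu> e = d"
  shows "part (\<lambda>e. \<mu> e = k) (f * g) = f * part (\<lambda>e. \<mu> e = k - d) g"
proof -
  have "part (\<lambda>e. \<mu> e = k - d) g + part (\<lambda>e. \<mu> e \<noteq> k - d) g = g"
    by (rule poly_mapping_eqI) (simp add: lookup_add lookup_part when_def)
  then have "f * g = f * part (\<lambda>e. \<mu> e = k - d) g + f * part (\<lambda>e. \<mu> e \<noteq> k - d) g"
    by (simp flip: distrib_left)
  then have "part (\<lambda>e. \<mu> e = k) (f * g) = part (\<lambda>e. \<mu> e = k) (f * part (\<lambda>e. \<mu> e = k - d) g)
      + part (\<lambda>e. \<mu> e = k) (f * part (\<lambda>e. \<mu> e \<noteq> k - d) g)"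
    by (simp only: part_add)
  also have "part (\<lambda>e. \<mu> e = k) (f * part (\<lambda>e. \<mu> e = k - d) g) = f * part (\<lambda>e. \<mu> e = k - d) g"
  proof (rule part_id)
    fix q assume "q \<in> Poly_Mapping.keys (f * part (\<lambda>e. \<mu> e = k - d) g)"
    then obtain u v where "q = u + v" "u \<in> Poly_Mapping.keys f" "v \<in> Poly_Mapping.keys (part (\<lambda>e. \<mu> e = k - d) g)"
      using keys_mult by blast
    then show "\<mu> q = k" using f[of u] by (simp add: keys_part add)
  qed
  also have "part (\<lambda>e. \<mu> e = k) (f * part (\<lambda>e. \<mu> e \<noteq> k - d) g) = 0"
  proof (rule part_eq_0)
    fix q assume "q \<in> Poly_Mapping.keys (f * part (\<lambda>e. \<mu> e \<noteq> k - d) g)"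
    then obtain u v where "q = u + v" "u \<in> Poly_Mapping.keys f" "v \<in> Poly_Mapping.keys (part (\<lambda>e. \<mu> e \<noteq> k - d) g)"
      using keys_mult by blast
    then show "\<mu> q \<noteq> k" using f[of u] by (simp add: keys_part add)
  qed
  finally show ?thesis by simp
qed

lemma part_Min_neq_0:
  assumes "h \<noteq> 0"
  shows "part (\<lambda>e. \<mu> e = Min (\<mu> ` Poly_Mapping.keys h)) h \<noteq> (0 :: 'e \<Rightarrow>\<^sub>0 'a::zero)"
    and "part (\<lambda>e. \<mu> e = Max (\<mu> ` Poly_Mapping.keys h)) h \<noteq> (0 :: 'e \<Rightarrow>\<^sub>0 'a::zero)"
proof -
  have ne: "Poly_Mapping.keys h \<noteq> {}"
    using assms part_id[of h "\<lambda>_. False"] part_eq_0[of h "\<lambda>_. False"] by auto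
  have nz: "part P h \<noteq> 0" if "e \<in> Poly_Mapping.keys h" "P e" for P e
  proof
    assume "part P h = 0"
    then have "Poly_Mapping.lookup (part P h) e = 0" by simp
    with that show False by (simp add: lookup_part in_keys_iff)
  qed
  show "part (\<lambda>e. \<mu> e = Min (\<mu> ` Poly_Mapping.keys h)) h \<noteq> 0"
    using Min_in[of "\<mu> ` Poly_Mapping.keys h"] ne nz by (metis (mono_tags, lifting) finite_imageI finite_keys image_iff image_is_empty)
  show "part (\<lambda>e. \<mu> e = Max (\<mu> ` Poly_Mapping.keys h)) h \<noteq> 0"
    using Max_in[of "\<mu> ` Poly_Mapping.keys h"] ne nz by (metis (mono_tags, lifting) finite_imageI finite_keys image_iff image_is_empty)
qed

text \<open>\<open>f0\<close> says that no variable divides \<open>f\<close>. The component of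
  \<open>f * e\<close> of lowest degree in the variable \<open>i\<close> is then the product of the
  lowest components of both factors, so a pole of \<open>e\<close> along \<open>i\<close> survives
  in \<open>f * e\<close>.\<close>

lemma localized_cancel:
  fixes f e :: "'a::idom laurent4"
  assumes f: "f \<in> localized {}" and f0: "\<And>i. part (\<lambda>m. Poly_Mapping.lookup m i = 0) f \<noteq> 0"
    and fe: "f * e \<in> localized I"
  shows "e \<in> localized I"
proof (cases "e = 0")
  case False
  show ?thesis
    unfolding localized_def
  proof (clarify, rule ccontr)
    fix m i
    assume m: "m \<in> Poly_Mapping.keys e" and i: "i \<notin> I" and "\<not> 0 \<le> Poly_Mapping.lookup m i"
    define k where "k = Min ((\<lambda>m. Poly_Mapping.lookup m i) ` Poly_Mapping.keys e)"
    have kle: "k \<le> Poly_Mapping.lookup m i" if "m \<in> Poly_Mapping.keys e" for m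
      unfolding k_def using that by (intro Min_le) auto
    with m \<open>\<not> 0 \<le> _\<close> have k: "k < 0" by force
    let ?p = "\<lambda>k. part (\<lambda>m. Poly_Mapping.lookup m i = k)"
    let ?f' = "part (\<lambda>m. Poly_Mapping.lookup m i \<noteq> 0) f"
    have fsplit: "f = ?p 0 f + ?f'"
      by (rule poly_mapping_eqI) (simp add: lookup_add lookup_part when_def)
    have "f * e = ?p 0 f * e + ?f' * e"
      by (subst (1) fsplit) (rule distrib_right)
    then have "?p k (f * e) = ?p k (?p 0 f * e) + ?p k (?f' * e)"
      by (simp only: part_add)
    also have "?p k (?p 0 f * e) = ?p 0 f * ?p (k - 0) e"
      by (rule part_homogeneous_mult[where \<mu> = "\<lambda>m. Poly_Mapping.lookup m i"])
        (simp_all add: lookup_add keys_part)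
    also have "?p k (?f' * e) = 0"
    proof (rule part_eq_0)
      fix q assume "q \<in> Poly_Mapping.keys (?f' * e)"
      then obtain u v where uv: "q = u + v" "u \<in> Poly_Mapping.keys ?f'" "v \<in> Poly_Mapping.keys e"
        using keys_mult by blast
      have "Poly_Mapping.lookup u i > 0"
        using uv(2) f by (auto simp: keys_part localized_def order_less_le)
      then show "Poly_Mapping.lookup q i \<noteq> k"
        using kle[OF uv(3)] by (simp add: uv(1) lookup_add)
    qed
    finally have "?p k (f * e) \<noteq> 0"
      using f0[of i] part_Min_neq_0(1)[OF False, of "\<lambda>m. Poly_Mapping.lookup m i"] by (simp add: k_def)
    then obtain q where "q \<in> Poly_Mapping.keys (f * e)" "Poly_Mapping.lookup q i = k"
      using part_eq_0[of "f * e" "\<lambda>m. Poly_Mapping.lookup m i = k"] by blast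
    with fe i k show False unfolding localized_def by fastforce
  qed
qed simp

definition free_of :: "coord \<Rightarrow> 'a::zero laurent4 \<Rightarrow> bool" where
  "free_of v f \<longleftrightarrow> (\<forall>e\<in>Poly_Mapping.keys f. Poly_Mapping.lookup e v = 0)"

lemma free_of_add: "free_of v f \<Longrightarrow> free_of v g \<Longrightarrow> free_of v (f + g)"
  using keys_add[of f g] unfolding free_of_def by blast

lemma free_of_mult: "free_of v f \<Longrightarrow> free_of v g \<Longrightarrow> free_of v (f * g)"
  using keys_mult[of f g] unfolding free_of_def by (fastforce simp: lookup_add)

lemma free_of_uminus: "free_of v f \<Longrightarrow> free_of v (- f :: 'a::ab_group_add laurent4)"
  by (simp add: free_of_def keys_minus')

lemma single_var_power:
  "Poly_Mapping.single (Poly_Mapping.single v 1) 1 ^ n =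
     (Poly_Mapping.single (Poly_Mapping.single v (int n)) 1 :: 'a::comm_ring_1 laurent4)"
  by (induction n) (simp_all add: mult_single single_add [symmetric] add.commute)

lemma single_eq_0_iff [simp]: "Poly_Mapping.single k c = 0 \<longleftrightarrow> c = 0"
  by (metis lookup_single_eq lookup_zero single_zero)

text \<open>$F$ is linear in the variable $v$ with invertible leading coefficient $s$, so modulo $F$ the
  variable $v$ can be eliminated from every Laurent polynomial without negative powers of $v$.\<close>

locale linear_in_var =
  fixes v :: coord and m :: "coord \<Rightarrow>\<^sub>0 int" and c :: "'a::field" and q F :: "'a laurent4"
  assumes c: "c \<noteq> 0" and m: "Poly_Mapping.lookup m v = 0" and q0: "q \<noteq> 0" and q: "free_of v q"
    and F_eq: "F = Poly_Mapping.single m c * Poly_Mapping.single (Poly_Mapping.single v 1) 1 + q"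
begin

abbreviation xv :: "'a laurent4" where "xv \<equiv> Poly_Mapping.single (Poly_Mapping.single v 1) 1"
abbreviation s :: "'a laurent4" where "s \<equiv> Poly_Mapping.single m c"
abbreviation s' :: "'a laurent4" where "s' \<equiv> Poly_Mapping.single (- m) (inverse c)"

lemma s_inverse: "s' * s = 1"
  using c by (simp add: mult_single)

lemma xv_eq: "xv = s' * F - s' * q"
proof -
  have "s' * F = (s' * s) * xv + s' * q"
    by (simp add: F_eq algebra_simps)
  then show ?thesis by (simp add: s_inverse)
qed

text \<open>If the \<open>v\<close>-degrees in \<open>h\<close> range from a to b, those in F h
  range from a to b + 1, and both extreme components are nonzero. A product free of \<open>v\<close>
  would force a = 0 and b = -1.\<close>

lemma F_dvd_free_of:
  assumes "F dvd r" "free_of v r"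
  shows "r = 0"
proof -
  obtain h where h: "r = F * h" using assms(1) by (elim dvdE)
  have "h = 0"
  proof (rule ccontr)
    assume h0: "h \<noteq> 0"
    let ?deg = "\<lambda>e. Poly_Mapping.lookup e v"
    let ?p = "\<lambda>k. part (\<lambda>e. ?deg e = k)"
    define a where "a = Min (?deg ` Poly_Mapping.keys h)"
    define b where "b = Max (?deg ` Poly_Mapping.keys h)"
    have range: "a \<le> ?deg e \<and> ?deg e \<le> b" if "e \<in> Poly_Mapping.keys h" for e
      using that by (auto simp: a_def b_def)
    have F_comp: "?p k r = (s * xv) * ?p (k - 1) h + q * ?p (k - 0) h" for k
    proof -
      have "?p k ((s * xv) * h) = (s * xv) * ?p (k - 1) h"
        by (rule part_homogeneous_mult[where \<mu> = ?deg])
          (use m in \<open>simp_all add: lookup_add mult_single split: if_splits\<close>)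
      moreover have "?p k (q * h) = q * ?p (k - 0) h"
        by (rule part_homogeneous_mult[where \<mu> = ?deg])
          (use q in \<open>simp_all add: lookup_add free_of_def\<close>)
      moreover have "r = (s * xv) * h + q * h"
        by (simp add: h F_eq distrib_right)
      ultimately show ?thesis by (simp only: part_add)
    qed
    have r_comp: "?p k r = 0" if "k \<noteq> 0" for k
      using assms(2) that by (intro part_eq_0) (auto simp: free_of_def)
    have ha: "?p a h \<noteq> 0" and hb: "?p b h \<noteq> 0"
      using part_Min_neq_0[OF h0, of ?deg] by (simp_all add: a_def b_def)
    have "?p (a - 1) h = 0" "?p (b + 1) h = 0"
      by (rule part_eq_0, use range in force)+
    then have "?p a r \<noteq> 0" "?p (b + 1) r \<noteq> 0"
      using F_comp[of a] F_comp[of "b + 1"] ha hb q0 c by (simp_all add: mult_single)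
    then have "a = 0" "b + 1 = 0"
      using r_comp by blast+
    moreover obtain e where "e \<in> Poly_Mapping.keys h"
      using ha part_eq_0[of h "\<lambda>e. ?deg e = a"] by blast
    ultimately show False using range by force
  qed
  then show ?thesis by (simp add: h)
qed

text \<open>Each further factor \<open>v\<close> is traded for -s' q modulo F by
  \<open>xv_eq\<close>, which keeps the remainder free of \<open>v\<close>.\<close>

lemma reduce_step:
  assumes "f = F * h + r" "free_of v r"
  shows "\<exists>h' r'. xv ^ n * f = F * h' + r' \<and> free_of v r'"
proof (induction n)
  case 0
  show ?case using assms by auto
next
  case (Suc n)
  then obtain h' r' where h': "xv ^ n * f = F * h' + r'" and r': "free_of v r'"
    by blast
  have "xv ^ Suc n * f = xv * (xv ^ n * f)"
    by (simp add: mult.assoc)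
  also have "\<dots> = F * (xv * h') + xv * r'"
    by (simp only: h') (simp add: algebra_simps)
  also have "xv * r' = F * (s' * r') + (- s' * q) * r'"
    by (subst xv_eq) (simp add: algebra_simps)
  finally have "xv ^ Suc n * f = F * (xv * h' + s' * r') + (- s' * q) * r'"
    by (simp add: algebra_simps)
  moreover have "free_of v ((- s' * q) * r')"
    using q r' m by (intro free_of_mult free_of_uminus) (simp_all add: free_of_def)
  ultimately show ?case by blast
qed

text \<open>The power of \<open>v\<close> clears the negative exponents of \<open>v\<close> in
  \<open>f\<close>. It is a unit among Laurent polynomials, so divisibility by F is not
  affected.\<close>

lemma eliminate: "\<exists>n h r. xv ^ n * f = F * h + r \<and> free_of v r"
proof -
  let ?P = "\<lambda>f. \<exists>n h r. xv ^ n * f = F * h + r \<and> free_of v r"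
  have add: "?P (f + g)" if f: "?P f" and g: "?P g" for f g
  proof -
    from f g obtain n h r n' h' r' where *: "xv ^ n * f = F * h + r" "free_of v r"
      "xv ^ n' * g = F * h' + r'" "free_of v r'" by blast
    obtain h1 r1 where 1: "xv ^ n' * (xv ^ n * f) = F * h1 + r1" "free_of v r1"
      using reduce_step[OF *(1,2)] by blast
    obtain h2 r2 where 2: "xv ^ n * (xv ^ n' * g) = F * h2 + r2" "free_of v r2"
      using reduce_step[OF *(3,4)] by blast
    have "xv ^ (n + n') * (f + g) = xv ^ n' * (xv ^ n * f) + xv ^ n * (xv ^ n' * g)"
      by (simp add: power_add algebra_simps)
    also have "\<dots> = F * (h1 + h2) + (r1 + r2)"
      by (simp only: 1 2) (simp add: algebra_simps)
    finally show ?thesis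
      using 1(2) 2(2) free_of_add by blast
  qed
  have single: "?P (Poly_Mapping.single e d)" for e d
  proof (cases "Poly_Mapping.lookup e v \<ge> 0")
    case True
    define k where "k = nat (Poly_Mapping.lookup e v)"
    let ?f = "Poly_Mapping.single (e - Poly_Mapping.single v (int k)) d"
    have "free_of v ?f"
      using True by (auto simp: free_of_def k_def lookup_minus)
    then obtain h r where "xv ^ k * ?f = F * h + r" "free_of v r"
      using reduce_step[of ?f 0 ?f k] by auto
    then have "xv ^ 0 * Poly_Mapping.single e d = F * h + r" "free_of v r"
      by (simp_all add: single_var_power mult_single)
    then show ?thesis by blast
  next
    case False
    define k where "k = nat (- Poly_Mapping.lookup e v)"
    have "xv ^ k * Poly_Mapping.single e d = F * 0 + Poly_Mapping.single (Poly_Mapping.single v (int k) + e) d"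
      by (simp add: single_var_power mult_single)
    moreover have "free_of v (Poly_Mapping.single (Poly_Mapping.single v (int k) + e) d)"
      using False by (auto simp: free_of_def k_def lookup_add)
    ultimately show ?thesis by blast
  qed
  have "?P (\<Sum>e\<in>A. Poly_Mapping.single e (Poly_Mapping.lookup f e))" for A
  proof (induction A rule: infinite_finite_induct)
    case (insert x A)
    then show ?case using add[OF single insert.IH] by simp
  qed (use single[of 0 0] in simp_all)
  then show ?thesis
    by (subst poly_mapping_sum_singles[of f])
qed

lemma xv_power_dvd:
  assumes "F dvd xv ^ n * f"
  shows "F dvd f"
proof -
  have "Poly_Mapping.single (Poly_Mapping.single v (- int n)) 1 * (xv ^ n * f) = f"
    by (simp add: single_var_power mult_single flip: mult.assoc single_add)
  with assms show ?thesis by (metis dvd_mult)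
qed

text \<open>Both factors may be replaced by remainders free of \<open>v\<close>. Their product is
  free of \<open>v\<close> and divisible by F, hence zero, and there are no zero divisors.\<close>

lemma F_prime:
  assumes "F dvd f * g"
  shows "F dvd f \<or> F dvd g"
proof -
  obtain n h r where 1: "xv ^ n * f = F * h + r" "free_of v r" using eliminate by blast
  obtain n' h' r' where 2: "xv ^ n' * g = F * h' + r'" "free_of v r'" using eliminate by blast
  have "xv ^ (n + n') * (f * g) = (xv ^ n * f) * (xv ^ n' * g)"
    by (simp add: power_add algebra_simps)
  also have "\<dots> = (F * h + r) * (F * h' + r')"
    by (simp only: 1 2)
  also have "\<dots> = F * (h * (F * h' + r') + r * h') + r * r'"
    by (simp add: algebra_simps)
  finally have "r * r' = xv ^ (n + n') * (f * g) - F * (h * (F * h' + r') + r * h')"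
    by simp
  moreover have "F dvd xv ^ (n + n') * (f * g) - F * (h * (F * h' + r') + r * h')"
    by (rule dvd_diff[OF dvd_mult[OF assms] dvd_triv_left])
  ultimately have "r * r' = 0"
    using F_dvd_free_of free_of_mult 1(2) 2(2) by metis
  then consider "r = 0" | "r' = 0" by auto
  then show ?thesis
  proof cases
    case 1
    then show ?thesis using \<open>xv ^ n * f = F * h + r\<close> xv_power_dvd[of n f] by simp
  next
    case 2
    then show ?thesis using \<open>xv ^ n' * g = F * h' + r'\<close> xv_power_dvd[of n' g] by simp
  qed
qed

text \<open>Since F has degree 0 for the grading \<open>\<mu>\<close>, it would divide each graded
  component of G, in particular one that is nonzero and free of \<open>v\<close>.\<close>

lemma F_not_dvd:
  assumes add: "\<And>e e'. \<mu> (e + e') = \<mu> e + (\<mu> e' :: int)"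
    and F: "\<And>e. e \<in> Poly_Mapping.keys F \<Longrightarrow> \<mu> e = 0"
    and G: "free_of v (part (\<lambda>e. \<mu> e = d) G)" "part (\<lambda>e. \<mu> e = d) G \<noteq> 0"
  shows "\<not> F dvd G"
proof
  assume "F dvd G"
  then obtain h where "G = F * h" by (elim dvdE)
  then have "part (\<lambda>e. \<mu> e = d) G = F * part (\<lambda>e. \<mu> e = d - 0) h"
    using part_homogeneous_mult[of \<mu> F 0 d h] add F by simp
  then have "F dvd part (\<lambda>e. \<mu> e = d) G" by (metis dvd_triv_left)
  then show False using F_dvd_free_of G by blast
qed

text \<open>Exactness of the Koszul complex in the middle: F divides b G, hence b. The quotient has
  no new denominators by \<open>localized_cancel\<close>.\<close>

lemma syzygy:
  assumes F: "F \<in> localized {}" "\<And>i. part (\<lambda>e. Poly_Mapping.lookup e i = 0) F \<noteq> 0"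
    and "\<not> F dvd G" and ab: "a * F + b * G = 0" and b: "b \<in> localized I"
  shows "\<exists>e\<in>localized I. a = e * G \<and> b = - e * F"
proof -
  have F0: "F \<noteq> 0" using F(2)[of v] by auto
  have "b * G = F * (- a)" using ab by (simp add: algebra_simps add_eq_0_iff)
  then have "F dvd b * G" by (metis dvd_triv_left)
  then have "F dvd b" using F_prime \<open>\<not> F dvd G\<close> by blast
  then obtain e where e: "b = F * e" by (elim dvdE)
  have "e \<in> localized I"
    using localized_cancel[OF F] b e by blast
  moreover have "F * (a + e * G) = 0"
    using ab by (simp add: e algebra_simps)
  then have "a = (- e) * G" using F0 by (simp add: add_eq_0_iff)
  ultimately show ?thesis
    using localized_uminus[of e I] by (intro bexI[of _ "- e"]) (auto simp: e algebra_simps)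
qed

end

section \<open>The ordered Cech complex\<close>

text \<open>The usual alternating sum over omitted indices, for cochains on arbitrary lists,
  repetitions included. The recursion on the first index turns the identities of the complex into
  plain list inductions.\<close>

fun cobd :: "(coord list \<Rightarrow> 'm::ab_group_add) \<Rightarrow> coord list \<Rightarrow> 'm" where
  "cobd C [] = 0"
| "cobd C (n # l) = C l - cobd (\<lambda>m. C (n # m)) l"

lemma cobd_additive:
  fixes h :: "'m::ab_group_add \<Rightarrow> 'n::ab_group_add"
  assumes "\<And>x y. h (x - y) = h x - h y"
  shows "cobd (\<lambda>m. h (C m)) l = h (cobd C l)"
proof (induction l arbitrary: C)
  case Nil
  show ?case using assms[of 0 0] by simp
qed (simp add: assms)

lemma cobd_diff: "cobd (\<lambda>m. C m - C' m) l = cobd C l - cobd C' l"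
  by (induction l arbitrary: C C') (simp_all add: algebra_simps)

lemma cobd_add: "cobd (\<lambda>m. C m + C' m) l = cobd C l + cobd C' l"
  by (induction l arbitrary: C C') (simp_all add: algebra_simps)

lemma cobd_zero: "cobd (\<lambda>m. 0) l = 0"
  by (induction l) simp_all

lemma cobd_sum: "cobd (\<lambda>m. \<Sum>n\<in>A. C n m) l = (\<Sum>n\<in>A. cobd (C n) l)"
  by (induction A rule: infinite_finite_induct) (simp_all add: cobd_add cobd_zero)

lemma cobd_cobd: "cobd (cobd C) l = 0"
proof (induction l arbitrary: C)
  case (Cons n l)
  have "cobd (cobd C) (n # l) = cobd C l - (cobd C l - cobd (cobd (\<lambda>m. C (n # m))) l)"
    by (simp add: cobd_diff)
  then show ?case using Cons by simp
qed simp

text \<open>Every monomial with a nonnegative exponent has a distinguished one, \<open>pivot\<close>; prepending it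
  to the index list is a contracting homotopy on the span of these monomials.\<close>

definition pivot :: "(coord \<Rightarrow>\<^sub>0 int) \<Rightarrow> coord" where
  "pivot e = (SOME i. 0 \<le> Poly_Mapping.lookup e i)"

text \<open>The second conjunct discards monomials with only negative exponents, for which
  \<open>pivot\<close> is an arbitrary value.\<close>

definition contract :: "(coord list \<Rightarrow> 'a::comm_ring_1 laurent4) \<Rightarrow> coord list \<Rightarrow> 'a laurent4" where
  "contract C l = (\<Sum>n\<in>UNIV. part (\<lambda>e. pivot e = n \<and> 0 \<le> Poly_Mapping.lookup e n) (C (n # l)))"

lemma sum_part_pivot:
  assumes "\<And>e. e \<in> Poly_Mapping.keys f \<Longrightarrow> \<exists>i. 0 \<le> Poly_Mapping.lookup e i"
  shows "(\<Sum>n\<in>UNIV. part (\<lambda>e. pivot e = n \<and> 0 \<le> Poly_Mapping.lookup e n) f) = f"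
proof (rule poly_mapping_eqI)
  fix e
  have *: "Poly_Mapping.lookup f e = 0 \<or> 0 \<le> Poly_Mapping.lookup e (pivot e)"
    unfolding pivot_def using assms[of e] someI_ex[of "\<lambda>i. 0 \<le> Poly_Mapping.lookup e i"]
    by (metis in_keys_iff)
  have "(\<Sum>n\<in>UNIV. Poly_Mapping.lookup f e when (pivot e = n \<and> 0 \<le> Poly_Mapping.lookup e n))
      = (\<Sum>n\<in>{pivot e}. Poly_Mapping.lookup f e when (pivot e = n \<and> 0 \<le> Poly_Mapping.lookup e n))"
    by (rule sum.mono_neutral_right) auto
  then show "Poly_Mapping.lookup (\<Sum>n\<in>UNIV. part (\<lambda>e. pivot e = n \<and> 0 \<le> Poly_Mapping.lookup e n) f) e
      = Poly_Mapping.lookup f e"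
    using * by (auto simp: lookup_sum lookup_part)
qed

text \<open>For each n the cocycle condition at \<open>n # l\<close> reads C l = cobd (\<lambda>m. C
  (n # m)) l. Projecting this to the monomials with pivot n, which commutes with
  \<open>cobd\<close>, and summing over n gives the claim.\<close>

lemma cobd_contract:
  assumes "\<And>n. cobd C (n # l) = 0"
    and "\<And>e. e \<in> Poly_Mapping.keys (C l) \<Longrightarrow> \<exists>i. 0 \<le> Poly_Mapping.lookup e i"
  shows "cobd (contract C) l = C l"
proof -
  let ?p = "\<lambda>n. part (\<lambda>e. pivot e = n \<and> 0 \<le> Poly_Mapping.lookup e n)"
  have "cobd (contract C) l = (\<Sum>n\<in>UNIV. ?p n (cobd (\<lambda>m. C (n # m)) l))"
    unfolding contract_def
    by (simp add: cobd_sum cobd_additive[where h = "?p n" and C = "\<lambda>m. C (n # m)" for n, OF part_diff])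
  also have "\<dots> = (\<Sum>n\<in>UNIV. ?p n (C l))"
    using assms(1) by simp
  also have "\<dots> = C l"
    by (rule sum_part_pivot) (rule assms(2))
  finally show ?thesis .
qed

text \<open>The monomials kept from \<open>C (n # l)\<close> have nonnegative exponent in n, so the
  denominator n gained by prepending n disappears again.\<close>

lemma contract_localized:
  assumes "\<And>n. C (n # l) \<in> localized (insert n (set l))"
  shows "contract C l \<in> localized (set l)"
  unfolding contract_def
proof (rule localized_sum)
  fix n
  show "part (\<lambda>e. pivot e = n \<and> 0 \<le> Poly_Mapping.lookup e n) (C (n # l)) \<in> localized (set l)"
    using assms[of n] unfolding localized_def by (fastforce simp: keys_part)
qed

section \<open>Degrees of Laurent polynomials\<close>

lemma homogeneous_0 [simp]: "homogeneous d 0"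
  by (simp add: homogeneous_def)

lemma homogeneous_add: "homogeneous d f \<Longrightarrow> homogeneous d g \<Longrightarrow> homogeneous d (f + g)"
  using keys_add[of f g] by (auto simp: homogeneous_def)

lemma homogeneous_sum: "(\<And>a. a \<in> A \<Longrightarrow> homogeneous d (f a)) \<Longrightarrow> homogeneous d (sum f A)"
  by (induction A rule: infinite_finite_induct) (auto intro: homogeneous_add)

lemma homogeneous_part: "homogeneous d f \<Longrightarrow> homogeneous d (part P f)"
  by (simp add: homogeneous_def keys_part)

lemma mdeg_add: "mdeg (e + e') = mdeg e + mdeg e'"
  by (simp add: mdeg_def lookup_add sum.distrib)

lemma homogeneous_mult:
  assumes "homogeneous d f" "homogeneous d' g"
  shows "homogeneous (d + d') (f * g)"
  unfolding homogeneous_def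
proof
  fix q assume "q \<in> Poly_Mapping.keys (f * g)"
  then obtain u v where "q = u + v" "u \<in> Poly_Mapping.keys f" "v \<in> Poly_Mapping.keys g"
    using keys_mult by blast
  with assms show "mdeg q = d + d'" by (simp add: homogeneous_def mdeg_add)
qed

lemma homogeneous_contract:
  "(\<And>n. homogeneous d (C (n # l))) \<Longrightarrow> homogeneous d (contract C l)"
  unfolding contract_def by (intro homogeneous_sum homogeneous_part)

lemma sum_coord: "(\<Sum>i\<in>UNIV. f i) = f CX + f CY + f CZ + f CW"
  by (simp add: UNIV_coord add.assoc)

text \<open>This is the vanishing of cohomology in degrees above -4: every monomial has a pivot
  there, so the contraction applies to O, O(-2) and O(-3), but not to O(-5).\<close>

lemma mdeg_nonneg_exponent:
  fixes e :: "coord \<Rightarrow>\<^sub>0 int"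
  assumes "- 4 < mdeg e"
  shows "\<exists>i. 0 \<le> Poly_Mapping.lookup e i"
proof (rule ccontr)
  assume "\<not> ?thesis"
  then have "Poly_Mapping.lookup e i \<le> - 1" for i
  proof -
    have "\<not> 0 \<le> Poly_Mapping.lookup e i" using \<open>\<not> (\<exists>i. _)\<close> by blast
    then show ?thesis by linarith
  qed
  from this[of CX] this[of CY] this[of CZ] this[of CW] show False
    using assms by (simp add: mdeg_def sum_coord)
qed

text \<open>The sign of the permutation sorting the list, and 0 if an index is repeated. Multiplying
  by it spreads a section over the fourfold overlap to an alternating cochain on all lists of length
  4.\<close>

primrec orientation :: "coord list \<Rightarrow> int" where
  "orientation [] = 1"
| "orientation (n # l) = prod_list (map (\<lambda>m. sgn (idx m - idx n)) l) * orientation l"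

lemma orientation_neq_0: "orientation l \<noteq> 0 \<Longrightarrow> distinct l"
  by (induction l) (force simp: prod_list_zero_iff image_iff)+

text \<open>Five indices among four coordinates contain a repetition; only the terms omitting one of
  the two equal indices can be nonzero, and they cancel. The proof checks all 4^5 lists.\<close>

lemma orientation_cocycle: "length l = 5 \<Longrightarrow> cobd orientation l = 0"
proof -
  have "\<forall>a b c d e. cobd orientation [a, b, c, d, e] = 0"
    by (simp add: all_coord)
  moreover assume "length l = 5"
  then obtain a b c d e where "l = [a, b, c, d, e]"
    by (auto simp: numeral_eq_Suc length_Suc_conv)
  ultimately show ?thesis by blast
qed

section \<open>The connecting map $H^1(X, O_X) \to H^3(P^3, O(-5))$\<close>

lemma cube_diff:
  fixes x y :: "'a::comm_ring_1"
  assumes "(3::'a) = 0"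
  shows "(x - y) ^ 3 = x ^ 3 - y ^ 3"
proof -
  have "(x - y) ^ 3 = x ^ 3 - y ^ 3 - 3 * (x ^ 2 * y - x * y ^ 2)"
    by (simp add: power3_eq_cube power2_eq_square algebra_simps)
  then show ?thesis using assms by simp
qed

text \<open>The exponent of 1/(x y z w u). These four are the only exponents of degree -5 with all
  entries negative, so they index a basis of H^3(P^3, O(-5)).\<close>

definition neg_exp :: "coord \<Rightarrow> coord \<Rightarrow>\<^sub>0 int" where
  "neg_exp u = - (\<Sum>i\<in>UNIV. Poly_Mapping.single i 1) - Poly_Mapping.single u 1"

lemma lookup_neg_exp: "Poly_Mapping.lookup (neg_exp u) i = (if i = u then - 2 else - 1)"
proof -
  have "Poly_Mapping.lookup (\<Sum>i\<in>UNIV. Poly_Mapping.single i 1) i = (1::int)"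
    by (simp add: lookup_sum lookup_single when_def)
  then show ?thesis by (auto simp: neg_exp_def lookup_minus lookup_single)
qed

lemma mdeg_neg_exp: "mdeg (neg_exp u) = - 5"
  by (cases u) (simp_all add: mdeg_def sum_coord lookup_neg_exp)

lemma negative_exponent_eq:
  assumes "\<And>i. Poly_Mapping.lookup e i < 0" and "mdeg e = - 5"
  shows "\<exists>u. e = neg_exp u"
proof -
  have e: "Poly_Mapping.lookup e CX + Poly_Mapping.lookup e CY + Poly_Mapping.lookup e CZ
      + Poly_Mapping.lookup e CW = - 5"
    using assms(2) by (simp add: mdeg_def sum_coord)
  have "\<exists>u. \<forall>i. Poly_Mapping.lookup e i = (if i = u then - 2 else - 1)"
    unfolding all_coord
    using assms(1)[of CX] assms(1)[of CY] assms(1)[of CZ] assms(1)[of CW] e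
    by (smt (verit) coord.distinct)
  then show ?thesis
    by (metis lookup_neg_exp poly_mapping_eqI)
qed

text \<open>\<open>syz\<close> is exactness of the Koszul complex over each localization.
  \<open>cube\<close> restricts scalars to those fixed by Frobenius, so that Frobenius acts
  linearly.\<close>

locale regular_pair =
  fixes PF PG :: "'a::field poly4" and F G :: "'a laurent4"
  defines "F \<equiv> to_laurent PF" and "G \<equiv> to_laurent PG"
  assumes hom_F: "homogeneous 2 F" and hom_G: "homogeneous 3 G"
    and F0: "F \<noteq> 0" and G0: "G \<noteq> 0"
    and syz: "\<And>a b I. a \<in> localized I \<Longrightarrow> b \<in> localized I \<Longrightarrow> a * F + b * G = 0 \<Longrightarrow>
       \<exists>e\<in>localized I. a = e * G \<and> b = - e * F"
    and three: "(3 :: 'a) = 0" and cube: "\<And>x :: 'a. x ^ 3 = x"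
begin

lemma F_localized: "F \<in> localized I" and G_localized: "G \<in> localized I"
  unfolding F_def G_def using to_laurent_localized localized_mono by blast+

lemma three_laurent: "(3 :: 'a laurent4) = 0"
  by (metis three single_numeral single_zero)

text \<open>\<open>obst c e\<close>: the class of $e$ in $H^3(P^3, O(-5))$ is the image of the class of $c$ under the
  composition of the two connecting maps of the Koszul resolution of $O_X$.\<close>

definition lifts :: "'a cochain \<Rightarrow> (coord list \<Rightarrow> 'a laurent4) \<Rightarrow> (coord list \<Rightarrow> 'a laurent4) \<Rightarrow> bool" where
  "lifts c a b \<longleftrightarrow> (\<forall>i j k. a [i, j, k] \<in> localized {i, j, k} \<and> b [i, j, k] \<in> localized {i, j, k} \<and>
      c i j + c j k - c i k = a [i, j, k] * F + b [i, j, k] * G)"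

definition obst :: "'a cochain \<Rightarrow> 'a laurent4 \<Rightarrow> bool" where
  "obst c e \<longleftrightarrow> (\<exists>a b. lifts c a b \<and> cobd a [CX, CY, CZ, CW] = e * G \<and>
      cobd b [CX, CY, CZ, CW] = - e * F)"

text \<open>The coboundaries of the two lifted coefficients form a relation between F and G, since
  the coboundary of c has coboundary zero; \<open>syz\<close> on the full overlap yields e.\<close>

lemma obst_exists:
  assumes "c \<in> cocycles PF PG"
  shows "\<exists>e. obst c e"
proof -
  have "\<forall>i j k. \<exists>p. fst p \<in> localized {i, j, k} \<and> snd p \<in> localized {i, j, k} \<and>
      c i j + c j k - c i k = fst p * F + snd p * G"
    using assms unfolding cocycles_def local_ideal_def F_def G_def by force
  then obtain p where p: "\<And>i j k. fst (p i j k) \<in> localized {i, j, k}"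
    "\<And>i j k. snd (p i j k) \<in> localized {i, j, k}"
    "\<And>i j k. c i j + c j k - c i k = fst (p i j k) * F + snd (p i j k) * G"
    by metis
  define a where "a = (\<lambda>l. fst (p (l ! 0) (l ! 1) (l ! 2)))"
  define b where "b = (\<lambda>l. snd (p (l ! 0) (l ! 1) (l ! 2)))"
  have l: "lifts c a b"
    using p by (simp add: lifts_def a_def b_def)
  then have l': "a [i, j, k] * F + b [i, j, k] * G = c i j + c j k - c i k" for i j k
    by (simp add: lifts_def)
  have "cobd a [CX, CY, CZ, CW] * F + cobd b [CX, CY, CZ, CW] * G =
     (a [CY, CZ, CW] * F + b [CY, CZ, CW] * G) - (a [CX, CZ, CW] * F + b [CX, CZ, CW] * G)
     + (a [CX, CY, CW] * F + b [CX, CY, CW] * G) - (a [CX, CY, CZ] * F + b [CX, CY, CZ] * G)"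
    by (simp add: algebra_simps)
  also have "\<dots> = 0"
    by (simp add: l')
  finally obtain e where "cobd a [CX, CY, CZ, CW] = e * G" "cobd b [CX, CY, CZ, CW] = - e * F"
    using syz[of "cobd a [CX, CY, CZ, CW]" UNIV "cobd b [CX, CY, CZ, CW]"] by auto
  with l show ?thesis unfolding obst_def by blast
qed

lemma obst_add:
  assumes "obst c e" "obst c' e'"
  shows "obst (\<lambda>i j. c i j + c' i j) (e + e')"
proof -
  obtain a b where 1: "lifts c a b" "cobd a [CX, CY, CZ, CW] = e * G" "cobd b [CX, CY, CZ, CW] = - e * F"
    using assms(1) unfolding obst_def by blast
  obtain a' b' where 2: "lifts c' a' b'" "cobd a' [CX, CY, CZ, CW] = e' * G" "cobd b' [CX, CY, CZ, CW] = - e' * F"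
    using assms(2) unfolding obst_def by blast
  have "lifts (\<lambda>i j. c i j + c' i j) (\<lambda>l. a l + a' l) (\<lambda>l. b l + b' l)"
    unfolding lifts_def
  proof (intro allI conjI)
    fix i j k
    have "c i j + c' i j + (c j k + c' j k) - (c i k + c' i k) =
      (c i j + c j k - c i k) + (c' i j + c' j k - c' i k)" by simp
    also have "\<dots> = (a [i, j, k] + a' [i, j, k]) * F + (b [i, j, k] + b' [i, j, k]) * G"
      using 1(1) 2(1) by (simp add: lifts_def algebra_simps)
    finally show "c i j + c' i j + (c j k + c' j k) - (c i k + c' i k) =
      (a [i, j, k] + a' [i, j, k]) * F + (b [i, j, k] + b' [i, j, k]) * G" .
  qed (use 1(1) 2(1) in \<open>auto simp: lifts_def intro: localized_add\<close>)
  moreover have "cobd (\<lambda>l. a l + a' l) [CX, CY, CZ, CW] = (e + e') * G"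
    "cobd (\<lambda>l. b l + b' l) [CX, CY, CZ, CW] = - (e + e') * F"
    using 1 2 by (simp_all only: cobd_add) (simp_all add: algebra_simps)
  ultimately show ?thesis unfolding obst_def by blast
qed

lemma obst_mult_const:
  assumes "obst c e"
  shows "obst (\<lambda>i j. const t * c i j) (const t * e)"
proof -
  obtain a b where 1: "lifts c a b" "cobd a [CX, CY, CZ, CW] = e * G" "cobd b [CX, CY, CZ, CW] = - e * F"
    using assms(1) unfolding obst_def by blast
  have "lifts (\<lambda>i j. const t * c i j) (\<lambda>l. const t * a l) (\<lambda>l. const t * b l)"
    unfolding lifts_def
  proof (intro allI conjI)
    fix i j k
    have "const t * c i j + const t * c j k - const t * c i k = const t * (c i j + c j k - c i k)"
      by (simp add: algebra_simps)
    also have "\<dots> = const t * a [i, j, k] * F + const t * b [i, j, k] * G"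
      using 1(1) by (simp add: lifts_def algebra_simps)
    finally show "const t * c i j + const t * c j k - const t * c i k =
      const t * a [i, j, k] * F + const t * b [i, j, k] * G" .
  qed (use 1(1) in \<open>auto simp: lifts_def intro: localized_mult localized_const\<close>)
  moreover have "cobd (\<lambda>l. const t * a l) [CX, CY, CZ, CW] = const t * e * G"
    "cobd (\<lambda>l. const t * b l) [CX, CY, CZ, CW] = - (const t * e) * F"
    using 1 by (simp_all only: cobd_additive[where h = "\<lambda>x. const t * x", OF right_diff_distrib])
      (simp_all add: algebra_simps)
  ultimately show ?thesis unfolding obst_def by blast
qed

text \<open>If c is a coboundary up to (F, G), with coefficients \<alpha> and \<beta> on double
  overlaps, then a and cobd \<alpha> differ by g G with g regular on the triple overlap. So e is an
  alternating sum of four such g, each without a pole along one coordinate, and no monomial with all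
  exponents negative can occur.\<close>

lemma obst_coboundary:
  assumes "c \<in> coboundaries PF PG" and "obst c e" and "\<And>i. Poly_Mapping.lookup q i < 0"
  shows "Poly_Mapping.lookup e q = 0"
proof -
  obtain a b where ab: "lifts c a b" "cobd a [CX, CY, CZ, CW] = e * G" "cobd b [CX, CY, CZ, CW] = - e * F"
    using assms(2) unfolding obst_def by blast
  obtain d where d: "\<And>i j. c i j - (d j - d i) \<in> local_ideal PF PG {i, j}"
    using assms(1) unfolding coboundaries_def by blast
  have "\<forall>i j. \<exists>p. fst p \<in> localized {i, j} \<and> snd p \<in> localized {i, j} \<and>
      c i j - (d j - d i) = fst p * F + snd p * G"
    using d unfolding local_ideal_def F_def G_def by force
  then obtain p where p: "\<And>i j. fst (p i j) \<in> localized {i, j}"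
    "\<And>i j. snd (p i j) \<in> localized {i, j}"
    "\<And>i j. c i j - (d j - d i) = fst (p i j) * F + snd (p i j) * G"
    by metis
  define \<alpha> where "\<alpha> = (\<lambda>l. fst (p (l ! 0) (l ! 1)))"
  define \<beta> where "\<beta> = (\<lambda>l. snd (p (l ! 0) (l ! 1)))"
  have loc2: "\<alpha> [i, j] \<in> localized I" "\<beta> [i, j] \<in> localized I" if "{i, j} \<subseteq> I" for i j I
    using p(1,2)[of i j] localized_mono[OF that] by (auto simp: \<alpha>_def \<beta>_def)
  have "\<exists>g\<in>localized {i, j, k}. a [i, j, k] - cobd \<alpha> [i, j, k] = g * G \<and>
      b [i, j, k] - cobd \<beta> [i, j, k] = - g * F" for i j k
  proof (rule syz)
    show "a [i, j, k] - cobd \<alpha> [i, j, k] \<in> localized {i, j, k}"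
      using ab(1) by (auto simp: lifts_def intro!: localized_diff loc2)
    show "b [i, j, k] - cobd \<beta> [i, j, k] \<in> localized {i, j, k}"
      using ab(1) by (auto simp: lifts_def intro!: localized_diff loc2)
    have *: "\<alpha> [i, j] * F + \<beta> [i, j] * G = c i j - (d j - d i)" for i j
      using p(3) by (simp add: \<alpha>_def \<beta>_def)
    have "cobd \<alpha> [i, j, k] * F + cobd \<beta> [i, j, k] * G = (\<alpha> [i, j] * F + \<beta> [i, j] * G)
        + (\<alpha> [j, k] * F + \<beta> [j, k] * G) - (\<alpha> [i, k] * F + \<beta> [i, k] * G)"
      by (simp add: algebra_simps)
    also have "\<dots> = c i j + c j k - c i k"
      by (simp only: *) simp
    also have "\<dots> = a [i, j, k] * F + b [i, j, k] * G"
      using ab(1) by (simp add: lifts_def)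
    finally have "(a [i, j, k] * F + b [i, j, k] * G) - (cobd \<alpha> [i, j, k] * F + cobd \<beta> [i, j, k] * G) = 0"
      by simp
    then show "(a [i, j, k] - cobd \<alpha> [i, j, k]) * F + (b [i, j, k] - cobd \<beta> [i, j, k]) * G = 0"
      by (simp only: left_diff_distrib add_diff_add)
  qed
  then obtain g where g: "\<And>i j k. g i j k \<in> localized {i, j, k}"
    "\<And>i j k. a [i, j, k] = cobd \<alpha> [i, j, k] + g i j k * G"
    by (metis diff_eq_eq add.commute)
  have "e * G = cobd a [CX, CY, CZ, CW]" using ab(2) by simp
  also have "\<dots> = cobd (cobd \<alpha>) [CX, CY, CZ, CW]
      + (g CY CZ CW - g CX CZ CW + g CX CY CW - g CX CY CZ) * G"
    by (simp add: g(2) algebra_simps del: cobd.simps) (simp add: algebra_simps g(2))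
  finally have e: "e = g CY CZ CW - g CX CZ CW + g CX CY CW - g CX CY CZ"
    using G0 by (simp add: cobd_cobd)
  have "Poly_Mapping.lookup (g i j k) q = 0" if "n \<notin> {i, j, k}" for i j k n
    using g(1)[of i j k] that assms(3)[of n] unfolding localized_def
    by (metis (mono_tags, lifting) mem_Collect_eq in_keys_iff not_le)
  from this[of CX] this[of CY] this[of CZ] this[of CW] show ?thesis
    by (simp add: e lookup_add lookup_minus)
qed

text \<open>Cubing is additive and (a F)^3 = (a^3 F^2) F, so the coefficients lift as a^3 F^2 and
  b^3 G^2. Cubing cobd a = e G and multiplying by F^2 produces the factor (F G)^2.\<close>

lemma obst_frobenius:
  assumes "obst c e"
  shows "obst (\<lambda>i j. c i j ^ 3) (e ^ 3 * (F ^ 2 * G ^ 2))"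
proof -
  note cd = cube_diff[OF three_laurent]
  have cube_add: "(x + y) ^ 3 = x ^ 3 + y ^ 3" for x y :: "'a laurent4"
    using cd[of x "- y"] by (simp add: power3_eq_cube)
  obtain a b where 1: "lifts c a b" "cobd a [CX, CY, CZ, CW] = e * G" "cobd b [CX, CY, CZ, CW] = - e * F"
    using assms(1) unfolding obst_def by blast
  have "lifts (\<lambda>i j. c i j ^ 3) (\<lambda>l. a l ^ 3 * F ^ 2) (\<lambda>l. b l ^ 3 * G ^ 2)"
    unfolding lifts_def
  proof (intro allI conjI)
    fix i j k
    have "c i j ^ 3 + c j k ^ 3 - c i k ^ 3 = (c i j + c j k - c i k) ^ 3"
      by (simp add: cd cube_add)
    also have "\<dots> = (a [i, j, k] * F + b [i, j, k] * G) ^ 3"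
      using 1(1) by (simp add: lifts_def)
    also have "\<dots> = a [i, j, k] ^ 3 * F ^ 2 * F + b [i, j, k] ^ 3 * G ^ 2 * G"
      unfolding cube_add by (simp add: power_mult_distrib power3_eq_cube power2_eq_square mult.assoc)
    finally show "c i j ^ 3 + c j k ^ 3 - c i k ^ 3 = \<dots>" .
  qed (use 1(1) in \<open>auto simp: lifts_def intro!: localized_mult localized_power F_localized G_localized\<close>)
  moreover have "cobd (\<lambda>l. a l ^ 3 * F ^ 2) [CX, CY, CZ, CW] = cobd a [CX, CY, CZ, CW] ^ 3 * F ^ 2"
    by (rule cobd_additive) (simp add: cd left_diff_distrib)
  moreover have "cobd (\<lambda>l. b l ^ 3 * G ^ 2) [CX, CY, CZ, CW] = cobd b [CX, CY, CZ, CW] ^ 3 * G ^ 2"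
    by (rule cobd_additive) (simp add: cd left_diff_distrib)
  moreover have "(e * G) ^ 3 * F ^ 2 = e ^ 3 * (F ^ 2 * G ^ 2) * G"
    "(- e * F) ^ 3 * G ^ 2 = - (e ^ 3 * (F ^ 2 * G ^ 2)) * F"
    by (simp_all add: power3_eq_cube power2_eq_square algebra_simps)
  ultimately show ?thesis unfolding obst_def 1(2,3) by metis
qed

text \<open>The connecting maps are inverted step by step: a 3-cochain with values in O(-5) maps to
  O(-2) and O(-3), where it is a coboundary, and the resulting 2-cocycle with values in O is a
  coboundary again.\<close>

lemma obst_surjective:
  "\<exists>c\<in>cocycles PF PG. obst c (Poly_Mapping.single (neg_exp u) 1)"
proof -
  define E :: "'a laurent4" where "E = Poly_Mapping.single (neg_exp u) 1"
  have hom_E: "homogeneous (- 5) E"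
    by (simp add: E_def homogeneous_def mdeg_neg_exp)
  define A where "A = (\<lambda>H l. of_int (orientation l) * (E * H))"
  have A_cocycle: "cobd (A H) l = 0" if "length l = 5" for H l
  proof -
    have "cobd (A H) l = of_int (cobd orientation l) * (E * H)"
      unfolding A_def by (rule cobd_additive) (simp add: left_diff_distrib)
    then show ?thesis using orientation_cocycle[OF that] by simp
  qed
  have hom_of_int: "homogeneous 0 (of_int t :: 'a laurent4)" for t
    by (simp add: homogeneous_def mdeg_def flip: single_of_int)
  have hom_A: "homogeneous (d - 5) (A H l)" if "homogeneous d H" for d H l
    using homogeneous_mult[OF hom_of_int homogeneous_mult[OF hom_E that]] by (simp add: A_def)
  have A_localized: "A H l \<in> localized (set l)" if "length l = 4" for H l
  proof (cases "orientation l = 0")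
    case False
    then have "card (set l) = CARD(coord)"
      using orientation_neq_0[of l] that by (simp add: distinct_card UNIV_coord)
    then have "set l = UNIV" by (intro card_eq_UNIV_imp_eq_UNIV) auto
    then show ?thesis by simp
  qed (simp add: A_def)
  \<comment> \<open>G and -F are the components of the Koszul map out of O(-5); E G and -E F have
    degrees -2 and -3, above the bound -4 for contraction.\<close>
  define a where "a = contract (A G)"
  define b where "b = contract (A (- F))"
  have hom_mF: "homogeneous 2 (- F)"
    using hom_F by (simp add: homogeneous_def keys_minus')
  have cobd_a: "cobd a l = A G l" and cobd_b: "cobd b l = A (- F) l" if "length l = 4" for l
    unfolding a_def b_def using A_cocycle that hom_A[OF hom_G, of l] hom_A[OF hom_mF, of l]
    by (auto intro!: cobd_contract mdeg_nonneg_exponent simp: homogeneous_def simp del: cobd.simps)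
  have a_localized: "a l \<in> localized (set l)" "b l \<in> localized (set l)" if "length l = 3" for l
    unfolding a_def b_def using that A_localized[of "_ # l"] by (auto intro!: contract_localized)
  have hom_a: "homogeneous (- 2) (a l)" and hom_b: "homogeneous (- 3) (b l)" for l
    unfolding a_def b_def using hom_A[OF hom_G] hom_A[OF hom_mF] by (auto intro!: homogeneous_contract)
  \<comment> \<open>The coboundary of T is a multiple of G F - F G = 0, and T has degree 0, so T can
    be contracted.\<close>
  define T where "T = (\<lambda>l. a l * F + b l * G)"
  have T_localized: "T l \<in> localized (set l)" if "length l = 3" for l
    unfolding T_def using a_localized[OF that] by (intro localized_add localized_mult F_localized G_localized)
  have hom_T: "homogeneous 0 (T l)" for l
    unfolding T_def using homogeneous_mult[OF hom_a hom_F] homogeneous_mult[OF hom_b hom_G]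
    by (auto intro: homogeneous_add)
  have T_cocycle: "cobd T l = 0" if "length l = 4" for l
  proof -
    have "cobd T l = cobd a l * F + cobd b l * G"
      unfolding T_def cobd_add
      by (simp add: cobd_additive[where h = "\<lambda>x. x * F", OF left_diff_distrib]
          cobd_additive[where h = "\<lambda>x. x * G", OF left_diff_distrib])
    then show ?thesis using that by (simp add: cobd_a cobd_b A_def algebra_simps)
  qed
  define c where "c = (\<lambda>i j. contract T [i, j])"
  have cobd_c: "c i j + c j k - c i k = T [i, j, k]" for i j k
  proof -
    have "cobd (contract T) [i, j, k] = T [i, j, k]"
      using T_cocycle hom_T[of "[i, j, k]"]
      by (intro cobd_contract) (auto intro!: mdeg_nonneg_exponent simp: homogeneous_def simp del: cobd.simps)
    then show ?thesis by (simp add: c_def algebra_simps)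
  qed
  have "c i j \<in> sections {i, j}" for i j
    using contract_localized[of T "[i, j]"] T_localized[of "[_, i, j]"] homogeneous_contract[of 0 T "[i, j]"] hom_T
    by (simp add: c_def sections_def)
  moreover have lifts: "lifts c a b"
    unfolding lifts_def cobd_c using a_localized[of "[_, _, _]"] by (simp add: T_def)
  then have "c i j + c j k - c i k \<in> local_ideal PF PG {i, j, k}" for i j k
    unfolding lifts_def local_ideal_def F_def G_def by blast
  ultimately have "c \<in> cocycles PF PG"
    by (simp add: cocycles_def)
  moreover have "obst c E"
    unfolding obst_def using lifts cobd_a[of "[CX, CY, CZ, CW]"] cobd_b[of "[CX, CY, CZ, CW]"]
    by (intro exI[of _ a] exI[of _ b]) (simp add: A_def del: cobd.simps)
  ultimately show ?thesis unfolding E_def by blast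
qed

end

section \<open>The Hasse--Witt matrix in terms of the coefficients of $(FG)^2$\<close>

lemma lookup_const_mult:
  fixes f :: "'e::ab_group_add \<Rightarrow>\<^sub>0 'a::semiring_0"
  shows "Poly_Mapping.lookup (const t * f) q = t * Poly_Mapping.lookup f q"
  by (simp add: const_def lookup_single_mult)

lemma rank_1_outer_product:
  fixes H :: "'a::field^'n^'m"
  assumes "rank H = 1"
  shows "\<exists>p q. \<forall>i j. H $ i $ j = p i * (q $ j)"
proof -
  obtain B where B: "vec.independent B" "rows H \<subseteq> vec.span B" "card B = 1"
    using assms vec.basis_exists[of "rows H"] by (metis row_rank_def_gen)
  then obtain q where "B = {q}" by (auto simp: card_1_singleton_iff)
  with B(2) have "row i H \<in> vec.span {q}" for i
    by (auto simp: rows_def)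
  then have "\<forall>i. \<exists>k. row i H = k *s q"
    by (auto simp: vec.span_singleton)
  then obtain p where "\<And>i. row i H = p i *s q" by metis
  then have "H $ i $ j = p i * (q $ j)" for i j
    by (metis row_def vec_lambda_eta vector_smult_component)
  then show ?thesis by blast
qed

lemma rank_0_eq_0:
  fixes H :: "'a::field^'n^'m"
  assumes "rank H = 0"
  shows "H = 0"
proof -
  have "rows H \<subseteq> {0}"
    using assms by (simp add: row_rank_def_gen)
  then have "row i H = 0" for i by (auto simp: rows_def)
  then show ?thesis by (simp add: row_def vec_eq_iff)
qed

lemma neg_exp_inj: "neg_exp u = neg_exp v \<longleftrightarrow> u = v"
  using lookup_neg_exp[of u u] lookup_neg_exp[of v u] by (auto split: if_splits)

context regular_pair
begin

text \<open>The matrix of e \<mapsto> e^3 (F G)^2 on H^3(P^3, O(-5)) in the basis of the monomials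
  \<open>neg_exp\<close>.\<close>

definition hw :: "coord \<Rightarrow> coord \<Rightarrow> 'a" where
  "hw u v = Poly_Mapping.lookup (F ^ 2 * G ^ 2) (neg_exp u - neg_exp v - neg_exp v - neg_exp v)"

text \<open>A monomial k of e contributes only if neg_exp u - 3 k is an exponent of the polynomial
  (F G)^2, homogeneous of degree 10. Nonnegativity of the entries forces every entry of k to be
  negative, and the degree forces -5 - 3 deg k = 10; so k is some \<open>neg_exp v\<close>.\<close>

lemma lookup_frobenius:
  "Poly_Mapping.lookup (e ^ 3 * (F ^ 2 * G ^ 2)) (neg_exp u) =
     (\<Sum>v\<in>UNIV. hw u v * Poly_Mapping.lookup e (neg_exp v))"
proof -
  let ?P = "F ^ 2 * G ^ 2"
  have cube_add: "(x + y) ^ 3 = x ^ 3 + y ^ 3" for x y :: "'a laurent4"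
    using cube_diff[OF three_laurent, of x "- y"] by (simp add: power3_eq_cube)
  have cube_sum: "(\<Sum>k\<in>K. f k) ^ 3 = (\<Sum>k\<in>K. f k ^ 3)" for K and f :: "_ \<Rightarrow> 'a laurent4"
    by (induction K rule: infinite_finite_induct) (simp_all add: cube_add)
  have hom_P: "homogeneous 10 ?P"
    using homogeneous_mult[OF homogeneous_mult[OF hom_F hom_F] homogeneous_mult[OF hom_G hom_G]]
    by (simp add: power2_eq_square)
  have loc_P: "?P \<in> localized {}"
    by (intro localized_mult localized_power F_localized G_localized)
  define g where "g = (\<lambda>k. Poly_Mapping.lookup e k * Poly_Mapping.lookup ?P (neg_exp u - k - k - k))"
  have g0: "g k = 0" if "k \<notin> range neg_exp" for k
  proof (rule ccontr)
    assume "g k \<noteq> 0"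
    then have k: "neg_exp u - k - k - k \<in> Poly_Mapping.keys ?P"
      by (auto simp: g_def in_keys_iff)
    have "Poly_Mapping.lookup k i < 0" for i
    proof -
      have "0 \<le> Poly_Mapping.lookup (neg_exp u - k - k - k) i"
        using loc_P k by (simp add: localized_def)
      then show ?thesis
        by (simp add: lookup_minus lookup_neg_exp split: if_splits)
    qed
    moreover have "mdeg k = - 5"
    proof -
      have "mdeg (neg_exp u - k - k - k) = 10"
        using hom_P k by (simp add: homogeneous_def)
      moreover have "mdeg (neg_exp u - k - k - k) = mdeg (neg_exp u) - 3 * mdeg k"
        by (simp add: mdeg_def lookup_minus sum_coord)
      ultimately show ?thesis by (simp add: mdeg_neg_exp)
    qed
    ultimately show False using negative_exponent_eq that by blast
  qed
  have "e ^ 3 = (\<Sum>k\<in>Poly_Mapping.keys e. Poly_Mapping.single (k + k + k) (Poly_Mapping.lookup e k))"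
    by (subst poly_mapping_sum_singles[of e], subst cube_sum)
      (simp add: power3_eq_cube mult_single cube[unfolded power3_eq_cube] add.assoc)
  then have "Poly_Mapping.lookup (e ^ 3 * ?P) (neg_exp u) = (\<Sum>k\<in>Poly_Mapping.keys e. g k)"
    by (simp add: sum_distrib_right lookup_sum lookup_single_mult g_def diff_diff_eq add.assoc)
  also have "\<dots> = (\<Sum>k\<in>Poly_Mapping.keys e \<union> range neg_exp. g k)"
    by (rule sum.mono_neutral_left) (auto simp: g_def in_keys_iff)
  also have "\<dots> = (\<Sum>k\<in>range neg_exp. g k)"
    by (rule sum.mono_neutral_right) (auto simp: g0)
  also have "\<dots> = (\<Sum>v\<in>UNIV. g (neg_exp v))"
    by (subst sum.reindex) (auto simp: inj_on_def neg_exp_inj)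
  finally show ?thesis
    by (simp add: g_def hw_def mult.commute)
qed

lemma obst_residual:
  assumes "obst c e" and "\<And>l. obst (\<xi> l) (d l)"
  shows "obst (residual \<xi> a c) (e - (\<Sum>l\<in>UNIV. const (a $ l) * d l))"
proof -
  have "obst (\<lambda>i j. c i j - (\<Sum>l\<in>A. const (a $ l) * \<xi> l i j)) (e - (\<Sum>l\<in>A. const (a $ l) * d l))"
    if "finite A" for A
    using that
  proof (induction A rule: finite_induct)
    case empty
    then show ?case using assms(1) by simp
  next
    case (insert x A)
    have "const (- t) * f = - (const t * f)" for t and f :: "'a laurent4"
      by (simp add: const_def single_uminus)
    then show ?case
      using obst_add[OF insert.IH obst_mult_const[OF assms(2)[of x], of "- (a $ x)"]] insert.hyps
      by (simp add: algebra_simps)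
  qed
  from this[OF finite_class.finite_UNIV] show ?thesis by (simp add: residual_def)
qed

text \<open>The residual is a coboundary, so its obstruction has no coefficient at
  \<open>neg_exp u\<close>; by linearity this compares coordinates in H^1 with coefficients in
  H^3.\<close>

lemma coords_eq:
  fixes a :: "'a ^ 'g::finite"
  assumes "residual \<xi> a c \<in> coboundaries PF PG" and "obst c e" and "\<And>l. obst (\<xi> l) (d l)"
  shows "Poly_Mapping.lookup e (neg_exp u) = (\<Sum>l\<in>UNIV. Poly_Mapping.lookup (d l) (neg_exp u) * (a $ l))"
proof -
  have "Poly_Mapping.lookup (e - (\<Sum>l\<in>UNIV. const (a $ l) * d l)) (neg_exp u) = 0"
    by (rule obst_coboundary[OF assms(1) obst_residual[OF assms(2,3)]]) (simp add: lookup_neg_exp)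
  then show ?thesis
    by (simp add: lookup_minus lookup_sum lookup_const_mult mult.commute[of _ "a $ _"])
qed

lemma frobenius_cocycle:
  assumes "c \<in> cocycles PF PG" and "CHAR('a) = 3"
  shows "frobenius_cochain c \<in> cocycles PF PG"
proof -
  obtain e where "obst c e" using obst_exists assms(1) by blast
  then have "obst (frobenius_cochain c) (e ^ 3 * (F ^ 2 * G ^ 2))"
    unfolding frobenius_cochain_def assms(2) by (rule obst_frobenius)
  then obtain a b where "lifts (frobenius_cochain c) a b" unfolding obst_def by blast
  then have "frobenius_cochain c i j + frobenius_cochain c j k - frobenius_cochain c i k
      \<in> local_ideal PF PG {i, j, k}" for i j k
    unfolding lifts_def local_ideal_def F_def G_def by blast
  moreover have "frobenius_cochain c i j \<in> sections {i, j}" for i j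
  proof -
    have "c i j \<in> localized {i, j}" "homogeneous 0 (c i j)"
      using assms(1) by (auto simp: cocycles_def sections_def)
    then show ?thesis
      using homogeneous_mult[OF homogeneous_mult[of 0 "c i j" 0 "c i j"], of 0 "c i j"]
      by (simp add: frobenius_cochain_def assms(2) sections_def localized_mult power3_eq_cube)
  qed
  ultimately show ?thesis by (simp add: cocycles_def)
qed

text \<open>The connecting map intertwines Frobenius with \<open>hw\<close>; being surjective, it makes \<open>hw\<close> a
  quotient of the Hasse--Witt matrix.\<close>

lemma hw_rank_one:
  fixes \<xi> :: "4 \<Rightarrow> 'a cochain"
  assumes basis: "H1_basis PF PG \<xi>" and char: "CHAR('a) = 3"
    and prank: "p_rank (hasse_witt PF PG \<xi>) = 0" and anum: "a_number (hasse_witt PF PG \<xi>) = 3"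
  shows "hw i j * hw k l = hw i l * hw k j" and "(\<Sum>u\<in>UNIV. hw u u) = 0"
proof -
  define H where "H = hasse_witt PF PG \<xi>"
  have coc: "\<xi> l \<in> cocycles PF PG" for l
    using basis by (simp add: H1_basis_def)
  have coords: "residual \<xi> (H1_coords PF PG \<xi> c) c \<in> coboundaries PF PG" if "c \<in> cocycles PF PG" for c
    using theI'[of "\<lambda>a. residual \<xi> a c \<in> coboundaries PF PG"] basis that
    unfolding H1_basis_def H1_coords_def by blast
  obtain d where d: "\<And>l. obst (\<xi> l) (d l)"
    using obst_exists[OF coc] by metis
  define \<Phi> :: "'a^4^coord" where "\<Phi> = (\<chi> u l. Poly_Mapping.lookup (d l) (neg_exp u))"
  define M :: "'a^coord^coord" where "M = (\<chi> u v. hw u v)"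
  have frob: "\<Phi> ** H = M ** \<Phi>"
  proof -
    have "(\<Phi> ** H) $ u $ l = (M ** \<Phi>) $ u $ l" for u l
    proof -
      have "obst (frobenius_cochain (\<xi> l)) (d l ^ 3 * (F ^ 2 * G ^ 2))"
        unfolding frobenius_cochain_def char by (rule obst_frobenius[OF d])
      from coords_eq[OF coords[OF frobenius_cocycle[OF coc[of l] char]] this d, of u]
      show ?thesis
        unfolding lookup_frobenius
        by (simp add: matrix_matrix_mult_def \<Phi>_def M_def H_def hasse_witt_def)
    qed
    then show ?thesis by (simp add: vec_eq_iff)
  qed
  have "\<forall>u. \<exists>a. \<Phi> *v a = axis u 1"
  proof
    fix u
    obtain c where c: "c \<in> cocycles PF PG" "obst c (Poly_Mapping.single (neg_exp u) 1)"
      using obst_surjective by blast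
    have "\<Phi> *v H1_coords PF PG \<xi> c = axis u 1"
      using coords_eq[OF coords[OF c(1)] c(2) d]
      by (simp add: vec_eq_iff matrix_vector_mult_def \<Phi>_def axis_def lookup_single neg_exp_inj
          when_def) metis
    then show "\<exists>a. \<Phi> *v a = axis u 1" by blast
  qed
  then obtain s where s: "\<And>u. \<Phi> *v s u = axis u 1" by metis
  \<comment> \<open>Surjectivity of the connecting map gives a right inverse of \<Phi>, so the
    intertwining relation can be solved for M.\<close>
  define S :: "'a^coord^4" where "S = (\<chi> l u. s u $ l)"
  have \<Phi>S: "\<Phi> ** S = mat 1"
  proof -
    have "(\<Phi> ** S) $ v $ u = (\<Phi> *v s u) $ v" for u v
      by (simp add: matrix_matrix_mult_def matrix_vector_mult_def S_def)
    then show ?thesis by (simp add: s vec_eq_iff mat_def axis_def)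
  qed
  have M_eq: "M = \<Phi> ** H ** S"
    by (simp add: frob \<Phi>S flip: matrix_mul_assoc)
  have "rank H = 1"
    using anum by (simp add: a_number_def H_def)
  then obtain p q where pq: "\<And>i j. H $ i $ j = p i * (q $ j)"
    using rank_1_outer_product by blast
  define p' where "p' = (\<lambda>u. \<Sum>i\<in>UNIV. (\<Phi> $ u $ i) * p i)"
  define q' where "q' = (\<lambda>v. \<Sum>j\<in>UNIV. (q $ j) * (S $ j $ v))"
  have M: "hw u v = p' u * q' v" for u v
  proof -
    have "hw u v = (\<Phi> ** H ** S) $ u $ v" by (simp add: M_eq[symmetric]) (simp add: M_def)
    also have "\<dots> = (\<Sum>k\<in>UNIV. p' u * ((q $ k) * (S $ k $ v)))"
      by (simp add: matrix_matrix_mult_def pq p'_def sum_distrib_right mult.assoc)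
    finally show ?thesis by (simp add: q'_def sum_distrib_left)
  qed
  show "hw i j * hw k l = hw i l * hw k j"
    by (simp add: M mult_ac)
  \<comment> \<open>The twisted product defining the p-rank is thus the ordinary fourth power of
    H.\<close>
  have entry: "entry_power (CHAR('a) ^ n) H = H" for n
  proof -
    have "x ^ (3 ^ n) = x" for x :: 'a
      by (induction n) (simp_all add: cube power_mult)
    then show ?thesis by (simp add: entry_power_def char vec_eq_iff)
  qed
  have "H ** (H ** (H ** H)) = 0"
    using rank_0_eq_0[OF prank[unfolded p_rank_def H_def[symmetric] entry]]
    by (simp add: numeral_eq_Suc)
  moreover have "M ** (M ** (M ** M)) = \<Phi> ** (H ** (H ** (H ** H))) ** S"
  proof -
    have "M ** \<Phi> = \<Phi> ** H" by (simp add: frob)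
    then have "M ** (M ** (M ** (M ** \<Phi>))) = \<Phi> ** H ** H ** H ** H"
      by (metis matrix_mul_assoc)
    then show ?thesis
      by (metis \<Phi>S matrix_mul_assoc matrix_mul_rid)
  qed
  ultimately have M4: "M ** (M ** (M ** M)) = 0"
    by (simp add: matrix_matrix_mult_def vec_eq_iff)
  \<comment> \<open>M is the outer product of p' and q', so its trace is t and M^4 = t^3 M. As M^4 =
    0, either t = 0 or M = 0; the trace vanishes in both cases.\<close>
  define t where "t = (\<Sum>u\<in>UNIV. q' u * p' u)"
  have M2: "(M ** B) $ u $ v = p' u * (\<Sum>w\<in>UNIV. q' w * (B $ w $ v))" for B :: "'a^coord^coord" and u v
    by (simp add: matrix_matrix_mult_def M_def M sum_distrib_left mult.assoc)
  have "(M ** (M ** (M ** M))) $ u $ v = t ^ 3 * hw u v" for u v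
    by (simp add: M2) (simp add: M_def M sum_distrib_left t_def power3_eq_cube sum_coord algebra_simps)
  then have *: "t ^ 3 * hw u v = 0" for u v by (metis M4 zero_index)
  have trace: "(\<Sum>u\<in>UNIV. hw u u) = t"
    by (simp add: M t_def mult.commute)
  show "(\<Sum>u\<in>UNIV. hw u u) = 0"
  proof (cases "t = 0")
    case False
    then show ?thesis using * by simp
  qed (simp add: trace)
qed

end

section \<open>Polynomials given by lists of terms\<close>

definition expo :: "'b \<Rightarrow> 'b \<Rightarrow> 'b \<Rightarrow> 'b \<Rightarrow> coord \<Rightarrow>\<^sub>0 'b::comm_monoid_add" where
  "expo a b c d = Poly_Mapping.single CX a + Poly_Mapping.single CY b
     + Poly_Mapping.single CZ c + Poly_Mapping.single CW d"

lemma lookup_expo: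
  "Poly_Mapping.lookup (expo a b c d) i = (case i of CX \<Rightarrow> a | CY \<Rightarrow> b | CZ \<Rightarrow> c | CW \<Rightarrow> d)"
  by (cases i) (simp_all add: expo_def lookup_add lookup_single)

lemma expo_eq_iff: "expo a b c d = expo a' b' c' d' \<longleftrightarrow> a = a' \<and> b = b' \<and> c = c' \<and> d = d'"
  unfolding poly_mapping_eq_iff fun_eq_iff all_coord by (simp add: lookup_expo)

lemma expo_add: "expo a b c d + expo a' b' c' d' = expo (a + a') (b + b') (c + c') (d + d')"
  by (simp add: expo_def single_add algebra_simps)

lemma expo_diff: "expo a b c d - expo a' b' c' d' = expo (a - a') (b - b') (c - c') (d - d')"
  by (rule poly_mapping_eqI) (simp add: lookup_expo lookup_minus split: coord.split)

type_synonym 'a terms = "('a \<times> nat \<times> nat \<times> nat \<times> nat) list"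

definition poly_of :: "'a::comm_monoid_add terms \<Rightarrow> 'a poly4" where
  "poly_of xs = (\<Sum>(c, i, j, k, l)\<leftarrow>xs. Poly_Mapping.single (expo i j k l) c)"

definition laurent_of :: "'a::comm_monoid_add terms \<Rightarrow> 'a laurent4" where
  "laurent_of xs = (\<Sum>(c, i, j, k, l)\<leftarrow>xs. Poly_Mapping.single (expo (int i) (int j) (int k) (int l)) c)"

text \<open>A list may repeat exponents or contain zero coefficients, so its terms need not match
  the keys; additivity of g in the coefficient bridges the gap.\<close>

lemma sum_keys_poly_of:
  assumes "\<And>e. g e 0 = 0" and "\<And>e c d. g e (c + d) = g e c + g e d"
  shows "(\<Sum>e\<in>Poly_Mapping.keys (poly_of xs). g e (Poly_Mapping.lookup (poly_of xs) e)) =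
    (\<Sum>(c, i, j, k, l)\<leftarrow>xs. g (expo i j k l) c)"
proof (induction xs)
  case (Cons x xs)
  obtain c i j k l where x: "x = (c, i, j, k, l)" by (metis prod_cases5)
  have "(\<Sum>e\<in>Poly_Mapping.keys (Poly_Mapping.single (expo i j k l) c).
      g e (Poly_Mapping.lookup (Poly_Mapping.single (expo i j k l) c) e)) = g (expo i j k l) c"
    by (simp add: assms(1))
  then show ?case
    using Cons setsum_keys_plus_distrib[of g "Poly_Mapping.single (expo i j k l) c" "poly_of xs"] assms
    by (simp add: poly_of_def x)
qed (simp add: poly_of_def)

lemma to_laurent_poly_of: "to_laurent (poly_of xs) = laurent_of (xs :: 'a::comm_ring_1 terms)"
proof -
  have "Poly_Mapping.map int (expo i j k l) = expo (int i) (int j) (int k) (int l)" for i j k l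
    by (rule poly_mapping_eqI) (auto simp: Poly_Mapping.map.rep_eq lookup_expo when_def split: coord.split)
  then show ?thesis
    unfolding to_laurent_def laurent_of_def
    by (subst sum_keys_poly_of[where g = "\<lambda>e. Poly_Mapping.single (Poly_Mapping.map int e)"])
      (simp_all add: single_add)
qed

lemma eval4_poly_of:
  "eval4 to_ac (poly_of xs) P =
     (\<Sum>(c, i, j, k, l)\<leftarrow>xs. to_ac c * ((P $ CX) ^ i * (P $ CY) ^ j * (P $ CZ) ^ k * (P $ CW) ^ l))"
proof -
  have "(\<Prod>n\<in>UNIV. (P $ n) ^ Poly_Mapping.lookup (expo i j k l) n) =
      (P $ CX) ^ i * (P $ CY) ^ j * (P $ CZ) ^ k * (P $ CW) ^ l" for i j k l
    by (simp add: UNIV_coord lookup_expo mult.assoc)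
  then show ?thesis
    unfolding eval4_def
    by (subst sum_keys_poly_of[where g = "\<lambda>e c. to_ac c * (\<Prod>n\<in>UNIV. (P $ n) ^ Poly_Mapping.lookup e n)"])
      (simp_all add: distrib_right)
qed

fun term_deriv :: "coord \<Rightarrow> 'a::comm_ring_1 \<times> nat \<times> nat \<times> nat \<times> nat \<Rightarrow> 'a \<times> nat \<times> nat \<times> nat \<times> nat" where
  "term_deriv CX (c, i, j, k, l) = (of_nat i * c, i - 1, j, k, l)"
| "term_deriv CY (c, i, j, k, l) = (of_nat j * c, i, j - 1, k, l)"
| "term_deriv CZ (c, i, j, k, l) = (of_nat k * c, i, j, k - 1, l)"
| "term_deriv CW (c, i, j, k, l) = (of_nat l * c, i, j, k, l - 1)"

lemma pderiv4_poly_of: "pderiv4 n (poly_of xs) = poly_of (map (term_deriv n) xs)"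
proof -
  have "Poly_Mapping.single (expo i j k l - Poly_Mapping.single n 1)
        (of_nat (Poly_Mapping.lookup (expo i j k l) n) * c) =
      (case term_deriv n (c, i, j, k, l) of (c, i, j, k, l) \<Rightarrow> Poly_Mapping.single (expo i j k l) c)"
    for c :: 'a and i j k l
  proof -
    have "Poly_Mapping.single n 1 =
      (case n of CX \<Rightarrow> expo 1 0 0 0 | CY \<Rightarrow> expo 0 1 0 0 | CZ \<Rightarrow> expo 0 0 1 0 | CW \<Rightarrow> expo 0 0 0 (1::nat))"
      by (cases n) (simp_all add: expo_def)
    then show ?thesis
      by (cases n) (simp_all add: expo_diff lookup_expo)
  qed
  then have "pderiv4 n (poly_of xs) = (\<Sum>(c, i, j, k, l)\<leftarrow>xs.
      case term_deriv n (c, i, j, k, l) of (c, i, j, k, l) \<Rightarrow> Poly_Mapping.single (expo i j k l) c)"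
    unfolding pderiv4_def
    by (subst sum_keys_poly_of[where g = "\<lambda>e c. Poly_Mapping.single (e - Poly_Mapping.single n 1)
          (of_nat (Poly_Mapping.lookup e n) * c)"])
      (simp_all add: single_add distrib_left)
  also have "\<dots> = poly_of (map (term_deriv n) xs)"
    unfolding poly_of_def map_map comp_def
    by (rule arg_cong[where f = sum_list], rule map_cong) auto
  finally show ?thesis .
qed

lemma var_eq_single:
  "px = Poly_Mapping.single (expo 1 0 0 0) 1" "py = Poly_Mapping.single (expo 0 1 0 0) 1"
  "pz = Poly_Mapping.single (expo 0 0 1 0) 1" "pw = Poly_Mapping.single (expo 0 0 0 1) 1"
  "const c = Poly_Mapping.single (expo 0 0 0 0 :: coord \<Rightarrow>\<^sub>0 nat) c"
  by (simp_all add: var_def const_def expo_def)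

lemma keys_laurent_of:
  "e \<in> Poly_Mapping.keys (laurent_of xs) \<Longrightarrow>
     \<exists>(t, i, j, k, l)\<in>set xs. e = expo (int i) (int j) (int k) (int l)"
  by (induction xs) (fastforce simp: laurent_of_def dest!: subsetD[OF keys_add] split: if_splits)+

lemma homogeneous_laurent_of:
  assumes "\<forall>(t, i, j, k, l)\<in>set xs. int (i + j + k + l) = d"
  shows "homogeneous d (laurent_of xs)"
  unfolding homogeneous_def
proof
  fix e assume "e \<in> Poly_Mapping.keys (laurent_of xs)"
  from keys_laurent_of[OF this] assms show "mdeg e = d"
    by (auto simp: mdeg_def sum_coord lookup_expo)
qed

lemma numeral_eq_const: "numeral n = (const (numeral n) :: 'a::comm_ring_1 poly4)"
  by (simp add: const_def)

section \<open>The standard forms as lists of terms\<close>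

definition terms_D :: "'a::comm_ring_1 \<Rightarrow> _" where
  "terms_D a0 a1 a2 a3 a4 a5 a6 a7 a8 a9 b1 b2 =
    [(a0, 3, 0, 0, 0), (a1, 1, 2, 0, 0), (a2, 1, 0, 2, 0), (a3, 1, 0, 0, 2), (a4, 1, 1, 1, 0),
     (a5, 1, 0, 1, 1), (a6, 0, 3, 0, 0), (a7, 0, 0, 3, 0), (a8, 0, 0, 0, 3), (a9, 0, 1, 2, 0),
     (b1, 0, 0, 2, 1), (b2, 0, 0, 1, 2)]"

text \<open>Both split cases at once: c, the coefficient of y^3, is 1 in case N1i, while c = a4 = 0
  in case N1ii.\<close>

definition terms_N1 :: "'a::comm_ring_1 \<Rightarrow> _" where
  "terms_N1 a1 a2 a3 c a4 b1 a5 a6 a7 b2 a8 a9 a10 =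
    [(a1, 2, 1, 0, 0), (a2, 2, 0, 1, 0), (a3, 1, 1, 1, 0), (c, 0, 3, 0, 0), (a4, 0, 0, 3, 0),
     (b1, 0, 2, 1, 0), (a5, 0, 1, 2, 0), (a6, 0, 2, 0, 1), (a7, 0, 1, 1, 1), (b2, 0, 0, 2, 1),
     (a8, 0, 1, 0, 2), (a9, 0, 0, 1, 2), (a10, 0, 0, 0, 3)]"

text \<open>The cubic after substituting \<epsilon> = -1 and 3 = 0: the forms attached to a4 and a5
  shrink to y^3 and -z^3.\<close>

definition terms_N2 :: "'a::comm_ring_1 \<Rightarrow> _" where
  "terms_N2 a1 a2 a3 b1 a4 a5 a6 a7 b2 a8 a9 a10 =
    [(a1, 2, 1, 0, 0), (a2, 2, 0, 1, 0), (a3, 1, 2, 0, 0), (a3, 1, 0, 2, 0), (b1 + a4, 0, 3, 0, 0),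
     (b1, 0, 1, 2, 0), (- a5, 0, 0, 3, 0), (a6, 0, 2, 0, 1), (a7, 0, 1, 1, 1), (b2, 0, 0, 2, 1),
     (a8, 0, 1, 0, 2), (a9, 0, 0, 1, 2), (a10, 0, 0, 0, 3)]"

lemmas poly_expand = numeral_eq_const[of "num.Bit0 _"] numeral_eq_const[of "num.Bit1 _"] var_eq_single mult_single expo_add power2_eq_square
  power3_eq_cube distrib_left distrib_right left_diff_distrib right_diff_distrib
  poly_of_def numeral_2_eq_2 numeral_3_eq_3

lemma F_d_poly_of: "F_d = poly_of [(2 :: 'a::field, 0, 1, 0, 1), (1, 0, 0, 2, 0)]"
  unfolding F_d_def by (simp add: poly_expand)

lemma F_1_poly_of: "F_1 = poly_of [(2 :: 'a::field, 1, 0, 0, 1), (2, 0, 1, 1, 0)]"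
  unfolding F_1_def by (simp add: poly_expand)

lemma F_2_poly_of: "F_2 \<epsilon> = poly_of [(2 :: 'a::field, 1, 0, 0, 1), (1, 0, 2, 0, 0), (- \<epsilon>, 0, 0, 2, 0)]"
  unfolding F_2_def by (simp add: poly_expand single_uminus)

lemma case_D_poly_of:
  assumes "case_D PF PG"
  shows "\<exists>a0 a1 a2 a3 a4 a5 a6 a7 a8 a9 b1 b2. a0 \<noteq> 0 \<and> a6 \<noteq> 0 \<and>
    PF = poly_of [(2, 0, 1, 0, 1), (1, 0, 0, 2, 0)] \<and>
    PG = poly_of (terms_D a0 a1 a2 a3 a4 a5 a6 a7 a8 a9 b1 b2)"
proof -
  obtain a0 a1 a2 a3 a4 a5 a6 a7 a8 a9 b1 b2 where *: "a0 \<noteq> 0" "a6 \<noteq> 0"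
    "PG = const a0 * px ^ 3 + (const a1 * py ^ 2 + const a2 * pz ^ 2 + const a3 * pw ^ 2
              + const a4 * py * pz + const a5 * pz * pw) * px
              + const a6 * py ^ 3 + const a7 * pz ^ 3 + const a8 * pw ^ 3
              + const a9 * py * pz ^ 2 + const b1 * pz ^ 2 * pw + const b2 * pz * pw ^ 2"
    using assms unfolding case_D_def by blast
  have "PG = poly_of (terms_D a0 a1 a2 a3 a4 a5 a6 a7 a8 a9 b1 b2)"
    unfolding *(3) terms_D_def by (simp add: poly_expand add_ac)
  moreover have "PF = poly_of [(2, 0, 1, 0, 1), (1, 0, 0, 2, 0)]"
    using assms by (simp add: case_D_def F_d_poly_of)
  ultimately show ?thesis using *(1,2) by blast
qed

lemma case_N1i_poly_of:
  assumes "case_N1i R PF PG"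
  shows "\<exists>a1 a2 a3 a4 b1 a5 a6 a7 b2 a8 a9 a10. a1 \<noteq> 0 \<and> a2 \<noteq> 0 \<and> b2 \<in> {0, 1} \<and>
    PF = poly_of [(2, 1, 0, 0, 1), (2, 0, 1, 1, 0)] \<and>
    PG = poly_of (terms_N1 a1 a2 a3 1 a4 b1 a5 a6 a7 b2 a8 a9 a10)"
proof -
  obtain a1 a2 a3 a4 b1 a5 a6 a7 b2 a8 a9 a10 where *: "a1 \<noteq> 0" "a2 \<noteq> 0" "b2 \<in> {0, 1}"
    "PG = (const a1 * py + const a2 * pz) * px ^ 2 + const a3 * py * pz * px
              + py ^ 3 + const a4 * pz ^ 3 + const b1 * py ^ 2 * pz + const a5 * py * pz ^ 2
              + (const a6 * py ^ 2 + const a7 * py * pz + const b2 * pz ^ 2) * pw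
              + (const a8 * py + const a9 * pz) * pw ^ 2 + const a10 * pw ^ 3"
    using assms unfolding case_N1i_def by blast
  have "PG = poly_of (terms_N1 a1 a2 a3 1 a4 b1 a5 a6 a7 b2 a8 a9 a10)"
    unfolding *(4) terms_N1_def by (simp add: poly_expand add_ac)
  moreover have "PF = poly_of [(2, 1, 0, 0, 1), (2, 0, 1, 1, 0)]"
    using assms by (simp add: case_N1i_def F_1_poly_of)
  ultimately show ?thesis using *(1-3) by blast
qed

lemma case_N1ii_poly_of:
  assumes "case_N1ii R PF PG"
  shows "\<exists>a1 a2 a3 b1 b2 a4 a5 b3 a6 a7 a8. a1 \<noteq> 0 \<and> a2 \<noteq> 0 \<and> b1 \<in> {0, 1} \<and> b3 \<in> {0, 1} \<and>
    PF = poly_of [(2, 1, 0, 0, 1), (2, 0, 1, 1, 0)] \<and>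
    PG = poly_of (terms_N1 a1 a2 a3 0 0 b1 b2 a4 a5 b3 a6 a7 a8)"
proof -
  obtain a1 a2 a3 b1 b2 a4 a5 b3 a6 a7 a8 where *: "a1 \<noteq> 0" "a2 \<noteq> 0" "b1 \<in> {0, 1}" "b3 \<in> {0, 1}"
    "PG = (const a1 * py + const a2 * pz) * px ^ 2 + const a3 * py * pz * px
              + const b1 * py ^ 2 * pz + const b2 * py * pz ^ 2
              + (const a4 * py ^ 2 + const a5 * py * pz + const b3 * pz ^ 2) * pw
              + (const a6 * py + const a7 * pz) * pw ^ 2 + const a8 * pw ^ 3"
    using assms unfolding case_N1ii_def mult_eq_0_iff de_Morgan_disj by blast
  have "PG = poly_of (terms_N1 a1 a2 a3 0 0 b1 b2 a4 a5 b3 a6 a7 a8)"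
    unfolding *(5) terms_N1_def by (simp add: poly_expand add_ac)
  moreover have "PF = poly_of [(2, 1, 0, 0, 1), (2, 0, 1, 1, 0)]"
    using assms by (simp add: case_N1ii_def F_1_poly_of)
  ultimately show ?thesis using *(1-4) by blast
qed

lemma case_N2_poly_of:
  assumes "case_N2 (- 1) PF PG" and "(3 :: 'a::field) = 0"
  shows "\<exists>a1 a2 a3 b1 a4 a5 a6 a7 b2 a8 a9 a10 :: 'a. (a1, a2) \<noteq> (0, 0) \<and> b1 \<in> {0, 1} \<and> b2 \<in> {0, 1} \<and>
    PF = poly_of [(2, 1, 0, 0, 1), (1, 0, 2, 0, 0), (1, 0, 0, 2, 0)] \<and>
    PG = poly_of (terms_N2 a1 a2 a3 b1 a4 a5 a6 a7 b2 a8 a9 a10)"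
proof -
  obtain a1 a2 a3 b1 a4 a5 a6 a7 b2 a8 a9 a10 :: 'a where *: "(a1, a2) \<noteq> (0, 0)" "b1 \<in> {0, 1}" "b2 \<in> {0, 1}"
    "PG = (const a1 * py + const a2 * pz) * px ^ 2
              + const a3 * (py ^ 2 - const (- 1) * pz ^ 2) * px
              + const b1 * py * (py ^ 2 - const (- 1) * pz ^ 2)
              + const a4 * py * (py ^ 2 + 3 * const (- 1) * pz ^ 2)
              + const a5 * pz * (3 * py ^ 2 + const (- 1) * pz ^ 2)
              + (const a6 * py ^ 2 + const a7 * py * pz + const b2 * pz ^ 2) * pw
              + (const a8 * py + const a9 * pz) * pw ^ 2 + const a10 * pw ^ 3"
    using assms(1) unfolding case_N2_def by blast
  have "(3 :: 'a poly4) = 0"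
    by (metis assms(2) single_numeral single_zero)
  then have "PG = poly_of (terms_N2 a1 a2 a3 b1 a4 a5 a6 a7 b2 a8 a9 a10)"
    unfolding *(4) terms_N2_def by (simp add: poly_expand add_ac single_add single_uminus)
  moreover have "PF = poly_of [(2, 1, 0, 0, 1), (1, 0, 2, 0, 0), (1, 0, 0, 2, 0)]"
    using assms(1) F_2_poly_of[of "- 1"] by (simp add: case_N2_def)
  ultimately show ?thesis using *(1-3) by blast
qed

section \<open>Computing single coefficients of products of term lists\<close>

fun term_coeff :: "'a::comm_ring_1 terms \<Rightarrow> int \<Rightarrow> int \<Rightarrow> int \<Rightarrow> int \<Rightarrow> 'a" where
  "term_coeff [] a b c d = 0"
| "term_coeff ((t, i, j, k, l) # xs) a b c d =
     (if a = int i then if b = int j then if c = int k then if d = int l then t else 0 else 0 else 0 else 0)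
     + term_coeff xs a b c d"

text \<open>The guard only prunes the rewriting: a term that does not divide the target monomial
  contributes zero by \<open>term_coeff_neg\<close>.\<close>

fun prod_coeff :: "'a::comm_ring_1 terms \<Rightarrow> 'a terms \<Rightarrow> int \<Rightarrow> int \<Rightarrow> int \<Rightarrow> int \<Rightarrow> 'a" where
  "prod_coeff [] ys a b c d = 0"
| "prod_coeff ((t, i, j, k, l) # xs) ys a b c d =
     (if int i \<le> a \<and> int j \<le> b \<and> int k \<le> c \<and> int l \<le> d
      then t * term_coeff ys (a - int i) (b - int j) (c - int k) (d - int l) else 0)
     + prod_coeff xs ys a b c d"

fun prod3_coeff :: "'a::comm_ring_1 terms \<Rightarrow> 'a terms \<Rightarrow> 'a terms \<Rightarrow> int \<Rightarrow> int \<Rightarrow> int \<Rightarrow> int \<Rightarrow> 'a" where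
  "prod3_coeff [] ys zs a b c d = 0"
| "prod3_coeff ((t, i, j, k, l) # xs) ys zs a b c d =
     (if int i \<le> a \<and> int j \<le> b \<and> int k \<le> c \<and> int l \<le> d
      then t * prod_coeff ys zs (a - int i) (b - int j) (c - int k) (d - int l) else 0)
     + prod3_coeff xs ys zs a b c d"

lemma term_coeff: "Poly_Mapping.lookup (laurent_of xs) (expo a b c d) = term_coeff xs a b c d"
  by (induction xs) (auto simp: laurent_of_def lookup_add lookup_single expo_eq_iff)

lemma term_coeff_neg: "a < 0 \<or> b < 0 \<or> c < 0 \<or> d < 0 \<Longrightarrow> term_coeff xs a b c d = 0"
  by (induction xs a b c d rule: term_coeff.induct) auto

lemma prod_coeff_neg: "a < 0 \<or> b < 0 \<or> c < 0 \<or> d < 0 \<Longrightarrow> prod_coeff xs ys a b c d = 0"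
  by (induction xs ys a b c d rule: prod_coeff.induct) auto

lemma prod_coeff:
  "Poly_Mapping.lookup (laurent_of xs * laurent_of ys) (expo a b c d) = prod_coeff xs ys a b c d"
proof (induction xs ys a b c d rule: prod_coeff.induct)
  case (2 t i j k l xs ys a b c d)
  have "Poly_Mapping.lookup (laurent_of ((t, i, j, k, l) # xs) * laurent_of ys) (expo a b c d) =
    t * term_coeff ys (a - int i) (b - int j) (c - int k) (d - int l)
      + Poly_Mapping.lookup (laurent_of xs * laurent_of ys) (expo a b c d)"
    by (simp add: laurent_of_def lookup_add distrib_right lookup_single_mult expo_diff flip: term_coeff)
  then show ?case
    using 2 by (auto simp: term_coeff_neg)
qed (simp add: laurent_of_def)

lemma prod3_coeff:
  "Poly_Mapping.lookup (laurent_of xs * (laurent_of ys * laurent_of zs)) (expo a b c d) =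
     prod3_coeff xs ys zs a b c d"
proof (induction xs ys zs a b c d rule: prod3_coeff.induct)
  case (2 t i j k l xs ys zs a b c d)
  have "Poly_Mapping.lookup (laurent_of ((t, i, j, k, l) # xs) * (laurent_of ys * laurent_of zs)) (expo a b c d) =
    t * prod_coeff ys zs (a - int i) (b - int j) (c - int k) (d - int l)
      + Poly_Mapping.lookup (laurent_of xs * (laurent_of ys * laurent_of zs)) (expo a b c d)"
    by (simp add: laurent_of_def lookup_add distrib_right lookup_single_mult expo_diff flip: prod_coeff)
  then show ?case
    using 2 by (auto simp: prod_coeff_neg)
qed (simp add: laurent_of_def)

definition hw_of :: "'a::comm_ring_1 terms \<Rightarrow> 'a terms \<Rightarrow> coord \<Rightarrow> coord \<Rightarrow> 'a" where
  "hw_of fs gs u v = Poly_Mapping.lookup (laurent_of fs ^ 2 * laurent_of gs ^ 2)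
     (neg_exp u - neg_exp v - neg_exp v - neg_exp v)"

definition frob_exp :: "coord \<Rightarrow> coord \<Rightarrow> coord \<Rightarrow> int" where
  "frob_exp u v i = (if i = v then 6 else 3) - (if i = u then 2 else 1)"

lemma hw_of_eq:
  assumes "laurent_of fs ^ 2 = laurent_of f2s"
  shows "hw_of fs gs u v = prod3_coeff f2s gs gs (frob_exp u v CX) (frob_exp u v CY)
     (frob_exp u v CZ) (frob_exp u v CW)"
proof -
  have "neg_exp u - neg_exp v - neg_exp v - neg_exp v =
     expo (frob_exp u v CX) (frob_exp u v CY) (frob_exp u v CZ) (frob_exp u v CW)"
    by (rule poly_mapping_eqI)
      (simp add: lookup_minus lookup_neg_exp lookup_expo frob_exp_def split: coord.split)
  then show ?thesis
    unfolding hw_of_def assms by (simp add: power2_eq_square prod3_coeff)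
qed

section \<open>Entries of the Hasse-Witt matrices in characteristic 3\<close>

context
  assumes three: "(3 :: 'a::field) = 0"
begin

lemma numeral_mod_3: "(2 :: 'a) = - 1" "(4 :: 'a) = 1" "(6 :: 'a) = 0" "(8 :: 'a) = - 1"
proof -
  have "(2 :: 'a) + 1 = 3" "(4 :: 'a) = 1 + 3" "(6 :: 'a) = 3 * 2" "(8 :: 'a) + 1 = 3 * 3" by simp_all
  then show "(2 :: 'a) = - 1" "(4 :: 'a) = 1" "(6 :: 'a) = 0" "(8 :: 'a) = - 1"
    by (simp_all only: three eq_neg_iff_add_eq_0 add_0_right mult_zero_left)
qed

lemma numeral_mult_single:
  "numeral n * Poly_Mapping.single e c = Poly_Mapping.single (e :: coord \<Rightarrow>\<^sub>0 int) (numeral n * c :: 'a)"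
  by (metis add_0 mult_single single_numeral)

text \<open>Squaring F beforehand, with coefficients reduced modulo 3, leaves a product of only
  three lists for each entry.\<close>

lemma laurent_of_square_D:
  "laurent_of [(2 :: 'a, 0, 1, 0, 1), (1, 0, 0, 2, 0)] ^ 2 = laurent_of [(1, 0, 2, 0, 2), (1, 0, 1, 2, 1), (1, 0, 0, 4, 0)]"
  by (simp add: laurent_of_def power2_eq_square distrib_left distrib_right mult_single expo_add
      numeral_mult_single single_uminus algebra_simps) (simp add: numeral_mod_3 single_uminus)

lemma laurent_of_square_N1:
  "laurent_of [(2 :: 'a, 1, 0, 0, 1), (2, 0, 1, 1, 0)] ^ 2 = laurent_of [(1, 2, 0, 0, 2), (- 1, 1, 1, 1, 1), (1, 0, 2, 2, 0)]"
  by (simp add: laurent_of_def power2_eq_square distrib_left distrib_right mult_single expo_add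
      numeral_mult_single single_uminus algebra_simps) (simp add: numeral_mod_3 single_uminus)

lemma laurent_of_square_N2:
  "laurent_of [(2 :: 'a, 1, 0, 0, 1), (1, 0, 2, 0, 0), (1, 0, 0, 2, 0)] ^ 2 = laurent_of [(1, 2, 0, 0, 2), (1, 1, 2, 0, 1), (1, 1, 0, 2, 1), (1, 0, 4, 0, 0), (- 1, 0, 2, 2, 0), (1, 0, 0, 4, 0)]"
  by (simp add: laurent_of_def power2_eq_square distrib_left distrib_right mult_single expo_add
      numeral_mult_single single_uminus algebra_simps) (simp add: numeral_mod_3 single_uminus)

lemma hw_D:
  fixes a0 a1 a2 a3 a4 a5 a6 a7 a8 a9 b1 b2 :: 'a
  defines "M \<equiv> hw_of [(2, 0, 1, 0, 1), (1, 0, 0, 2, 0)] (terms_D a0 a1 a2 a3 a4 a5 a6 a7 a8 a9 b1 b2)"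
  shows
    "M CX CX = - (a0 * a2)" "M CX CY = - (a1 * a9) - a2 * a6" "M CX CZ = - (a1 * b2) - a2 * a7 - a4 * b1 - a5 * a9" "M CX CW = - (a2 * a8) - a3 * b1 - a5 * b2"
    "M CY CX = 0" "M CY CY = - (a1 * a2) + a4 * a4" "M CY CZ = - (a2 * a5) - a3 * a4" "M CY CW = a3 * a3"
    "M CZ CX = 0" "M CZ CY = - (a1 * a4)" "M CZ CZ = - (a1 * a3) + a2 * a2 - a4 * a5" "M CZ CW = - (a3 * a5)"
    "M CW CX = 0" "M CW CY = a1 * a1" "M CW CZ = - (a1 * a5) - a2 * a4" "M CW CW = - (a2 * a3) + a5 * a5"
  unfolding M_def hw_of_eq[OF laurent_of_square_D] terms_D_def
  by (simp_all add: frob_exp_def) (simp_all add: algebra_simps three numeral_mod_3(2-4))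

lemma hw_N1:
  fixes a1 a2 a3 c a4 b1 a5 a6 a7 b2 a8 a9 a10 :: 'a
  defines "M \<equiv> hw_of [(2, 1, 0, 0, 1), (2, 0, 1, 1, 0)] (terms_N1 a1 a2 a3 c a4 b1 a5 a6 a7 b2 a8 a9 a10)"
  shows
    "M CX CX = - (a1 * a5) - a2 * b1 + a3 * a3" "M CX CY = a6 * b1 + a7 * c" "M CX CZ = a4 * a7 + a5 * b2" "M CX CW = a10 * a7 + a8 * a9"
    "M CY CX = - (a2 * a3)" "M CY CY = - (a1 * a8) + a3 * a6 - a5 * c + b1 * b1" "M CY CZ = - (a4 * a5)" "M CY CW = - (a10 * a5) - a7 * a9 - a8 * b2"
    "M CZ CX = - (a1 * a3)" "M CZ CY = - (b1 * c)" "M CZ CZ = - (a2 * a9) + a3 * b2 - a4 * b1 + a5 * a5" "M CZ CW = - (a10 * b1) - a6 * a9 - a7 * a8"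
    "M CW CX = a1 * a2" "M CW CY = - (a1 * a6) + a3 * c" "M CW CZ = - (a2 * b2) + a3 * a4" "M CW CW = a10 * a3 - a5 * a8 - a6 * b2 + a7 * a7 - a9 * b1"
  unfolding M_def hw_of_eq[OF laurent_of_square_N1] terms_N1_def
  by (simp_all add: frob_exp_def) (simp_all add: algebra_simps three numeral_mod_3(2-4))

lemma hw_N2:
  fixes a1 a2 a3 b1 a4 a5 a6 a7 b2 a8 a9 a10 :: 'a
  defines "M \<equiv> hw_of [(2, 1, 0, 0, 1), (1, 0, 2, 0, 0), (1, 0, 0, 2, 0)] (terms_N2 a1 a2 a3 b1 a4 a5 a6 a7 b2 a8 a9 a10)"
  shows
    "M CX CX = - (a1 * b1) - a3 * a3" "M CX CY = - (a4 * a6) - a4 * b2 + a6 * b1 - b1 * b2" "M CX CZ = a5 * a6 + a5 * b2 - a7 * b1" "M CX CW = - (a10 * a6) - a10 * b2 + a8 * a8 + a9 * a9"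
    "M CY CX = - (a1 * a3)" "M CY CY = a1 * a8 - a2 * a9 + a3 * a6 - a3 * b2 - a4 * b1 - b1 * b1" "M CY CZ = - (a1 * a9) - a2 * a8 - a3 * a7 + a5 * b1" "M CY CW = - (a10 * b1) - a7 * a9 - a8 * b2"
    "M CZ CX = - (a2 * a3)" "M CZ CY = - (a1 * a9) - a2 * a8 - a3 * a7" "M CZ CZ = - (a1 * a8) + a2 * a9 - a3 * a6 + a3 * b2 + b1 * b1" "M CZ CW = - (a6 * a9) - a7 * a8"
    "M CW CX = a1 * a1 + a2 * a2" "M CW CY = a1 * a6 - a1 * b2 - a2 * a7 + a3 * a4" "M CW CZ = - (a1 * a7) - a2 * a6 + a2 * b2 - a3 * a5" "M CW CW = a10 * a3 - a6 * b2 + a7 * a7 - a8 * b1"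
  unfolding M_def hw_of_eq[OF laurent_of_square_N2] terms_N2_def
  by (simp_all add: frob_exp_def) (simp_all add: algebra_simps three numeral_mod_3(2-4))

end

section \<open>Fields with three elements\<close>

lemma three_elements:
  assumes "CARD('k::field) = 3"
  shows "(UNIV :: 'k set) = {0, 1, - 1}" and "(3 :: 'k) = 0"
proof -
  have "\<exists>x. x \<notin> {0, 1 :: 'k}"
  proof (rule ccontr)
    assume "\<not> ?thesis"
    then have "(UNIV :: 'k set) = {0, 1}" by auto
    then have "CARD('k) = card {0, 1 :: 'k}" by simp
    then show False using assms by simp
  qed
  then obtain x :: 'k where x: "x \<noteq> 0" "x \<noteq> 1" by auto
  have U: "(UNIV :: 'k set) = {0, 1, x}"
  proof (rule sym, rule card_subset_eq)
    show "finite (UNIV :: 'k set)" using assms by (simp add: card_ge_0_finite)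
    show "card {0, 1, x} = CARD('k)" using x assms by simp
  qed simp
  have "1 + x \<in> {0, 1, x}" using U by blast
  then have x1: "1 + x = 0" using x by auto
  then have m: "x = - 1" by (simp add: eq_neg_iff_add_eq_0 add.commute)
  have "1 + 1 \<in> {0, 1, x}" using U by blast
  moreover have "(1 :: 'k) + 1 \<noteq> 0"
    using m x(2) by (metis add_eq_0_iff)
  moreover have "(1 :: 'k) + 1 \<noteq> 1"
    by (metis add_cancel_right_right one_neq_zero)
  ultimately have "1 + 1 = x" by (simp del: one_add_one)
  then have "1 + (1 + 1) = (0 :: 'k)" using x1 by simp
  then show "(3 :: 'k) = 0" by simp
  show "(UNIV :: 'k set) = {0, 1, - 1}" using U m by simp
qed

lemma cube_three_elements:
  assumes "CARD('k::field) = 3"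
  shows "(x :: 'k) ^ 3 = x"
proof -
  have "x \<in> {0, 1, - 1}" using three_elements(1)[OF assms] by blast
  then show ?thesis by auto
qed

lemma CHAR_three_elements:
  assumes "CARD('k::field) = 3"
  shows "CHAR('k) = 3"
proof (rule CHAR_eq_posI)
  fix n :: nat assume "n > 0" "n < 3"
  then have "n = 1 \<or> n = 2" by auto
  moreover have "(2 :: 'k) \<noteq> 0"
    unfolding numeral_mod_3(1)[OF three_elements(2)[OF assms]] by simp
  ultimately show "of_nat n \<noteq> (0 :: 'k)" by auto
qed (use three_elements(2)[OF assms] in simp_all)

section \<open>Consequences of the cohomological hypotheses\<close>

lemma part_laurent_of:
  "part P (laurent_of xs) =
     laurent_of (filter (\<lambda>(t, i, j, k, l). P (expo (int i) (int j) (int k) (int l))) xs)"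
proof (induction xs)
  case (Cons x xs)
  have *: "part P (Poly_Mapping.single e c) = (if P e then Poly_Mapping.single e c else 0)"
    for e and c :: 'a
    by (rule poly_mapping_eqI) (auto simp: lookup_part lookup_single when_def)
  obtain c i j k l where x: "x = (c, i, j, k, l)" by (metis prod_cases5)
  show ?case using Cons by (simp add: laurent_of_def x part_add *)
qed (simp add: laurent_of_def)

text \<open>\<open>lin\<close> makes F prime, \<open>ndvd\<close> excludes that it divides G, and
  \<open>parts\<close> says that no variable divides F; together they give the Koszul exactness
  required by \<open>regular_pair\<close>.\<close>

lemma hw_of_rank_one:
  fixes fs gs :: "'k::field terms" and \<xi> :: "4 \<Rightarrow> 'k cochain"
  assumes card: "CARD('k) = 3"
    and fs: "\<forall>(t, i, j, k, l)\<in>set fs. i + j + k + l = 2"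
    and gs: "\<forall>(t, i, j, k, l)\<in>set gs. i + j + k + l = 3"
    and lin: "linear_in_var v m c q (laurent_of fs)"
    and parts: "\<And>i. part (\<lambda>e. Poly_Mapping.lookup e i = 0) (laurent_of fs) \<noteq> 0"
    and ndvd: "\<not> laurent_of fs dvd laurent_of gs"
    and basis: "H1_basis (poly_of fs) (poly_of gs) \<xi>"
    and prank: "p_rank (hasse_witt (poly_of fs) (poly_of gs) \<xi>) = 0"
    and anum: "a_number (hasse_witt (poly_of fs) (poly_of gs) \<xi>) = 3"
  shows "hw_of fs gs i j * hw_of fs gs k l = hw_of fs gs i l * hw_of fs gs k j"
    and "hw_of fs gs CX CX + hw_of fs gs CY CY + hw_of fs gs CZ CZ + hw_of fs gs CW CW = 0"
proof -
  interpret lin: linear_in_var v m c q "laurent_of fs" by (rule lin)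
  interpret regular_pair "poly_of fs" "poly_of gs" "to_laurent (poly_of fs)" "to_laurent (poly_of gs)"
  proof unfold_locales
    show "homogeneous 2 (to_laurent (poly_of fs))"
      unfolding to_laurent_poly_of by (rule homogeneous_laurent_of) (use fs in fastforce)
    show "homogeneous 3 (to_laurent (poly_of gs))"
      unfolding to_laurent_poly_of by (rule homogeneous_laurent_of) (use gs in fastforce)
    show "to_laurent (poly_of fs) \<noteq> 0"
      using parts[of CX] by (auto simp: to_laurent_poly_of)
    show "to_laurent (poly_of gs) \<noteq> 0"
      using ndvd by (auto simp: to_laurent_poly_of)
    fix a b :: "'k laurent4" and I
    assume ab: "b \<in> localized I" "a * to_laurent (poly_of fs) + b * to_laurent (poly_of gs) = 0"
    have "laurent_of fs \<in> localized {}"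
      using to_laurent_localized[of "poly_of fs"] by (simp add: to_laurent_poly_of)
    from lin.syzygy[OF this parts ndvd, of a b I] ab
    show "\<exists>e\<in>localized I. a = e * to_laurent (poly_of gs) \<and> b = - e * to_laurent (poly_of fs)"
      by (simp add: to_laurent_poly_of)
  qed (use three_elements(2)[OF card] cube_three_elements[OF card] in auto)
  have "hw u v = hw_of fs gs u v" for u v
    by (simp add: hw_def hw_of_def to_laurent_poly_of)
  then show "hw_of fs gs i j * hw_of fs gs k l = hw_of fs gs i l * hw_of fs gs k j"
    "hw_of fs gs CX CX + hw_of fs gs CY CY + hw_of fs gs CZ CZ + hw_of fs gs CW CW = 0"
    using hw_rank_one[OF basis CHAR_three_elements[OF card] prank anum] by (simp_all add: sum_coord)
qed

lemma laurent_of_neq_0: "term_coeff xs a b c d \<noteq> 0 \<Longrightarrow> laurent_of xs \<noteq> 0"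
  by (metis term_coeff lookup_zero)

lemma free_of_laurent_of: "\<forall>(t, i, j, k, l)\<in>set xs. l = 0 \<Longrightarrow> free_of CW (laurent_of xs)"
  unfolding free_of_def by (fastforce dest: keys_laurent_of simp: lookup_expo)

section \<open>Singular points\<close>

lemma rank_proportional_rows:
  fixes u v :: "'a::field ^ 'n"
  assumes "v = t *s u"
  shows "rank (vector [u, v] :: 'a ^ 'n ^ 2) \<noteq> 2"
proof -
  have "row i (vector [u, v] :: 'a ^ 'n ^ 2) \<in> vec.span {u}" for i
    using exhaust_2[of i] assms
    by (auto simp: row_def vec_lambda_eta vector_2 vec.span_base vec.span_scale)
  then have "rows (vector [u, v] :: 'a ^ 'n ^ 2) \<subseteq> vec.span {u}"
    by (auto simp: rows_def)
  then have "vec.dim (rows (vector [u, v] :: 'a ^ 'n ^ 2)) \<le> card {u}"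
    by (rule vec.dim_le_card) simp
  then show ?thesis by (simp add: row_rank_def_gen)
qed

definition eval_terms :: "('a \<Rightarrow> 'b::comm_ring_1) \<Rightarrow> 'a terms \<Rightarrow> 'b \<Rightarrow> 'b \<Rightarrow> 'b \<Rightarrow> 'b \<Rightarrow> 'b" where
  "eval_terms h xs x y z w = (\<Sum>(c, i, j, k, l)\<leftarrow>xs. h c * (x ^ i * y ^ j * z ^ k * w ^ l))"

lemma smooth_curve_gradient:
  fixes fs gs :: "'a::field terms" and x y z w t :: "'a alg_closure"
  assumes "smooth_curve (poly_of fs) (poly_of gs)"
    and "(x, y, z, w) \<noteq> (0, 0, 0, 0)"
    and "eval_terms to_ac fs x y z w = 0" and "eval_terms to_ac gs x y z w = 0"
    and "\<And>n. eval_terms to_ac (map (term_deriv n) gs) x y z w =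
           t * eval_terms to_ac (map (term_deriv n) fs) x y z w"
  shows False
proof -
  define P :: "'a alg_closure ^ coord" where
    "P = (\<chi> i. case i of CX \<Rightarrow> x | CY \<Rightarrow> y | CZ \<Rightarrow> z | CW \<Rightarrow> w)"
  have P: "P $ CX = x" "P $ CY = y" "P $ CZ = z" "P $ CW = w"
    by (simp_all add: P_def)
  have eval: "eval4 to_ac (poly_of xs) P = eval_terms to_ac xs x y z w" for xs
    by (simp add: eval4_poly_of eval_terms_def P)
  have "P \<noteq> 0"
    using assms(2) P by (metis zero_index)
  then have "P \<in> zeros (poly_of fs) (poly_of gs)"
    using assms(3,4) by (simp add: zeros_def eval)
  then have "rank (vector [\<chi> i. eval4 to_ac (pderiv4 i (poly_of fs)) P,
      \<chi> i. eval4 to_ac (pderiv4 i (poly_of gs)) P] :: 'a alg_closure ^ coord ^ 2) = 2"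
    using assms(1) by (simp add: smooth_curve_def)
  moreover have "(\<chi> i. eval4 to_ac (pderiv4 i (poly_of gs)) P) =
      t *s (\<chi> i. eval4 to_ac (pderiv4 i (poly_of fs)) P)"
    by (simp add: vec_eq_iff pderiv4_poly_of eval assms(5))
  ultimately show False
    using rank_proportional_rows by blast
qed

section \<open>The quadric cone\<close>

lemma rank_one_D:
  fixes a0 a1 a2 a3 a4 a5 a6 a7 a8 a9 b1 b2 :: "'k::field" and \<xi> :: "4 \<Rightarrow> 'k cochain"
  defines "fs \<equiv> [(2, 0, 1, 0, 1), (1, 0, 0, 2, 0)]"
    and "gs \<equiv> terms_D a0 a1 a2 a3 a4 a5 a6 a7 a8 a9 b1 b2"
  assumes card: "CARD('k) = 3" and a0: "a0 \<noteq> 0"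
    and H1: "H1_basis (poly_of fs) (poly_of gs) \<xi>"
    "p_rank (hasse_witt (poly_of fs) (poly_of gs) \<xi>) = 0"
    "a_number (hasse_witt (poly_of fs) (poly_of gs) \<xi>) = 3"
  shows "hw_of fs gs i j * hw_of fs gs k l = hw_of fs gs i l * hw_of fs gs k j"
    and "hw_of fs gs CX CX + hw_of fs gs CY CY + hw_of fs gs CZ CZ + hw_of fs gs CW CW = 0"
proof -
  note two = numeral_mod_3(1)[OF three_elements(2)[OF card]]
  have lin: "linear_in_var CW (expo 0 1 0 0) (2 :: 'k) (laurent_of [(1, 0, 0, 2, 0)]) (laurent_of fs)"
  proof
    show "laurent_of fs = Poly_Mapping.single (expo 0 1 0 0) 2 * Poly_Mapping.single (Poly_Mapping.single CW 1) 1
        + laurent_of [(1 :: 'k, 0, 0, 2, 0)]"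
      by (simp add: fs_def laurent_of_def mult_single) (simp add: expo_def)
    show "laurent_of [(1 :: 'k, 0, 0, 2, 0)] \<noteq> 0"
      by (rule laurent_of_neq_0[of _ 0 0 2 0]) simp
    show "free_of CW (laurent_of [(1 :: 'k, 0, 0, 2, 0)])"
      by (rule free_of_laurent_of) simp
  qed (simp_all add: two lookup_expo)
  have part_neq_0: "part (\<lambda>e. Poly_Mapping.lookup e n = 0) (laurent_of fs) \<noteq> 0" for n
  proof (cases "n = CZ")
    case True
    then show ?thesis
      unfolding part_laurent_of by (intro laurent_of_neq_0[of _ 0 1 0 1]) (simp add: fs_def lookup_expo two)
  next
    case False
    then show ?thesis
      unfolding part_laurent_of
      by (intro laurent_of_neq_0[of _ 0 0 2 0]) (cases n; simp add: fs_def lookup_expo)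
  qed
  have part_G: "part (\<lambda>e. Poly_Mapping.lookup e CX = 3) (laurent_of gs) = laurent_of [(a0, 3, 0, 0, 0)]"
    by (simp add: part_laurent_of gs_def terms_D_def lookup_expo)
  have "\<not> laurent_of fs dvd laurent_of gs"
  \<comment> \<open>The equation of the cone is free of x, and the x-cubic part of G is a0 x^3,
    which is free of w.\<close>
  proof (rule linear_in_var.F_not_dvd[OF lin, where \<mu> = "\<lambda>e. Poly_Mapping.lookup e CX" and d = 3])
    fix e assume "e \<in> Poly_Mapping.keys (laurent_of fs)"
    then show "Poly_Mapping.lookup e CX = 0"
      using keys_laurent_of by (fastforce simp: fs_def lookup_expo)
  next
    show "part (\<lambda>e. Poly_Mapping.lookup e CX = 3) (laurent_of gs) \<noteq> 0"
      unfolding part_G by (rule laurent_of_neq_0[of _ 3 0 0 0]) (simp add: a0)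
    show "free_of CW (part (\<lambda>e. Poly_Mapping.lookup e CX = 3) (laurent_of gs))"
      unfolding part_G by (rule free_of_laurent_of) simp
  qed (simp add: lookup_add)
  note * = hw_of_rank_one[OF card _ _ lin part_neq_0 this H1]
  show "hw_of fs gs i j * hw_of fs gs k l = hw_of fs gs i l * hw_of fs gs k j"
    by (rule *(1)) (simp_all add: fs_def gs_def terms_D_def)
  show "hw_of fs gs CX CX + hw_of fs gs CY CY + hw_of fs gs CZ CZ + hw_of fs gs CW CW = 0"
    by (rule *(2)) (simp_all add: fs_def gs_def terms_D_def)
qed

text \<open>As 2 = -1, the cone is z^2 = y w, parametrized by (y, z, w) = (s^2, s v, v^2). There G =
  a0 x^3 + r x + h with forms r, h in s, v. Since x^3 has derivative zero, a singular point arises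
  at a double root of r where the derivative of h vanishes as well; x is then found by a cube
  root.\<close>

lemma no_curve_D:
  fixes a0 a1 a2 a3 a4 a5 a6 a7 a8 a9 b1 b2 :: "'k::field" and \<xi> :: "4 \<Rightarrow> 'k cochain"
  defines "fs \<equiv> [(2, 0, 1, 0, 1), (1, 0, 0, 2, 0)]"
    and "gs \<equiv> terms_D a0 a1 a2 a3 a4 a5 a6 a7 a8 a9 b1 b2"
  assumes card: "CARD('k) = 3" and a0: "a0 \<noteq> 0"
    and smooth: "smooth_curve (poly_of fs) (poly_of gs)"
    and H1: "H1_basis (poly_of fs) (poly_of gs) \<xi>"
    "p_rank (hasse_witt (poly_of fs) (poly_of gs) \<xi>) = 0"
    "a_number (hasse_witt (poly_of fs) (poly_of gs) \<xi>) = 3"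
  shows False
proof -
  note three = three_elements(2)[OF card] and cube = cube_three_elements[OF card]
  note two = numeral_mod_3(1)[OF three]
  have three_ac: "(3 :: 'k alg_closure) = 0" by (metis three to_ac_0 to_ac_numeral)
  note two_ac = numeral_mod_3(1)[OF three_ac]
  note rank1 = rank_one_D[OF card a0 H1[unfolded fs_def gs_def], unfolded hw_D[OF three]]
  \<comment> \<open>Column CX vanishes off the diagonal. If its diagonal entry -(a0 a2) were
    nonzero, the minors would kill all other diagonal entries and it would equal the trace.\<close>
  have a2: "a2 = 0"
  proof (rule ccontr)
    assume "a2 \<noteq> 0"
    then have "- (a1 * a2) + a4 * a4 = 0" "- (a1 * a3) + a2 * a2 - a4 * a5 = 0" "- (a2 * a3) + a5 * a5 = 0"
      using rank1(1)[of CX CX CY CY] rank1(1)[of CX CX CZ CZ] rank1(1)[of CX CX CW CW] a0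
      unfolding hw_D[OF three] by simp_all
    then have "a0 * a2 = 0"
      using rank1(2) by (simp add: algebra_simps)
    then show False using a0 \<open>a2 \<noteq> 0\<close> by simp
  qed
  have trits: "t = 0 \<or> t = 1 \<or> t = - 1" for t :: 'k
    using three_elements(1)[OF card] by blast
  show False
  proof (cases "a1 = 0")
    case True
    \<comment> \<open>The minor gives a4 a5 = 0 and the trace a4^2 - a4 a5 + a5^2 = 0. Now r has a
      double root at v = 0, that is at (y, z, w) = (1, 0, 0).\<close>
    have "a4 = 0"
      using rank1(1)[of CY CY CW CW] rank1(2) trits[of a4] unfolding hw_D[OF three]
      by (auto simp: True a2)
    define x where "x = - a6 / a0"
    have x: "a0 * x ^ 3 + a6 = 0"
      using a0 by (simp add: cube x_def)
    show False
    proof (rule smooth_curve_gradient[OF smooth, of "to_ac x" 1 0 0 0])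
      have "eval_terms to_ac gs (to_ac x) 1 0 0 = to_ac (a0 * x ^ 3 + a6)"
        by (simp add: eval_terms_def gs_def terms_D_def True)
      then show "eval_terms to_ac gs (to_ac x) 1 0 0 = 0" by (simp only: x to_ac_0)
      fix n
      show "eval_terms to_ac (map (term_deriv n) gs) (to_ac x) 1 0 0 =
          0 * eval_terms to_ac (map (term_deriv n) fs) (to_ac x) 1 0 0"
        by (cases n) (simp_all add: eval_terms_def gs_def terms_D_def True \<open>a4 = 0\<close> three_ac)
    qed (simp_all add: eval_terms_def fs_def)
  next
    case False
    then have a1: "a1 = 1 \<or> a1 = - 1" using trits[of a1] by blast
    then have a1_sq: "a1 * a1 = 1" by auto
    \<comment> \<open>The minor in rows CZ and CW gives a1 a3 = a4 a5, whereupon the trace becomes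
      (a4 - a5)^2. Consequently r = a1 (s + a1 a4 v)^4 on the cone.\<close>
    have "a5 = a4 \<and> a3 = a1 * a4 ^ 2"
      using rank1(1)[of CY CZ CW CY] rank1(1)[of CZ CZ CW CY] rank1(1)[of CY CW CW CY] rank1(2)
        a1 trits[of a3] trits[of a4] trits[of a5]
      unfolding hw_D[OF three] a2
      by (elim disjE) (simp_all add: two)
    then have eqs: "a5 = a4" "a3 = a1 * a4 ^ 2" by blast+
    \<comment> \<open>This minor says that for v = 1 the derivative a9 s^3 - b1 s + b2 of h vanishes
      at s = -a1 a4, the root of r.\<close>
    have "(- (a1 * b2) - a4 * b1 - a4 * a9) - a9 * a4 = 0"
      using rank1(1)[of CX CZ CW CY] a1
      unfolding hw_D[OF three] a2 eqs by auto
    moreover have "a1 * b2 = - (a4 * b1) - 2 * (a4 * a9) - ((- (a1 * b2) - a4 * b1 - a4 * a9) - a9 * a4)"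
      by (simp add: algebra_simps)
    ultimately have "a1 * b2 = - (a4 * b1) - 2 * (a4 * a9)"
      by (simp only: diff_zero)
    then have "a1 * b2 = a4 * (a9 - b1)"
      by (simp add: two algebra_simps)
    then have "a1 * (a1 * b2) = a1 * (a4 * (a9 - b1))"
      by simp
    then have b2: "b2 = a1 * (a4 * (a9 - b1))"
      by (simp add: a1_sq flip: mult.assoc)
    \<comment> \<open>q is the value of h at s = -a1 a4, v = 1, which is the point (y, z, w) =
      (a4^2, -a1 a4, 1).\<close>
    define q where "q = a6 * a4 ^ 6 - a7 * (a1 * a4) ^ 3 + a8 + a9 * a4 ^ 4 * a1 ^ 2 + b1 * (a1 * a4) ^ 2 - b2 * a1 * a4"
    define x where "x = - q / a0"
    have x: "a0 * x ^ 3 + q = 0"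
      using a0 by (simp add: cube x_def)
    have G: "eval_terms to_ac gs (to_ac x) (to_ac (a4 ^ 2)) (to_ac (- a1 * a4)) 1 = to_ac (a0 * x ^ 3 + q)"
      using a1 trits[of a4] unfolding eqs q_def b2
      by (elim disjE) (simp_all add: eval_terms_def gs_def terms_D_def a2 eqs b2 two three three_ac algebra_simps)
    show False
    \<comment> \<open>The multiplier is read off from the y-derivatives: that of F is 2 w = -1 at
      this point.\<close>
    proof (rule smooth_curve_gradient[OF smooth, of "to_ac x" "to_ac (a4 ^ 2)" "to_ac (- a1 * a4)" 1
          "- eval_terms to_ac (map (term_deriv CY) gs) (to_ac x) (to_ac (a4 ^ 2)) (to_ac (- a1 * a4)) 1"])
      show "eval_terms to_ac gs (to_ac x) (to_ac (a4 ^ 2)) (to_ac (- a1 * a4)) 1 = 0"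
        by (simp only: x G to_ac_0)
      show "eval_terms to_ac fs (to_ac x) (to_ac (a4 ^ 2)) (to_ac (- a1 * a4)) 1 = 0"
        using a1 trits[of a4]
        by (elim disjE) (simp_all add: eval_terms_def fs_def two_ac)
      fix n
      show "eval_terms to_ac (map (term_deriv n) gs) (to_ac x) (to_ac (a4 ^ 2)) (to_ac (- a1 * a4)) 1 =
          - eval_terms to_ac (map (term_deriv CY) gs) (to_ac x) (to_ac (a4 ^ 2)) (to_ac (- a1 * a4)) 1 *
          eval_terms to_ac (map (term_deriv n) fs) (to_ac x) (to_ac (a4 ^ 2)) (to_ac (- a1 * a4)) 1"
        using a1 trits[of a4]
        by (elim disjE; cases n) (simp_all add: eval_terms_def gs_def fs_def terms_D_def a2 eqs b2 three_ac two_ac algebra_simps)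
    qed simp
  qed
qed

section \<open>The split quadric\<close>

text \<open>The singularity conditions with all derivatives reduced by 2 = -1 and 3 = 0; t is the
  multiplier for the gradient (w, z, y, x) of x w + y z.\<close>

definition N1_singular where
  "N1_singular a1 a2 a3 c a4 b1 a5 a6 a7 b2 a8 a9 a10 x y z w t \<longleftrightarrow>
     (x, y, z, w) \<noteq> (0, 0, 0, 0) \<and> x * w + y * z = 0 \<and>
     a1 * x ^ 2 * y + a2 * x ^ 2 * z + a3 * x * y * z + c * y ^ 3 + a4 * z ^ 3 + b1 * y ^ 2 * z
       + a5 * y * z ^ 2 + a6 * y ^ 2 * w + a7 * y * z * w + b2 * z ^ 2 * w
       + a8 * y * w ^ 2 + a9 * z * w ^ 2 + a10 * w ^ 3 = 0 \<and>
     a3 * y * z - a1 * x * y - a2 * x * z = t * w \<and>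
     a1 * x ^ 2 + a3 * x * z - b1 * y * z + a5 * z ^ 2 - a6 * y * w + a7 * z * w + a8 * w ^ 2 = t * z \<and>
     a2 * x ^ 2 + a3 * x * y + b1 * y ^ 2 - a5 * y * z + a7 * y * w - b2 * z * w + a9 * w ^ 2 = t * y \<and>
     a6 * y ^ 2 + a7 * y * z + b2 * z ^ 2 - a8 * y * w - a9 * z * w = (t :: 'a::field) * x"

lemma N1_singular_to_ac:
  assumes "N1_singular a1 a2 a3 c a4 b1 a5 a6 a7 b2 a8 a9 a10 x y z w t"
  shows "N1_singular (to_ac a1) (to_ac a2) (to_ac a3) (to_ac c) (to_ac a4) (to_ac b1) (to_ac a5)
    (to_ac a6) (to_ac a7) (to_ac b2) (to_ac a8) (to_ac a9) (to_ac a10)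
    (to_ac x) (to_ac y) (to_ac z) (to_ac w) (to_ac t)"
  using assms unfolding N1_singular_def
  by (simp flip: to_ac_add to_ac_mult to_ac_power to_ac_diff)

lemma N1_singular_not_smooth:
  fixes a1 a2 a3 c a4 b1 a5 a6 a7 b2 a8 a9 a10 :: "'k::field"
  assumes three: "(3 :: 'k) = 0"
    and smooth: "smooth_curve (poly_of [(2, 1, 0, 0, 1), (2, 0, 1, 1, 0)])
      (poly_of (terms_N1 a1 a2 a3 c a4 b1 a5 a6 a7 b2 a8 a9 a10))"
  shows "\<not> N1_singular (to_ac a1) (to_ac a2) (to_ac a3) (to_ac c) (to_ac a4) (to_ac b1) (to_ac a5)
    (to_ac a6) (to_ac a7) (to_ac b2) (to_ac a8) (to_ac a9) (to_ac a10) x y z w t"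
proof
  assume *: "N1_singular (to_ac a1) (to_ac a2) (to_ac a3) (to_ac c) (to_ac a4) (to_ac b1) (to_ac a5)
    (to_ac a6) (to_ac a7) (to_ac b2) (to_ac a8) (to_ac a9) (to_ac a10) x y z w t"
  have three_ac: "(3 :: 'k alg_closure) = 0" by (metis three to_ac_0 to_ac_numeral)
  note two_ac = numeral_mod_3(1)[OF three_ac]
  show False
  proof (rule smooth_curve_gradient[OF smooth, of x y z w "- t"])
    show "eval_terms to_ac [(2, 1, 0, 0, 1), (2, 0, 1, 1, 0)] x y z w = 0"
      using * by (simp add: N1_singular_def eval_terms_def flip: distrib_left)
    show "eval_terms to_ac (terms_N1 a1 a2 a3 c a4 b1 a5 a6 a7 b2 a8 a9 a10) x y z w = 0"
      using *[unfolded N1_singular_def, THEN conjunct2, THEN conjunct2, THEN conjunct1]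
      by (simp add: eval_terms_def terms_N1_def algebra_simps)
    fix n
    show "eval_terms to_ac (map (term_deriv n) (terms_N1 a1 a2 a3 c a4 b1 a5 a6 a7 b2 a8 a9 a10)) x y z w =
        - t * eval_terms to_ac (map (term_deriv n) [(2, 1, 0, 0, 1), (2, 0, 1, 1, 0)]) x y z w"
      using * by (cases n)
        (simp_all add: N1_singular_def eval_terms_def terms_N1_def two_ac three_ac algebra_simps)
  qed (use * in \<open>simp add: N1_singular_def\<close>)
qed

text \<open>Away from $x = 0$ the derivative in the direction $x$ is determined by Euler's relation.\<close>

lemma N1_singular_affine:
  fixes a1 a2 a3 c a4 b1 a5 a6 a7 b2 a8 a9 a10 y z w t :: "'a::field"
  assumes three: "(3 :: 'a) = 0" and w: "w = - y * z"
    and G: "a1 * y + a2 * z + a3 * y * z + c * y ^ 3 + a4 * z ^ 3 + b1 * y ^ 2 * z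
       + a5 * y * z ^ 2 + a6 * y ^ 2 * w + a7 * y * z * w + b2 * z ^ 2 * w
       + a8 * y * w ^ 2 + a9 * z * w ^ 2 + a10 * w ^ 3 = 0"
    and t: "t = a6 * y ^ 2 + a7 * y * z + b2 * z ^ 2 - a8 * y * w - a9 * z * w"
    and Gy: "a1 + a3 * z - b1 * y * z + a5 * z ^ 2 - a6 * y * w + a7 * z * w + a8 * w ^ 2 = t * z"
    and Gz: "a2 + a3 * y + b1 * y ^ 2 - a5 * y * z + a7 * y * w - b2 * z * w + a9 * w ^ 2 = t * y"
  shows "N1_singular a1 a2 a3 c a4 b1 a5 a6 a7 b2 a8 a9 a10 1 y z w t"
proof -
  have "(a3 * y * z - a1 * y - a2 * z)
     + y * (a1 + a3 * z - b1 * y * z + a5 * z ^ 2 - a6 * y * w + a7 * z * w + a8 * w ^ 2)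
     + z * (a2 + a3 * y + b1 * y ^ 2 - a5 * y * z + a7 * y * w - b2 * z * w + a9 * w ^ 2)
     + w * (a6 * y ^ 2 + a7 * y * z + b2 * z ^ 2 - a8 * y * w - a9 * z * w) =
     3 * (a3 * y * z + a7 * y * z * w)"
    by (simp add: algebra_simps power2_eq_square)
  then have "a3 * y * z - a1 * y - a2 * z + y * (t * z) + z * (t * y) + w * t = 0"
    unfolding Gy Gz three t[symmetric] by simp
  then have "a3 * y * z - a1 * y - a2 * z = t * (w + 3 * - (y * z)) "
    by (simp add: w algebra_simps numeral_mod_3(2)[OF three])
  then have "a3 * y * z - a1 * y - a2 * z = t * w"
    by (simp only: three mult_zero_left add_0_right)
  then show ?thesis
    unfolding N1_singular_def using G Gy Gz t w by simp
qed

lemma rank_one_N1: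
  fixes a1 a2 a3 c a4 b1 a5 a6 a7 b2 a8 a9 a10 :: "'k::field" and \<xi> :: "4 \<Rightarrow> 'k cochain"
  defines "fs \<equiv> [(2, 1, 0, 0, 1), (2, 0, 1, 1, 0)]"
    and "gs \<equiv> terms_N1 a1 a2 a3 c a4 b1 a5 a6 a7 b2 a8 a9 a10"
  assumes card: "CARD('k) = 3" and a1: "a1 \<noteq> 0"
    and H1: "H1_basis (poly_of fs) (poly_of gs) \<xi>"
    "p_rank (hasse_witt (poly_of fs) (poly_of gs) \<xi>) = 0"
    "a_number (hasse_witt (poly_of fs) (poly_of gs) \<xi>) = 3"
  shows "hw_of fs gs i j * hw_of fs gs k l = hw_of fs gs i l * hw_of fs gs k j"
    and "hw_of fs gs CX CX + hw_of fs gs CY CY + hw_of fs gs CZ CZ + hw_of fs gs CW CW = 0"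
proof -
  note two = numeral_mod_3(1)[OF three_elements(2)[OF card]]
  have lin: "linear_in_var CW (expo 1 0 0 0) (2 :: 'k) (laurent_of [(2, 0, 1, 1, 0)]) (laurent_of fs)"
  proof
    show "laurent_of fs = Poly_Mapping.single (expo 1 0 0 0) 2 * Poly_Mapping.single (Poly_Mapping.single CW 1) 1
        + laurent_of [(2 :: 'k, 0, 1, 1, 0)]"
      by (simp add: fs_def laurent_of_def mult_single) (simp add: expo_def)
    show "laurent_of [(2 :: 'k, 0, 1, 1, 0)] \<noteq> 0"
      by (rule laurent_of_neq_0[of _ 0 1 1 0]) (simp add: two)
    show "free_of CW (laurent_of [(2 :: 'k, 0, 1, 1, 0)])"
      by (rule free_of_laurent_of) simp
  qed (simp_all add: two lookup_expo)
  have part_neq_0: "part (\<lambda>e. Poly_Mapping.lookup e n = 0) (laurent_of fs) \<noteq> 0" for n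
  proof (cases "n = CX \<or> n = CW")
    case True
    then show ?thesis
      unfolding part_laurent_of
      by (intro laurent_of_neq_0[of _ 0 1 1 0]) (cases n; simp add: fs_def lookup_expo two)
  next
    case False
    then show ?thesis
      unfolding part_laurent_of
      by (intro laurent_of_neq_0[of _ 1 0 0 1]) (cases n; simp add: fs_def lookup_expo two)
  qed
  \<comment> \<open>For this grading x w and y z both have degree 0, and the part of G of degree 2
    consists of the terms with x^2.\<close>
  let ?\<mu> = "\<lambda>e. Poly_Mapping.lookup e CX - Poly_Mapping.lookup e CW :: int"
  have part_G: "part (\<lambda>e. ?\<mu> e = 2) (laurent_of gs) = laurent_of [(a1, 2, 1, 0, 0), (a2, 2, 0, 1, 0)]"
    by (simp add: part_laurent_of gs_def terms_N1_def lookup_expo)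
  have "\<not> laurent_of fs dvd laurent_of gs"
  proof (rule linear_in_var.F_not_dvd[OF lin, where \<mu> = ?\<mu> and d = 2])
    fix e assume "e \<in> Poly_Mapping.keys (laurent_of fs)"
    then show "?\<mu> e = 0"
      using keys_laurent_of by (fastforce simp: fs_def lookup_expo)
  next
    show "part (\<lambda>e. ?\<mu> e = 2) (laurent_of gs) \<noteq> 0"
      unfolding part_G by (rule laurent_of_neq_0[of _ 2 1 0 0]) (simp add: a1)
    show "free_of CW (part (\<lambda>e. ?\<mu> e = 2) (laurent_of gs))"
      unfolding part_G by (rule free_of_laurent_of) simp
  qed (simp add: lookup_add)
  note * = hw_of_rank_one[OF card _ _ lin part_neq_0 this H1]
  show "hw_of fs gs i j * hw_of fs gs k l = hw_of fs gs i l * hw_of fs gs k j"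
    by (rule *(1)) (simp_all add: fs_def gs_def terms_N1_def)
  show "hw_of fs gs CX CX + hw_of fs gs CY CY + hw_of fs gs CZ CZ + hw_of fs gs CW CW = 0"
    by (rule *(2)) (simp_all add: fs_def gs_def terms_N1_def)
qed

text \<open>The entry in row CW and column CX is the unit a1 a2, equal to its inverse. So each entry
  is a1 a2 times a product from that row and column, and the diagonal entries CY and CZ can be
  solved for a8 and a9.\<close>

lemma N1_equations:
  fixes a1 a2 a3 c a4 b1 a5 a6 a7 b2 a8 a9 a10 :: "'k::field"
  defines "M \<equiv> hw_of [(2, 1, 0, 0, 1), (2, 0, 1, 1, 0)] (terms_N1 a1 a2 a3 c a4 b1 a5 a6 a7 b2 a8 a9 a10)"
  assumes three: "(3 :: 'k) = 0" and a1: "a1 * a1 = 1" and a2: "a2 * a2 = 1"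
    and minors: "\<And>i j k l. M i j * M k l = M i l * M k j"
    and trace: "M CX CX + M CY CY + M CZ CZ + M CW CW = 0"
    and m00: "m00 = a3 * a3 - a1 * a5 - a2 * b1"
    and m33: "m33 = a10 * a3 - a5 * a8 - a6 * b2 + a7 * a7 - a9 * b1"
  shows "c * b1 = a1 * a2 * a1 * a3 * (c * a3 - a1 * a6)"
    and "a4 * a5 = a1 * a3 * (a3 * a4 - a2 * b2)"
    and "c * a7 = a1 * a2 * m00 * (c * a3 - a1 * a6) - a6 * b1"
    and "a4 * a7 + a5 * b2 = a1 * a2 * m00 * (a3 * a4 - a2 * b2)"
    and "a8 = a1 * (b1 * b1 - c * a5) + c * a3 * a3"
    and "a9 = a2 * (a5 * a5 - a4 * b1) + a3 * a3 * a4"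
    and "m00 + (- (a1 * a8) + a3 * a6 - c * a5 + b1 * b1) + (- (a2 * a9) + a3 * b2 - a4 * b1 + a5 * a5) + m33 = 0"
    and "a10 * a7 + a8 * a9 = a1 * a2 * m00 * m33"
    and "- (a10 * a5) - a7 * a9 - a8 * b2 = - (a1 * a3) * m33"
    and "- (a10 * b1) - a6 * a9 - a7 * a8 = - (a2 * a3) * m33"
proof -
  note hw = hw_N1[OF three, of a1 a2 a3 c a4 b1 a5 a6 a7 b2 a8 a9 a10, folded M_def]
  have pivot: "M i j = (a1 * a2) * (M i CX * M CW j)" for i j
  proof -
    have "(a1 * a2) * (M i CX * M CW j) = (a1 * a2) * (M i j * M CW CX)"
      using minors[of i CX CW j] by simp
    also have "\<dots> = (a1 * a1) * (a2 * a2) * M i j"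
      by (simp add: hw mult_ac)
    finally show ?thesis by (simp add: a1 a2)
  qed
  have sq: "a1 * (a1 * x) = x" "a2 * (a2 * x) = x" for x
    using a1 a2 by (simp_all flip: mult.assoc)
  note simps = a1 a2 sq algebra_simps
  have "- (- (b1 * c)) = - (a1 * a2 * (- (a1 * a3) * (- (a1 * a6) + a3 * c)))"
    using pivot[of CZ CY] unfolding hw by (simp only:)
  then show "c * b1 = a1 * a2 * a1 * a3 * (c * a3 - a1 * a6)"
    by (simp add: simps)
  have "- (- (a4 * a5)) = - (a1 * a2 * (- (a2 * a3) * (- (a2 * b2) + a3 * a4)))"
    using pivot[of CY CZ] unfolding hw by (simp only:)
  then show "a4 * a5 = a1 * a3 * (a3 * a4 - a2 * b2)"
    by (simp add: simps)
  have "(a6 * b1 + a7 * c) - a6 * b1 = a1 * a2 * (m00 * (- (a1 * a6) + a3 * c)) - a6 * b1"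
    using pivot[of CX CY] unfolding hw m00 by (simp add: algebra_simps)
  then show "c * a7 = a1 * a2 * m00 * (c * a3 - a1 * a6) - a6 * b1"
    by (simp add: algebra_simps)
  show "a4 * a7 + a5 * b2 = a1 * a2 * m00 * (a3 * a4 - a2 * b2)"
    using pivot[of CX CZ] unfolding hw m00 by (simp add: algebra_simps)
  have "a1 * (- (a1 * a8) + a3 * a6 - a5 * c + b1 * b1) =
      a1 * (a1 * a2 * (- (a2 * a3) * (- (a1 * a6) + a3 * c)))"
    using pivot[of CY CY] unfolding hw by (simp only:)
  then show "a8 = a1 * (b1 * b1 - c * a5) + c * a3 * a3"
    by (simp add: simps)
  have "a2 * (- (a2 * a9) + a3 * b2 - a4 * b1 + a5 * a5) =
      a2 * (a1 * a2 * (- (a1 * a3) * (- (a2 * b2) + a3 * a4)))"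
    using pivot[of CZ CZ] unfolding hw by (simp only:)
  then show "a9 = a2 * (a5 * a5 - a4 * b1) + a3 * a3 * a4"
    by (simp add: simps)
  show "m00 + (- (a1 * a8) + a3 * a6 - c * a5 + b1 * b1) + (- (a2 * a9) + a3 * b2 - a4 * b1 + a5 * a5) + m33 = 0"
    using trace unfolding hw m00 m33 by (simp add: algebra_simps)
  show "a10 * a7 + a8 * a9 = a1 * a2 * m00 * m33"
    using pivot[of CX CW] unfolding hw m00 m33 by (simp add: algebra_simps)
  show "- (a10 * a5) - a7 * a9 - a8 * b2 = - (a1 * a3) * m33"
    using pivot[of CY CW] unfolding hw m33 by (simp add: simps)
  show "- (a10 * b1) - a6 * a9 - a7 * a8 = - (a2 * a3) * m33"
    using pivot[of CZ CW] unfolding hw m33 by (simp add: simps)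
qed

lemma trit_cases:
  assumes "x \<in> {0, 1, - 1 :: 'a::field}"
  obtains "x = 0" | "x = 1" | "x = - 1"
  using assms by auto

lemma sign_cases:
  assumes "x \<in> {1, - 1 :: 'a::field}"
  obtains "x = 1" | "x = - 1"
  using assms by auto

lemma bit_cases:
  assumes "x \<in> {0, 1 :: 'a::field}"
  obtains "x = 0" | "x = 1"
  using assms by auto

text \<open>Here \<open>m00\<close> and \<open>m33\<close> are entries of the Hasse--Witt matrix, and \<open>s1\<close> to \<open>s5\<close> exclude singular
  points over the prime field. The surviving tuples are singular only at points defined over the field
  with 27 elements.\<close>

lemma N1_solutions:
  fixes a1 a2 a3 a4 b1 a5 a6 a7 b2 a8 a9 a10 :: "'a::field"
  assumes three: "(3 :: 'a) = 0"
   and a1: "a1 \<in> {1, - 1}" and a2: "a2 \<in> {1, - 1}" and b2: "b2 \<in> {0, 1}"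
   and a3: "a3 \<in> {0, 1, - 1}"
   and a4: "a4 \<in> {0, 1, - 1}"
   and a5: "a5 \<in> {0, 1, - 1}"
   and a6: "a6 \<in> {0, 1, - 1}"
   and a10: "a10 \<in> {0, 1, - 1}"
   and eqs: "b1 = a1 * a2 * a1 * a3 * (a3 - a1 * a6)"
     "a4 * a5 = a1 * a3 * (a3 * a4 - a2 * b2)"
     "m00 = a3 * a3 - a1 * a5 - a2 * b1"
     "a7 = a1 * a2 * m00 * (a3 - a1 * a6) - a6 * b1"
     "a4 * a7 + a5 * b2 = a1 * a2 * m00 * (a3 * a4 - a2 * b2)"
     "a8 = a1 * (b1 * b1 - a5) + a3 * a3"
     "a9 = a2 * (a5 * a5 - a4 * b1) + a3 * a3 * a4"
     "m33 = a10 * a3 - a5 * a8 - a6 * b2 + a7 * a7 - a9 * b1"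
   and tr: "m00 + (- (a1 * a8) + a3 * a6 - a5 + b1 * b1) + (- (a2 * a9) + a3 * b2 - a4 * b1 + a5 * a5) + m33 = 0"
     "a10 * a7 + a8 * a9 = a1 * a2 * m00 * m33"
     "- (a10 * a5) - a7 * a9 - a8 * b2 = - (a1 * a3) * m33"
     "- (a10 * b1) - a6 * a9 - a7 * a8 = - (a2 * a3) * m33"
   and s1: "\<not> (a4 = 0 \<and> b2 = 0)" and s2: "\<not> (a10 = 0 \<and> a8 = 0 \<and> a9 = 0)"
   and s3: "\<And>w. w \<in> {1, - 1} \<Longrightarrow> \<not> (a4 + b2 * w + a9 + a10 * w = 0 \<and> b2 - a9 * w = 0 \<and> a5 + a7 * w + a8 = 0)"
   and s4: "\<And>w. w \<in> {1, - 1} \<Longrightarrow> \<not> (1 + a6 * w + a8 + a10 * w = 0 \<and> a6 - a8 * w = 0 \<and> b1 + a7 * w + a9 = 0)"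
   and s5: "\<And>y z w Gw. y \<in> {1, - 1} \<Longrightarrow> z \<in> {1, - 1} \<Longrightarrow> w = - y * z \<Longrightarrow>
      Gw = a6 + a7 * y * z + b2 - w * (a8 * y + a9 * z) \<Longrightarrow>
      \<not> (a1 * y + a2 * z + a3 * y * z + y + a4 * z + b1 * z + a5 * y + w * (a6 + a7 * y * z + b2) + a8 * y + a9 * z + a10 * w = 0 \<and>
        a1 + a3 * z - b1 * y * z + a5 + w * (- a6 * y + a7 * z) + a8 = z * Gw \<and>
        a2 + a3 * y + b1 - a5 * y * z + w * (a7 * y - b2 * z) + a9 = y * Gw)"
  shows "\<exists>p\<in>{1, - 1}. \<exists>q\<in>{1, - 1}. (a1, a2, a3, a4, b1, a5, a6, a7, b2, a8, a9, a10) \<in>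
    {(1, p, 0, 0, 0, 1, 1, p, 1, - 1, p, 0), (1, p, - 1, - p, 0, 0, - 1, 0, 1, 1, - p, - 1),
     (1, p, - 1, - p, p, 0, 0, 0, 1, - 1, 0, - 1), (- 1, p, 1, p, 0, 0, - 1, 0, 1, 1, p, 1),
     (- 1, p, q, p, 0, - 1, - q, 0, 0, 0, - p, q)}"
proof -
  note two = numeral_mod_3(1)[OF three]
  have "(1 :: 'a) \<noteq> - 1"
    using two by (metis add_eq_0_iff one_add_one zero_neq_one neg_equal_0_iff_equal)
  then have neq: "(1 :: 'a) \<noteq> - 1" "- 1 \<noteq> (1 :: 'a)" by simp_all
  note S = two neq
  show ?thesis
    \<comment> \<open>Only a1 to a6, b2 and a10 are split; b1, a7, a8, a9 follow from the equations.
      Each equation is inserted as soon as its variables are known, so that most branches close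
      early.\<close>
    by (insert s1 eqs(2); rule sign_cases[OF a1]; rule sign_cases[OF a2]; rule trit_cases[OF a3];
      rule trit_cases[OF a4]; rule bit_cases[OF b2]; rule trit_cases[OF a5]; simp add: S;
      insert eqs(1,3); rule trit_cases[OF a6]; simp add: S;
      insert eqs(4,5); simp add: S;
      insert eqs(6,7,8); rule trit_cases[OF a10]; simp add: S;
      insert tr s2; simp add: S;
      insert s3[of 1] s3[of "- 1"] s4[of 1] s4[of "- 1"]; simp add: S;
      insert s5[of 1 1 "- 1", OF _ _ _ refl] s5[of "- 1" "- 1" "- 1", OF _ _ _ refl]
        s5[of 1 "- 1" "1", OF _ _ _ refl] s5[of "- 1" 1 "1", OF _ _ _ refl]; simp add: S ex_disj_distrib)
qed

lemma numeral_mod_3_more: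
  assumes "(3 :: 'a::field) = 0"
  shows "(5 :: 'a) = - 1" "(7 :: 'a) = 1" "(9 :: 'a) = 0" "(10 :: 'a) = 1" "(11 :: 'a) = - 1" "(12 :: 'a) = 0"
proof -
  have "(5 :: 'a) = - 1 + 3 * 2" "(7 :: 'a) = 1 + 3 * 2" "(9 :: 'a) = 0 + 3 * 3" "(10 :: 'a) = 1 + 3 * 3"
    "(11 :: 'a) = - 1 + 3 * 4" "(12 :: 'a) = 0 + 3 * 4" by simp_all
  then show "(5 :: 'a) = - 1" "(7 :: 'a) = 1" "(9 :: 'a) = 0" "(10 :: 'a) = 1" "(11 :: 'a) = - 1" "(12 :: 'a) = 0"
    by (simp_all only: assms mult_zero_left add_0_right)
qed

text \<open>The witnesses are written in 1, t, u = t^2, which over the prime field span the field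
  with 27 elements. The rules t u = t - 1 and u u = u - t reduce every condition to a linear
  combination of these three.\<close>

lemma N1_exceptional:
  fixes p q t :: "'a::field"
  assumes three: "(3 :: 'a) = 0" and t: "t ^ 3 = t - 1" and p: "p \<in> {1, - 1}" and q: "q \<in> {1, - 1}"
    and T: "(a1, a2, a3, a4, b1, a5, a6, a7, b2, a8, a9, a10) \<in>
    {(1, p, 0, 0, 0, 1, 1, p, 1, - 1, p, 0), (1, p, - 1, - p, 0, 0, - 1, 0, 1, 1, - p, - 1),
     (1, p, - 1, - p, p, 0, 0, 0, 1, - 1, 0, - 1), (- 1, p, 1, p, 0, 0, - 1, 0, 1, 1, p, 1),
     (- 1, p, q, p, 0, - 1, - q, 0, 0, 0, - p, q)}"
  shows "\<exists>y z w s. N1_singular a1 a2 a3 1 a4 b1 a5 a6 a7 b2 a8 a9 a10 1 y z w s"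
proof -
  define u where "u = t * t"
  have tt: "t * t = u" and tu: "t * u = t - 1"
    using t by (simp_all add: u_def power3_eq_cube mult.assoc)
  have "u * u = t * (t * u)"
    by (simp add: u_def mult_ac)
  then have uu: "u * u = u - t"
    by (simp add: tu tt right_diff_distrib)
  have nested: "t * (t * x) = u * x" "t * (u * x) = t * x - x" "u * (u * x) = u * x - t * x" for x
    by (simp_all only: mult.assoc[symmetric] tt tu uu left_diff_distrib mult_1)
  note R = tt tu uu nested power2_eq_square power3_eq_cube algebra_simps numeral_mod_3[OF three] numeral_mod_3_more[OF three] three
  have *: "\<exists>y z w s. N1_singular a1 a2 a3 1 a4 b1 a5 a6 a7 b2 a8 a9 a10 1 y z w s"
    if "N1_singular a1 a2 a3 1 a4 b1 a5 a6 a7 b2 a8 a9 a10 1 y z w s" for y z w s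
    using that by blast
  show ?thesis
    using T
  proof (elim insertE emptyE, goal_cases)
    case 1
    show ?thesis
      \<comment> \<open>The two \<open>refl\<close> arguments set w = -y z and take the w-derivative
        of G as the multiplier, leaving the equation of G and two derivatives to check.\<close>
      by (rule *, rule N1_singular_affine[OF three refl _ refl, where y = "- p * t" and z = "- 1 - t - u"])
        (use 1 p in \<open>auto simp: R\<close>)
  next
    case 2
    show ?thesis
      by (rule *, rule N1_singular_affine[OF three refl _ refl, where y = "p * (u + t - 1)" and z = u])
        (use 2 p in \<open>auto simp: R\<close>)
  next
    case 3
    show ?thesis
      by (rule *, rule N1_singular_affine[OF three refl _ refl, where y = "p * u" and z = "- t - u"])
        (use 3 p in \<open>auto simp: R\<close>)
  next
    case 4
    show ?thesis
      by (rule *, rule N1_singular_affine[OF three refl _ refl, where y = "- p * u" and z = "u + t - 1"])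
        (use 4 p in \<open>auto simp: R\<close>)
  next
    case 5
    show ?thesis
      by (rule *, rule N1_singular_affine[OF three refl _ refl, where y = "p * q * (t + u)" and z = "q * u"])
        (use 5 p q in \<open>auto simp: R\<close>)
  qed
qed

lemma exists_artin_schreier_root: "\<exists>t :: 'a::alg_closed_field. t ^ 3 = t - 1"
proof -
  have "Polynomial.degree [:1, - 1, 0, 1 :: 'a:] > 0" by simp
  then obtain t where "poly [:1, - 1, 0, 1 :: 'a:] t = 0"
    using alg_closed_imp_poly_has_root by blast
  then have "1 - t + t ^ 3 = 0"
    by (simp add: power3_eq_cube algebra_simps)
  then show ?thesis
    by (intro exI[of _ t]) (simp add: algebra_simps eq_neg_iff_add_eq_0)
qed

lemma no_curve_N1i:
  fixes a1 a2 a3 a4 b1 a5 a6 a7 b2 a8 a9 a10 :: "'k::field" and \<xi> :: "4 \<Rightarrow> 'k cochain"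
  defines "fs \<equiv> [(2, 1, 0, 0, 1), (2, 0, 1, 1, 0)]"
    and "gs \<equiv> terms_N1 a1 a2 a3 1 a4 b1 a5 a6 a7 b2 a8 a9 a10"
  assumes card: "CARD('k) = 3" and a1: "a1 \<noteq> 0" and a2: "a2 \<noteq> 0" and b2: "b2 \<in> {0, 1}"
    and smooth: "smooth_curve (poly_of fs) (poly_of gs)"
    and H1: "H1_basis (poly_of fs) (poly_of gs) \<xi>"
    "p_rank (hasse_witt (poly_of fs) (poly_of gs) \<xi>) = 0"
    "a_number (hasse_witt (poly_of fs) (poly_of gs) \<xi>) = 3"
  shows False
proof -
  note three = three_elements(2)[OF card]
  have three_ac: "(3 :: 'k alg_closure) = 0" by (metis three to_ac_0 to_ac_numeral)
  have trit: "x \<in> {0, 1, - 1}" for x :: 'k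
    using three_elements(1)[OF card] by blast
  have sign: "a1 \<in> {1, - 1}" "a2 \<in> {1, - 1}"
    using trit[of a1] trit[of a2] a1 a2 by blast+
  then have sq: "a1 * a1 = 1" "a2 * a2 = 1" by auto
  have not_singular_ac: "\<not> N1_singular (to_ac a1) (to_ac a2) (to_ac a3) (to_ac 1) (to_ac a4) (to_ac b1)
      (to_ac a5) (to_ac a6) (to_ac a7) (to_ac b2) (to_ac a8) (to_ac a9) (to_ac a10) x y z w t" for x y z w t
    using N1_singular_not_smooth[OF three] smooth unfolding fs_def gs_def by blast
  then have not_singular: "\<not> N1_singular a1 a2 a3 1 a4 b1 a5 a6 a7 b2 a8 a9 a10 x y z w t" for x y z w t
    using N1_singular_to_ac[of a1 a2 a3 1 a4 b1 a5 a6 a7 b2 a8 a9 a10 x y z w t] by blast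
  note eqs = N1_equations[OF three sq rank_one_N1[OF card a1 H1[unfolded fs_def gs_def]] refl refl]
  have "\<exists>p\<in>{1, - 1}. \<exists>q\<in>{1, - 1}. (a1, a2, a3, a4, b1, a5, a6, a7, b2, a8, a9, a10) \<in>
    {(1, p, 0, 0, 0, 1, 1, p, 1, - 1, p, 0), (1, p, - 1, - p, 0, 0, - 1, 0, 1, 1, - p, - 1),
     (1, p, - 1, - p, p, 0, 0, 0, 1, - 1, 0, - 1), (- 1, p, 1, p, 0, 0, - 1, 0, 1, 1, p, 1),
     (- 1, p, q, p, 0, - 1, - q, 0, 0, 0, - p, q)}"
  proof (rule N1_solutions[OF three sign b2 trit trit trit trit trit _ _ refl _ _ _ _ refl])
    \<comment> \<open>The conditions are those for (0:0:1:0), (0:0:0:1), (0:0:1:w), (0:1:0:w) and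
      (1:y:z:-y z). At the first of them the y-derivative forces the multiplier a5.\<close>
    show "\<not> (a4 = 0 \<and> b2 = 0)"
      using not_singular[of 0 0 1 0 a5] by (auto simp: N1_singular_def)
    show "\<not> (a10 = 0 \<and> a8 = 0 \<and> a9 = 0)"
      using not_singular[of 0 0 0 1 0] by (auto simp: N1_singular_def)
    show "\<not> (a4 + b2 * w + a9 + a10 * w = 0 \<and> b2 - a9 * w = 0 \<and> a5 + a7 * w + a8 = 0)" if "w \<in> {1, - 1}" for w
      using not_singular[of 0 0 1 w 0] that by (auto simp: N1_singular_def)
    show "\<not> (1 + a6 * w + a8 + a10 * w = 0 \<and> a6 - a8 * w = 0 \<and> b1 + a7 * w + a9 = 0)" if "w \<in> {1, - 1}" for w
      using not_singular[of 0 1 0 w 0] that by (auto simp: N1_singular_def)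
    show "\<not> (a1 * y + a2 * z + a3 * y * z + y + a4 * z + b1 * z + a5 * y + w * (a6 + a7 * y * z + b2) + a8 * y + a9 * z + a10 * w = 0 \<and>
        a1 + a3 * z - b1 * y * z + a5 + w * (- a6 * y + a7 * z) + a8 = z * Gw \<and>
        a2 + a3 * y + b1 - a5 * y * z + w * (a7 * y - b2 * z) + a9 = y * Gw)"
      if yz: "y \<in> {1, - 1}" "z \<in> {1, - 1}" and w: "w = - y * z"
        and Gw: "Gw = a6 + a7 * y * z + b2 - w * (a8 * y + a9 * z)" for y z w Gw
    proof (rule notI, elim conjE)
      assume G: "a1 * y + a2 * z + a3 * y * z + y + a4 * z + b1 * z + a5 * y + w * (a6 + a7 * y * z + b2) + a8 * y + a9 * z + a10 * w = 0"
        and Gy: "a1 + a3 * z - b1 * y * z + a5 + w * (- a6 * y + a7 * z) + a8 = z * Gw"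
        and Gz: "a2 + a3 * y + b1 - a5 * y * z + w * (a7 * y - b2 * z) + a9 = y * Gw"
      have sq: "y ^ 2 = 1" "z ^ 2 = 1" "w ^ 2 = 1" "y ^ 3 = y" "z ^ 3 = z" "w ^ 3 = w"
        using yz w by auto
      have "N1_singular a1 a2 a3 1 a4 b1 a5 a6 a7 b2 a8 a9 a10 1 y z w Gw"
      proof (rule N1_singular_affine[OF three w], goal_cases)
        case 1
        show ?case unfolding sq using G by (simp add: algebra_simps)
      next
        case 2
        show ?case unfolding sq using Gw by (simp add: algebra_simps)
      next
        case 3
        show ?case unfolding sq using Gy by (simp add: algebra_simps)
      next
        case 4
        show ?case unfolding sq using Gz by (simp add: algebra_simps)
      qed
      then show False using not_singular by blast
    qed
  qed (use eqs in \<open>simp_all only: mult_1\<close>)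
  then show False
  proof (elim bexE)
    fix p q :: 'k
    assume p: "p \<in> {1, - 1}" and q: "q \<in> {1, - 1}"
      and tuple: "(a1, a2, a3, a4, b1, a5, a6, a7, b2, a8, a9, a10) \<in>
    {(1, p, 0, 0, 0, 1, 1, p, 1, - 1, p, 0), (1, p, - 1, - p, 0, 0, - 1, 0, 1, 1, - p, - 1),
     (1, p, - 1, - p, p, 0, 0, 0, 1, - 1, 0, - 1), (- 1, p, 1, p, 0, 0, - 1, 0, 1, 1, p, 1),
     (- 1, p, q, p, 0, - 1, - q, 0, 0, 0, - p, q)}"
    obtain t :: "'k alg_closure" where t: "t ^ 3 = t - 1" using exists_artin_schreier_root by blast
  have "\<exists>y z w s. N1_singular (to_ac a1) (to_ac a2) (to_ac a3) 1 (to_ac a4) (to_ac b1)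
      (to_ac a5) (to_ac a6) (to_ac a7) (to_ac b2) (to_ac a8) (to_ac a9) (to_ac a10) 1 y z w s"
    proof (rule N1_exceptional[OF three_ac t, of "to_ac p" "to_ac q"])
      show "to_ac p \<in> {1, - 1}" "to_ac q \<in> {1, - 1 :: 'k alg_closure}"
        using p q by auto
    qed (use tuple in \<open>elim insertE emptyE; simp\<close>)
    then show False using not_singular_ac by simp
  qed
qed

text \<open>With c = a4 = 0, smoothness at (0:0:1:0) and (0:1:0:0) makes b2 and a6 units. The
  relations can then be solved by hand and force a singularity at (0:0:0:1).\<close>

lemma no_curve_N1ii:
  fixes a1 a2 a3 b1 a5 a6 a7 b2 a8 a9 a10 :: "'k::field" and \<xi> :: "4 \<Rightarrow> 'k cochain"
  defines "fs \<equiv> [(2, 1, 0, 0, 1), (2, 0, 1, 1, 0)]"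
    and "gs \<equiv> terms_N1 a1 a2 a3 0 0 b1 a5 a6 a7 b2 a8 a9 a10"
  assumes card: "CARD('k) = 3" and a1: "a1 \<noteq> 0" and a2: "a2 \<noteq> 0"
    and smooth: "smooth_curve (poly_of fs) (poly_of gs)"
    and H1: "H1_basis (poly_of fs) (poly_of gs) \<xi>"
    "p_rank (hasse_witt (poly_of fs) (poly_of gs) \<xi>) = 0"
    "a_number (hasse_witt (poly_of fs) (poly_of gs) \<xi>) = 3"
  shows False
proof -
  note three = three_elements(2)[OF card]
  have trit: "x \<in> {0, 1, - 1}" for x :: 'k
    using three_elements(1)[OF card] by blast
  have sign: "a1 \<in> {1, - 1}" "a2 \<in> {1, - 1}"
    using trit[of a1] trit[of a2] a1 a2 by blast+
  then have sq: "a1 * a1 = 1" "a2 * a2 = 1" by auto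
  have not_singular: "\<not> N1_singular a1 a2 a3 0 0 b1 a5 a6 a7 b2 a8 a9 a10 x y z w t" for x y z w t
    using N1_singular_not_smooth[OF three smooth[unfolded fs_def gs_def]]
      N1_singular_to_ac[of a1 a2 a3 0 0 b1 a5 a6 a7 b2 a8 a9 a10 x y z w t] by blast
  note eqs = N1_equations[OF three sq rank_one_N1[OF card a1 H1[unfolded fs_def gs_def]] refl refl]
  have b2: "b2 \<noteq> 0"
    using not_singular[of 0 0 1 0 a5] by (auto simp: N1_singular_def)
  have a6: "a6 \<noteq> 0"
    using not_singular[of 0 1 0 0 b1] by (auto simp: N1_singular_def)
  have a3: "a3 = 0"
    using eqs(2) b2 a1 a2 by auto
  have "a6 * (a1 * a2 * (a1 * a5 + a2 * b1) * a1) = a6 * b1"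
    using eqs(3) by (simp add: a3 algebra_simps)
  then have 1: "a1 * a2 * (a1 * a5 + a2 * b1) * a1 = b1"
    using a6 by simp
  have "b2 * (a1 * a2 * (a1 * a5 + a2 * b1) * a2) = b2 * a5"
    using eqs(4) by (simp add: a3 algebra_simps)
  then have 2: "a1 * a2 * (a1 * a5 + a2 * b1) * a2 = a5"
    using b2 by simp
  \<comment> \<open>As a1 and a2 square to 1, the two facts read a1 a2 a5 + b1 = b1 and a5 + a1 a2
    b1 = a5.\<close>
  have "a5 = 0" "b1 = 0"
    using 1 2 sign by (auto simp: algebra_simps)
  then have "a8 = 0" "a9 = 0"
    using eqs(5,6) a3 by simp_all
  have "a10 * a7 = 0" "a7 * a7 = a6 * b2"
    using eqs(7,8) \<open>a5 = 0\<close> \<open>b1 = 0\<close> \<open>a8 = 0\<close> \<open>a9 = 0\<close> a3 by simp_all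
  then have "a10 = 0" using a6 b2 by auto
  then show False
    using not_singular[of 0 0 0 1 0] \<open>a8 = 0\<close> \<open>a9 = 0\<close> by (auto simp: N1_singular_def)
qed

section \<open>The nonsplit quadric\<close>

text \<open>In characteristic 3 the quadric is x w = y^2 + z^2, and (w, y, z, x) is the gradient of
  x w - y^2 - z^2; t is again the multiplier.\<close>

definition N2_singular where
  "N2_singular a1 a2 a3 b1 a4 a5 a6 a7 b2 a8 a9 a10 x y z w t \<longleftrightarrow>
     (x, y, z, w) \<noteq> (0, 0, 0, 0) \<and> x * w = y ^ 2 + z ^ 2 \<and>
     a1 * x ^ 2 * y + a2 * x ^ 2 * z + a3 * x * y ^ 2 + a3 * x * z ^ 2 + (b1 + a4) * y ^ 3
       + b1 * y * z ^ 2 - a5 * z ^ 3 + a6 * y ^ 2 * w + a7 * y * z * w + b2 * z ^ 2 * w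
       + a8 * y * w ^ 2 + a9 * z * w ^ 2 + a10 * w ^ 3 = 0 \<and>
     a3 * y ^ 2 + a3 * z ^ 2 - a1 * x * y - a2 * x * z = t * w \<and>
     a1 * x ^ 2 - a3 * x * y + b1 * z ^ 2 - a6 * y * w + a7 * z * w + a8 * w ^ 2 = t * y \<and>
     a2 * x ^ 2 - a3 * x * z - b1 * y * z + a7 * y * w - b2 * z * w + a9 * w ^ 2 = t * z \<and>
     a6 * y ^ 2 + a7 * y * z + b2 * z ^ 2 - a8 * y * w - a9 * z * w = (t :: 'a::field) * x"

lemma N2_singular_to_ac:
  assumes "N2_singular a1 a2 a3 b1 a4 a5 a6 a7 b2 a8 a9 a10 x y z w t"
  shows "N2_singular (to_ac a1) (to_ac a2) (to_ac a3) (to_ac b1) (to_ac a4) (to_ac a5)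
    (to_ac a6) (to_ac a7) (to_ac b2) (to_ac a8) (to_ac a9) (to_ac a10)
    (to_ac x) (to_ac y) (to_ac z) (to_ac w) (to_ac t)"
  using assms unfolding N2_singular_def
  by (simp flip: to_ac_add to_ac_mult to_ac_power to_ac_diff)

lemma N2_singular_not_smooth:
  fixes a1 a2 a3 b1 a4 a5 a6 a7 b2 a8 a9 a10 :: "'k::field"
  assumes three: "(3 :: 'k) = 0"
    and smooth: "smooth_curve (poly_of [(2, 1, 0, 0, 1), (1, 0, 2, 0, 0), (1, 0, 0, 2, 0)])
      (poly_of (terms_N2 a1 a2 a3 b1 a4 a5 a6 a7 b2 a8 a9 a10))"
  shows "\<not> N2_singular (to_ac a1) (to_ac a2) (to_ac a3) (to_ac b1) (to_ac a4) (to_ac a5)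
    (to_ac a6) (to_ac a7) (to_ac b2) (to_ac a8) (to_ac a9) (to_ac a10) x y z w t"
proof
  assume *: "N2_singular (to_ac a1) (to_ac a2) (to_ac a3) (to_ac b1) (to_ac a4) (to_ac a5)
    (to_ac a6) (to_ac a7) (to_ac b2) (to_ac a8) (to_ac a9) (to_ac a10) x y z w t"
  have three_ac: "(3 :: 'k alg_closure) = 0" by (metis three to_ac_0 to_ac_numeral)
  note two_ac = numeral_mod_3(1)[OF three_ac]
  show False
  proof (rule smooth_curve_gradient[OF smooth, of x y z w "- t"])
    show "eval_terms to_ac [(2, 1, 0, 0, 1), (1, 0, 2, 0, 0), (1, 0, 0, 2, 0)] x y z w = 0"
      using *[unfolded N2_singular_def, THEN conjunct2, THEN conjunct1]
      by (simp add: eval_terms_def two_ac)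
    show "eval_terms to_ac (terms_N2 a1 a2 a3 b1 a4 a5 a6 a7 b2 a8 a9 a10) x y z w = 0"
      using *[unfolded N2_singular_def, THEN conjunct2, THEN conjunct2, THEN conjunct1]
      by (simp add: eval_terms_def terms_N2_def algebra_simps)
    fix n
    show "eval_terms to_ac (map (term_deriv n) (terms_N2 a1 a2 a3 b1 a4 a5 a6 a7 b2 a8 a9 a10)) x y z w =
        - t * eval_terms to_ac (map (term_deriv n) [(2, 1, 0, 0, 1), (1, 0, 2, 0, 0), (1, 0, 0, 2, 0)]) x y z w"
      using *[unfolded N2_singular_def, THEN conjunct2, THEN conjunct2, THEN conjunct2]
      by (cases n) (simp_all add: eval_terms_def terms_N2_def two_ac three_ac algebra_simps)
  qed (use * in \<open>simp add: N2_singular_def\<close>)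
qed

text \<open>Euler's relation again supplies the x-derivative: y (t y) + z (t z) + w t = 2 t w = -(t
  w) because y^2 + z^2 = w.\<close>

lemma N2_singular_affine:
  fixes a1 a2 a3 b1 a4 a5 a6 a7 b2 a8 a9 a10 y z w t :: "'a::field"
  assumes three: "(3 :: 'a) = 0" and w: "w = y ^ 2 + z ^ 2"
    and t: "t = a6 * y ^ 2 + a7 * y * z + b2 * z ^ 2 - a8 * y * w - a9 * z * w"
    and G: "a1 * y + a2 * z + a3 * w + (b1 + a4) * y ^ 3
       + b1 * y * z ^ 2 - a5 * z ^ 3 + w * (a6 * y ^ 2 + a7 * y * z + b2 * z ^ 2)
       + w ^ 2 * (a8 * y + a9 * z) + a10 * w ^ 3 = 0"
    and Gy: "a1 - a3 * y + b1 * z ^ 2 - a6 * y * w + a7 * z * w + a8 * w ^ 2 = t * y"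
    and Gz: "a2 - a3 * z - b1 * y * z + a7 * y * w - b2 * z * w + a9 * w ^ 2 = t * z"
  shows "N2_singular a1 a2 a3 b1 a4 a5 a6 a7 b2 a8 a9 a10 1 y z w t"
proof -
  have "(a3 * y ^ 2 + a3 * z ^ 2 - a1 * y - a2 * z)
     + y * (a1 - a3 * y + b1 * z ^ 2 - a6 * y * w + a7 * z * w + a8 * w ^ 2)
     + z * (a2 - a3 * z - b1 * y * z + a7 * y * w - b2 * z * w + a9 * w ^ 2)
     + w * (a6 * y ^ 2 + a7 * y * z + b2 * z ^ 2 - a8 * y * w - a9 * z * w) =
     3 * (a7 * y * z * w)"
    by (simp add: algebra_simps power2_eq_square)
  then have "(a3 * y ^ 2 + a3 * z ^ 2 - a1 * y - a2 * z) + (y * (t * y) + z * (t * z) + w * t) = 0"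
    unfolding Gy Gz three t[symmetric] by (simp add: add.assoc)
  moreover have "y * (t * y) + z * (t * z) + w * t = 3 * (t * w) - t * w"
    by (simp add: w algebra_simps power2_eq_square)
  then have "y * (t * y) + z * (t * z) + w * t = - (t * w)"
    by (simp only: three mult_zero_left diff_0)
  ultimately have "(a3 * y ^ 2 + a3 * z ^ 2 - a1 * y - a2 * z) + - (t * w) = 0"
    by (simp only:)
  then have Gx: "a3 * y ^ 2 + a3 * z ^ 2 - a1 * y - a2 * z = t * w"
    by simp
  have a3w: "a3 * w = a3 * y ^ 2 + a3 * z ^ 2"
    by (simp add: w distrib_left)
  show ?thesis
    unfolding N2_singular_def
  proof (intro conjI)
    show "a1 * 1 ^ 2 * y + a2 * 1 ^ 2 * z + a3 * 1 * y ^ 2 + a3 * 1 * z ^ 2 + (b1 + a4) * y ^ 3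
       + b1 * y * z ^ 2 - a5 * z ^ 3 + a6 * y ^ 2 * w + a7 * y * z * w + b2 * z ^ 2 * w
       + a8 * y * w ^ 2 + a9 * z * w ^ 2 + a10 * w ^ 3 = 0"
      using G unfolding a3w by (simp add: algebra_simps)
  qed (use w Gx Gy Gz t in simp_all)
qed

lemma rank_one_N2:
  fixes a1 a2 a3 b1 a4 a5 a6 a7 b2 a8 a9 a10 :: "'k::field" and \<xi> :: "4 \<Rightarrow> 'k cochain"
  defines "fs \<equiv> [(2, 1, 0, 0, 1), (1, 0, 2, 0, 0), (1, 0, 0, 2, 0)]"
    and "gs \<equiv> terms_N2 a1 a2 a3 b1 a4 a5 a6 a7 b2 a8 a9 a10"
  assumes card: "CARD('k) = 3" and nz: "(a1, a2) \<noteq> (0, 0)"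
    and H1: "H1_basis (poly_of fs) (poly_of gs) \<xi>"
    "p_rank (hasse_witt (poly_of fs) (poly_of gs) \<xi>) = 0"
    "a_number (hasse_witt (poly_of fs) (poly_of gs) \<xi>) = 3"
  shows "hw_of fs gs i j * hw_of fs gs k l = hw_of fs gs i l * hw_of fs gs k j"
    and "hw_of fs gs CX CX + hw_of fs gs CY CY + hw_of fs gs CZ CZ + hw_of fs gs CW CW = 0"
proof -
  note two = numeral_mod_3(1)[OF three_elements(2)[OF card]]
  have lin: "linear_in_var CW (expo 1 0 0 0) (2 :: 'k) (laurent_of [(1, 0, 2, 0, 0), (1, 0, 0, 2, 0)]) (laurent_of fs)"
  proof
    show "laurent_of fs = Poly_Mapping.single (expo 1 0 0 0) 2 * Poly_Mapping.single (Poly_Mapping.single CW 1) 1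
        + laurent_of [(1 :: 'k, 0, 2, 0, 0), (1, 0, 0, 2, 0)]"
      by (simp add: fs_def laurent_of_def mult_single) (simp add: expo_def)
    show "laurent_of [(1 :: 'k, 0, 2, 0, 0), (1, 0, 0, 2, 0)] \<noteq> 0"
      by (rule laurent_of_neq_0[of _ 0 2 0 0]) simp
    show "free_of CW (laurent_of [(1 :: 'k, 0, 2, 0, 0), (1, 0, 0, 2, 0)])"
      by (rule free_of_laurent_of) simp
  qed (simp_all add: two lookup_expo)
  have part_neq_0: "part (\<lambda>e. Poly_Mapping.lookup e n = 0) (laurent_of fs) \<noteq> 0" for n
  proof (cases "n = CX \<or> n = CW")
    case True
    then show ?thesis
      unfolding part_laurent_of
      by (intro laurent_of_neq_0[of _ 0 2 0 0]) (cases n; simp add: fs_def lookup_expo)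
  next
    case False
    then show ?thesis
      unfolding part_laurent_of
      by (intro laurent_of_neq_0[of _ 1 0 0 1]) (cases n; simp add: fs_def lookup_expo two)
  qed
  let ?\<mu> = "\<lambda>e. Poly_Mapping.lookup e CX - Poly_Mapping.lookup e CW :: int"
  have part_G: "part (\<lambda>e. ?\<mu> e = 2) (laurent_of gs) = laurent_of [(a1, 2, 1, 0, 0), (a2, 2, 0, 1, 0)]"
    by (simp add: part_laurent_of gs_def terms_N2_def lookup_expo)
  have "\<not> laurent_of fs dvd laurent_of gs"
  proof (rule linear_in_var.F_not_dvd[OF lin, where \<mu> = ?\<mu> and d = 2])
    fix e assume "e \<in> Poly_Mapping.keys (laurent_of fs)"
    then show "?\<mu> e = 0"
      using keys_laurent_of by (fastforce simp: fs_def lookup_expo)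
  next
    show "part (\<lambda>e. ?\<mu> e = 2) (laurent_of gs) \<noteq> 0"
    proof (cases "a1 = 0")
      case True
      with nz show ?thesis
        unfolding part_G by (intro laurent_of_neq_0[of _ 2 0 1 0]) simp
    next
      case False
      then show ?thesis
        unfolding part_G by (intro laurent_of_neq_0[of _ 2 1 0 0]) simp
    qed
    show "free_of CW (part (\<lambda>e. ?\<mu> e = 2) (laurent_of gs))"
      unfolding part_G by (rule free_of_laurent_of) simp
  qed (simp add: lookup_add)
  note * = hw_of_rank_one[OF card _ _ lin part_neq_0 this H1]
  show "hw_of fs gs i j * hw_of fs gs k l = hw_of fs gs i l * hw_of fs gs k j"
    by (rule *(1)) (simp_all add: fs_def gs_def terms_N2_def)
  show "hw_of fs gs CX CX + hw_of fs gs CY CY + hw_of fs gs CZ CZ + hw_of fs gs CW CW = 0"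
    by (rule *(2)) (simp_all add: fs_def gs_def terms_N2_def)
qed

text \<open>The unit is now n, the norm of a1 + a2 i with i^2 = -1. P and Q are the real and
  imaginary parts of (a1 + a2 i)(a8 + a9 i), so multiplication by the conjugate of a1 + a2 i
  recovers a8 and a9; m31 and -m32 arise likewise from (a1 + a2 i)((a6 - b2) + a7 i), up to terms in
  a3.\<close>

lemma N2_equations:
  fixes a1 a2 a3 b1 a4 a5 a6 a7 b2 a8 a9 a10 :: "'k::field"
  defines "M \<equiv> hw_of [(2, 1, 0, 0, 1), (1, 0, 2, 0, 0), (1, 0, 0, 2, 0)] (terms_N2 a1 a2 a3 b1 a4 a5 a6 a7 b2 a8 a9 a10)"
  assumes three: "(3 :: 'k) = 0" and n: "n = a1 * a1 + a2 * a2" and n2: "n * n = 1"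
    and minors: "\<And>i j k l. M i j * M k l = M i l * M k j"
    and trace: "M CX CX + M CY CY + M CZ CZ + M CW CW = 0"
    and m00: "m00 = - (a1 * b1) - a3 * a3"
    and m31: "m31 = a1 * (a6 - b2) - a2 * a7 + a3 * a4"
    and m32: "m32 = - (a1 * a7) - a2 * (a6 - b2) - a3 * a5"
    and m33: "m33 = a10 * a3 - a6 * b2 + a7 * a7 - a8 * b1"
    and P: "P = - (n * a1 * a3 * m31) - a3 * (a6 - b2) + a4 * b1 + b1 * b1"
    and Q: "Q = n * a2 * a3 * m31 - a3 * a7"
  shows "a4 * b1 = n * a3 * (a1 * m31 + a2 * m32)"
    and "a5 * b1 = n * a3 * (a2 * m31 - a1 * m32)"
    and "a6 * b1 - a4 * (a6 + b2) - b1 * b2 = n * m00 * m31"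
    and "a5 * (a6 + b2) - a7 * b1 = n * m00 * m32"
    and "a8 = n * (a1 * P + a2 * Q)"
    and "a9 = n * (a1 * Q - a2 * P)"
    and "m00 - a4 * b1 + m33 = 0"
    and "a8 * a8 + a9 * a9 - a10 * (a6 + b2) = n * m00 * m33"
    and "- (a10 * b1) - a7 * a9 - a8 * b2 = - (n * a1 * a3 * m33)"
    and "- (a6 * a9) - a7 * a8 = - (n * a2 * a3 * m33)"
proof -
  note hw = hw_N2[OF three, of a1 a2 a3 b1 a4 a5 a6 a7 b2 a8 a9 a10, folded M_def]
  have n': "M CW CX = n" by (simp add: hw n)
  have pivot: "M i j = n * (M i CX * M CW j)" for i j
  proof -
    have "n * (M i CX * M CW j) = n * (M i j * M CW CX)"
      using minors[of i CX CW j] by simp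
    also have "\<dots> = n * n * M i j"
      by (simp add: n' mult_ac)
    finally show ?thesis by (simp add: n2)
  qed
  have row: "M CW CY = m31" "M CW CZ = m32" "M CW CW = m33" "M CX CX = m00"
    by (simp_all add: hw m31 m32 m33 m00 algebra_simps)
  \<comment> \<open>In the middle block of the matrix all other terms cancel in the sum of the
    diagonal entries, and likewise in the difference of the off-diagonal ones.\<close>
  have "a4 * b1 = - (M CY CY + M CZ CZ)" by (simp add: hw)
  also have "\<dots> = - (n * (M CY CX * M CW CY) + n * (M CZ CX * M CW CZ))"
    using pivot[of CY CY] pivot[of CZ CZ] by simp
  finally show a4b1: "a4 * b1 = n * a3 * (a1 * m31 + a2 * m32)"
    unfolding row by (simp add: hw algebra_simps)
  have "a5 * b1 = M CY CZ - M CZ CY" by (simp add: hw)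
  also have "\<dots> = n * (M CY CX * M CW CZ) - n * (M CZ CX * M CW CY)"
    using pivot[of CY CZ] pivot[of CZ CY] by simp
  finally show "a5 * b1 = n * a3 * (a2 * m31 - a1 * m32)"
    unfolding row by (simp add: hw algebra_simps)
  show "a6 * b1 - a4 * (a6 + b2) - b1 * b2 = n * m00 * m31"
    using pivot[of CX CY] unfolding row by (simp add: hw algebra_simps)
  show "a5 * (a6 + b2) - a7 * b1 = n * m00 * m32"
    using pivot[of CX CZ] unfolding row by (simp add: hw algebra_simps)
  have "a1 * a8 - a2 * a9 = M CY CY - (a3 * a6 - a3 * b2 - a4 * b1 - b1 * b1)"
    by (simp add: hw)
  also have "\<dots> = P"
    using pivot[of CY CY] unfolding row P by (simp add: hw algebra_simps)
  finally have P': "P = a1 * a8 - a2 * a9" ..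
  have "a1 * a9 + a2 * a8 = - (M CZ CY) - a3 * a7"
    by (simp add: hw)
  also have "\<dots> = Q"
    using pivot[of CZ CY] unfolding row Q by (simp add: hw algebra_simps)
  finally have Q': "Q = a1 * a9 + a2 * a8" ..
  have nn: "n * (n * x) = x" for x using n2 by (simp flip: mult.assoc)
  have "a1 * P + a2 * Q = n * a8" unfolding P' Q' n by (simp add: algebra_simps)
  then show "a8 = n * (a1 * P + a2 * Q)" by (simp add: nn)
  have "a1 * Q - a2 * P = n * a9" unfolding P' Q' n by (simp add: algebra_simps)
  then show "a9 = n * (a1 * Q - a2 * P)" by (simp add: nn)
  have "M CX CX + (M CY CY + M CZ CZ) + M CW CW = 0"
    using trace by (simp add: add.assoc)
  moreover have "M CY CY + M CZ CZ = - (a4 * b1)" by (simp add: hw)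
  ultimately show "m00 - a4 * b1 + m33 = 0" unfolding row by simp
  show "a8 * a8 + a9 * a9 - a10 * (a6 + b2) = n * m00 * m33"
    using pivot[of CX CW] unfolding row by (simp add: hw algebra_simps)
  show "- (a10 * b1) - a7 * a9 - a8 * b2 = - (n * a1 * a3 * m33)"
    using pivot[of CY CW] unfolding row by (simp add: hw algebra_simps)
  show "- (a6 * a9) - a7 * a8 = - (n * a2 * a3 * m33)"
    using pivot[of CZ CW] unfolding row by (simp add: hw algebra_simps)
qed

text \<open>Same reduction to 1, t, u as in the split case; the signs p and q enter the witnesses
  only as factors of y and z.\<close>

lemma N2_exceptional:
  fixes p q t :: "'a::field"
  assumes three: "(3 :: 'a) = 0" and t: "t ^ 3 = t - 1" and p: "p \<in> {1, - 1}" and q: "q \<in> {1, - 1}"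
    and T: "(a1, a2, a3, b1, a4, a5, a6, a7, b2, a8, a9, a10) \<in>
    {(0, q, 1, 0, p, - q, - 1, p * q, 1, - p, q, - 1), (p, 0, - 1, 0, p, q, - 1, p * q, 1, p, q, 1),
     (p, q, 1, 0, 0, q, - 1, p * q, 1, - p, 0, - 1), (p, q, - 1, 0, - p, 0, - 1, - (p * q), 1, 0, - q, 1)}"
  shows "\<exists>y z w s. N2_singular a1 a2 a3 b1 a4 a5 a6 a7 b2 a8 a9 a10 1 y z w s"
proof -
  define u where "u = t * t"
  have tt: "t * t = u" and tu: "t * u = t - 1"
    using t by (simp_all add: u_def power3_eq_cube mult.assoc)
  have "u * u = t * (t * u)"
    by (simp add: u_def mult_ac)
  then have uu: "u * u = u - t"
    by (simp add: tu tt right_diff_distrib)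
  have nested: "t * (t * x) = u * x" "t * (u * x) = t * x - x" "u * (u * x) = u * x - t * x" for x
    by (simp_all only: mult.assoc[symmetric] tt tu uu left_diff_distrib mult_1)
  note R = tt tu uu nested power2_eq_square power3_eq_cube algebra_simps numeral_mod_3[OF three]
    numeral_mod_3_more[OF three] three
  have *: "\<exists>y z w s. N2_singular a1 a2 a3 b1 a4 a5 a6 a7 b2 a8 a9 a10 1 y z w s"
    if "N2_singular a1 a2 a3 b1 a4 a5 a6 a7 b2 a8 a9 a10 1 y z w s" for y z w s
    using that by blast
  show ?thesis
    using T
  proof (elim insertE emptyE, goal_cases)
    case 1
    show ?thesis
      by (rule *, rule N2_singular_affine[OF three refl refl, where y = "p * t" and z = "q * (u - t)"])
        (use 1 p q in \<open>auto simp: R\<close>)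
  next
    case 2
    show ?thesis
      by (rule *, rule N2_singular_affine[OF three refl refl, where y = "p * (t - u)" and z = "q * t"])
        (use 2 p q in \<open>auto simp: R\<close>)
  next
    case 3
    show ?thesis
      by (rule *, rule N2_singular_affine[OF three refl refl, where y = "p * (t + u)" and z = "q * u"])
        (use 3 p q in \<open>auto simp: R\<close>)
  next
    case 4
    show ?thesis
      by (rule *, rule N2_singular_affine[OF three refl refl, where y = "- p * u" and z = "- q * (t + u)"])
        (use 4 p q in \<open>auto simp: R\<close>)
  qed
qed

text \<open>For a3 = 0 the coefficient of a10 in \<open>m33\<close> vanishes, so a10 cannot be
  solved for; a6, a7 and a10 are enumerated together with a4 and a5. Every tuple has a singular
  point among those tested by \<open>s1\<close> to \<open>s3\<close>.\<close>

lemma N2_solutions_degenerate: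
  fixes a1 a2 a3 a4 b1 a5 a6 a7 b2 a8 a9 a10 :: "'a::field"
  assumes three: "(3 :: 'a) = 0"
   and a1: "a1 \<in> {0, 1, - 1}" and a2: "a2 \<in> {0, 1, - 1}" and nz: "(a1, a2) \<noteq> (0, 0)"
   and b1: "b1 \<in> {0, 1}" and b2: "b2 \<in> {0, 1}" and a3: "a3 = 0"
   and a4: "a4 \<in> {0, 1, - 1}" and a5: "a5 \<in> {0, 1, - 1}"
   and a6: "a6 \<in> {0, 1, - 1}" and a7: "a7 \<in> {0, 1, - 1}" and a10: "a10 \<in> {0, 1, - 1}"
   and eqs: "n = a1 * a1 + a2 * a2" "a4 * b1 = 0" "a5 * b1 = 0"
     "a8 = n * a1 * b1" "a9 = - (n * a2 * b1)"
     "a7 * a7 = a6 * b2 + a8 * b1 + a1 * b1"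
     "a6 * b1 - a4 * (a6 + b2) - b1 * b2 = - (n * a1 * b1 * (a1 * (a6 - b2) - a2 * a7))"
     "a5 * (a6 + b2) - a7 * b1 = n * a1 * b1 * (a1 * a7 + a2 * (a6 - b2))"
   and tr: "a8 * a8 + a9 * a9 - a10 * (a6 + b2) = - (n * a1 * a1 * b1)"
     "a10 * b1 + a7 * a9 + a8 * b2 = 0"
     "a6 * a9 + a7 * a8 = 0"
   and s1: "\<not> (a10 = 0 \<and> a8 = 0 \<and> a9 = 0)"
   and s2: "\<And>p q. p \<in> {0, 1, - 1} \<Longrightarrow> q \<in> {0, 1, - 1} \<Longrightarrow>
      \<not> (a4 + (a6 - b2) * p - a7 * q + a8 * (p * p - q * q) + a9 * p * q + a10 * p = 0 \<and>
         a5 + (a6 - b2) * q + a7 * p - a8 * p * q + a9 * (p * p - q * q) - a10 * q = 0 \<and>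
         a6 - b2 - a8 * p + a9 * q = 0 \<and> a7 - a8 * q - a9 * p = 0 \<and>
         (p = 0 \<and> q = 0 \<or> a8 * (p * p - q * q) - b1 - a6 * p - a7 * q = 0 \<and> a7 * p - a6 * q - a8 * p * q = 0))"
   and s3: "\<And>y z w Gw. y \<in> {0, 1, - 1} \<Longrightarrow> z \<in> {0, 1, - 1} \<Longrightarrow> w = y * y + z * z \<Longrightarrow>
      Gw = a6 * y * y + a7 * y * z + b2 * z * z - w * (a8 * y + a9 * z) \<Longrightarrow>
      \<not> (a1 * y + a2 * z + a3 * w + (b1 + a4) * y + b1 * y * z * z - a5 * z
           + w * (a6 * y * y + a7 * y * z + b2 * z * z) + w * w * (a8 * y + a9 * z) + a10 * w = 0 \<and>
        a1 - a3 * y + b1 * z * z + w * (a7 * z - a6 * y) + a8 * w * w = y * Gw \<and>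
        a2 - a3 * z - b1 * y * z + w * (a7 * y - b2 * z) + a9 * w * w = z * Gw)"
  shows False
proof -
  note two = numeral_mod_3(1)[OF three]
  have "(1 :: 'a) \<noteq> - 1"
    using two by (metis add_eq_0_iff one_add_one zero_neq_one neg_equal_0_iff_equal)
  then have neq: "(1 :: 'a) \<noteq> - 1" "- 1 \<noteq> (1 :: 'a)" by simp_all
  note S = two neq
  show ?thesis
    by (insert nz eqs(1,4,5); rule trit_cases[OF a1]; rule trit_cases[OF a2]; rule bit_cases[OF b1]; simp add: S;
      insert eqs(6,7,8); rule trit_cases[OF a6]; rule trit_cases[OF a7]; rule bit_cases[OF b2]; simp add: S;
      insert tr s1; rule trit_cases[OF a10]; simp add: S;
      insert eqs(2,3); rule trit_cases[OF a4]; rule trit_cases[OF a5]; simp add: S;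
      insert a3;
      insert s2[of 0 0] s2[of 0 1] s2[of 0 "- 1"] s2[of 1 0] s2[of 1 1] s2[of 1 "- 1"]
        s2[of "- 1" 0] s2[of "- 1" 1] s2[of "- 1" "- 1"]; simp add: S;
      insert s3[OF _ _ refl refl, of 0 1] s3[OF _ _ refl refl, of 0 "- 1"]
        s3[OF _ _ refl refl, of 1 0] s3[OF _ _ refl refl, of 1 1] s3[OF _ _ refl refl, of 1 "- 1"]
        s3[OF _ _ refl refl, of "- 1" 0] s3[OF _ _ refl refl, of "- 1" 1] s3[OF _ _ refl refl, of "- 1" "- 1"];
      simp add: S ex_disj_distrib)
qed

text \<open>As before, the surviving tuples are singular only over the field with 27 elements; \<open>s2\<close> excludes
  singular points with $x = 0$ over the field with nine elements.\<close>

lemma N2_solutions_nondegenerate: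
  fixes a1 a2 a3 a4 b1 a5 a6 a7 b2 a8 a9 a10 :: "'a::field"
  assumes three: "(3 :: 'a) = 0"
   and a1: "a1 \<in> {0, 1, - 1}" and a2: "a2 \<in> {0, 1, - 1}" and nz: "(a1, a2) \<noteq> (0, 0)"
   and b1: "b1 \<in> {0, 1}" and b2: "b2 \<in> {0, 1}" and a3: "a3 \<in> {1, - 1}"
   and a4: "a4 \<in> {0, 1, - 1}" and a5: "a5 \<in> {0, 1, - 1}"
   and eqs: "n = a1 * a1 + a2 * a2"
     "m31 = a3 * b1 * (a1 * a4 + a2 * a5)" "m32 = a3 * b1 * (a2 * a4 - a1 * a5)"
     "a6 = b2 + n * (a1 * (m31 - a3 * a4) - a2 * (m32 + a3 * a5))"
     "a7 = - (n * (a2 * (m31 - a3 * a4) + a1 * (m32 + a3 * a5)))"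
     "m00 = - (a1 * b1) - a3 * a3"
     "a6 * b1 - a4 * (a6 + b2) - b1 * b2 = n * m00 * m31"
     "a5 * (a6 + b2) - a7 * b1 = n * m00 * m32"
     "P = - (n * a1 * a3 * m31) - a3 * (a6 - b2) + a4 * b1 + b1 * b1"
     "Q = n * a2 * a3 * m31 - a3 * a7"
     "a8 = n * (a1 * P + a2 * Q)"
     "a9 = n * (a1 * Q - a2 * P)"
     "m33 = a4 * b1 - m00"
     "a10 = a3 * (m33 + a6 * b2 - a7 * a7 + a8 * b1)"
   and tr: "a8 * a8 + a9 * a9 - a10 * (a6 + b2) = n * m00 * m33"
     "- (a10 * b1) - a7 * a9 - a8 * b2 = - (n * a1 * a3 * m33)"
     "- (a6 * a9) - a7 * a8 = - (n * a2 * a3 * m33)"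
   and s1: "\<not> (a10 = 0 \<and> a8 = 0 \<and> a9 = 0)"
   and s2: "\<And>p q. p \<in> {0, 1, - 1} \<Longrightarrow> q \<in> {0, 1, - 1} \<Longrightarrow>
      \<not> (a4 + (a6 - b2) * p - a7 * q + a8 * (p * p - q * q) + a9 * p * q + a10 * p = 0 \<and>
         a5 + (a6 - b2) * q + a7 * p - a8 * p * q + a9 * (p * p - q * q) - a10 * q = 0 \<and>
         a6 - b2 - a8 * p + a9 * q = 0 \<and> a7 - a8 * q - a9 * p = 0 \<and>
         (p = 0 \<and> q = 0 \<or> a8 * (p * p - q * q) - b1 - a6 * p - a7 * q = 0 \<and> a7 * p - a6 * q - a8 * p * q = 0))"
   and s3: "\<And>y z w Gw. y \<in> {0, 1, - 1} \<Longrightarrow> z \<in> {0, 1, - 1} \<Longrightarrow> w = y * y + z * z \<Longrightarrow>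
      Gw = a6 * y * y + a7 * y * z + b2 * z * z - w * (a8 * y + a9 * z) \<Longrightarrow>
      \<not> (a1 * y + a2 * z + a3 * w + (b1 + a4) * y + b1 * y * z * z - a5 * z
           + w * (a6 * y * y + a7 * y * z + b2 * z * z) + w * w * (a8 * y + a9 * z) + a10 * w = 0 \<and>
        a1 - a3 * y + b1 * z * z + w * (a7 * z - a6 * y) + a8 * w * w = y * Gw \<and>
        a2 - a3 * z - b1 * y * z + w * (a7 * y - b2 * z) + a9 * w * w = z * Gw)"
  shows "\<exists>p\<in>{1, - 1}. \<exists>q\<in>{1, - 1}. (a1, a2, a3, b1, a4, a5, a6, a7, b2, a8, a9, a10) \<in>
    {(0, q, 1, 0, p, - q, - 1, p * q, 1, - p, q, - 1), (p, 0, - 1, 0, p, q, - 1, p * q, 1, p, q, 1),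
     (p, q, 1, 0, 0, q, - 1, p * q, 1, - p, 0, - 1), (p, q, - 1, 0, - p, 0, - 1, - (p * q), 1, 0, - q, 1)}"
proof -
  note two = numeral_mod_3(1)[OF three]
  have "(1 :: 'a) \<noteq> - 1"
    using two by (metis add_eq_0_iff one_add_one zero_neq_one neg_equal_0_iff_equal)
  then have neq: "(1 :: 'a) \<noteq> - 1" "- 1 \<noteq> (1 :: 'a)" by simp_all
  note S = two neq
  show ?thesis
    by (insert nz eqs(1); rule trit_cases[OF a1]; rule trit_cases[OF a2]; simp add: S;
      insert eqs(2,3,6); rule sign_cases[OF a3]; rule bit_cases[OF b1]; rule trit_cases[OF a4]; rule trit_cases[OF a5]; simp add: S;
      insert eqs(4,5,7,8); rule bit_cases[OF b2]; simp add: S;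
      insert eqs(9-14); simp add: S;
      insert tr s1; simp add: S;
      insert s2[of 0 0] s2[of 0 1] s2[of 0 "- 1"] s2[of 1 0] s2[of 1 1] s2[of 1 "- 1"]
        s2[of "- 1" 0] s2[of "- 1" 1] s2[of "- 1" "- 1"]; simp add: S;
      insert s3[OF _ _ refl refl, of 0 1] s3[OF _ _ refl refl, of 0 "- 1"]
        s3[OF _ _ refl refl, of 1 0] s3[OF _ _ refl refl, of 1 1] s3[OF _ _ refl refl, of 1 "- 1"]
        s3[OF _ _ refl refl, of "- 1" 0] s3[OF _ _ refl refl, of "- 1" 1] s3[OF _ _ refl refl, of "- 1" "- 1"];
      simp add: S ex_disj_distrib)
qed

text \<open>On $x = 0$ the coordinates live in the field with nine elements; the hypotheses are the real and
  imaginary parts of the singularity conditions at $(0 : 1 : i : p + q i)$.\<close>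

lemma N2_singular_line:
  fixes a1 a2 a3 b1 a4 a5 a6 a7 b2 a8 a9 a10 p q i :: "'a::field"
  assumes three: "(3 :: 'a) = 0" and ii: "i * i = - 1" and p: "p ^ 3 = p" and q: "q ^ 3 = q"
    and re: "a4 + (a6 - b2) * p - a7 * q + a8 * (p * p - q * q) + a9 * p * q + a10 * p = 0"
    and im: "a5 + (a6 - b2) * q + a7 * p - a8 * p * q + a9 * (p * p - q * q) - a10 * q = 0"
    and dre: "a6 - b2 - a8 * p + a9 * q = 0" and dim: "a7 - a8 * q - a9 * p = 0"
    and zero: "p = 0 \<and> q = 0 \<or> a8 * (p * p - q * q) - b1 - a6 * p - a7 * q = 0 \<and> a7 * p - a6 * q - a8 * p * q = 0"
  shows "\<exists>t. N2_singular a1 a2 a3 b1 a4 a5 a6 a7 b2 a8 a9 a10 0 1 i (p + q * i) t"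
proof -
  note two = numeral_mod_3(1)[OF three]
  define w where "w = p + q * i"
  \<comment> \<open>This is the y-derivative, hence the multiplier because y = 1. On x = 0 the
    x-derivative vanishes, so t w = 0 is needed: this is the disjunction in
    \<open>zero\<close>.\<close>
  define t where "t = (a8 * (p * p - q * q) - b1 - a6 * p - a7 * q) + i * (a7 * p - a6 * q - a8 * p * q)"
  have ii': "i * (i * x) = - x" for x using ii by (simp flip: mult.assoc)
  have i2: "i ^ 2 = - 1" "i ^ 3 = - i"
    using ii by (simp_all add: power2_eq_square power3_eq_cube)
  have w2: "w ^ 2 = p * p - q * q - p * q * i"
    by (simp add: w_def power2_eq_square algebra_simps ii ii' two)
  have "w ^ 3 = p ^ 3 + q ^ 3 * i ^ 3 + 3 * (p * p * q * i - p * q * q)"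
    by (simp add: w_def power3_eq_cube algebra_simps ii ii')
  then have w3: "w ^ 3 = p - q * i" by (simp add: p q three i2)
  have tw: "t * w = 0"
    using zero by (auto simp: t_def w_def)
  have G: "(b1 + a4) + b1 * i ^ 2 - a5 * i ^ 3 + a6 * w + a7 * i * w + b2 * i ^ 2 * w
       + a8 * w ^ 2 + a9 * i * w ^ 2 + a10 * w ^ 3 =
     (a4 + (a6 - b2) * p - a7 * q + a8 * (p * p - q * q) + a9 * p * q + a10 * p) +
     i * (a5 + (a6 - b2) * q + a7 * p - a8 * p * q + a9 * (p * p - q * q) - a10 * q)"
    unfolding w2 w3 i2 by (simp add: w_def algebra_simps ii ii')
  have Gw: "a6 + a7 * i + b2 * i ^ 2 - a8 * w - a9 * i * w = (a6 - b2 - a8 * p + a9 * q) + i * (a7 - a8 * q - a9 * p)"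
    unfolding i2 by (simp add: w_def algebra_simps ii ii')
  have Gy: "b1 * i ^ 2 - a6 * w + a7 * i * w + a8 * w ^ 2 = t"
    unfolding w2 i2 by (simp add: w_def t_def algebra_simps ii ii')
  \<comment> \<open>Euler's relation at x = 0, y = 1, z = i: the z-derivative is i times the
    y-derivative plus i w times the w-derivative, and the latter is zero.\<close>
  have "a7 * w - b1 * i - b2 * i * w + a9 * w ^ 2 =
      t * i + i * w * (a6 + a7 * i + b2 * i ^ 2 - a8 * w - a9 * i * w) + 3 * (a7 * w)"
    unfolding Gy[symmetric] i2 power2_eq_square by (simp add: algebra_simps ii ii')
  then have Gz: "a7 * w - b1 * i - b2 * i * w + a9 * w ^ 2 = t * i"
    unfolding Gw dre dim three by simp
  have "N2_singular a1 a2 a3 b1 a4 a5 a6 a7 b2 a8 a9 a10 0 1 i w t"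
    unfolding N2_singular_def
  proof (intro conjI)
    show "a1 * 0 ^ 2 * 1 + a2 * 0 ^ 2 * i + a3 * 0 * 1 ^ 2 + a3 * 0 * i ^ 2 + (b1 + a4) * 1 ^ 3
       + b1 * 1 * i ^ 2 - a5 * i ^ 3 + a6 * 1 ^ 2 * w + a7 * 1 * i * w + b2 * i ^ 2 * w
       + a8 * 1 * w ^ 2 + a9 * i * w ^ 2 + a10 * w ^ 3 = 0"
      using G unfolding re im by simp
    show "a6 * 1 ^ 2 + a7 * 1 * i + b2 * i ^ 2 - a8 * 1 * w - a9 * i * w = t * 0"
      using Gw unfolding dre dim by simp
    show "a1 * 0 ^ 2 - a3 * 0 * 1 + b1 * i ^ 2 - a6 * 1 * w + a7 * i * w + a8 * w ^ 2 = t * 1"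
      using Gy by simp
    show "a2 * 0 ^ 2 - a3 * 0 * i - b1 * 1 * i + a7 * 1 * w - b2 * i * w + a9 * w ^ 2 = t * i"
      using Gz by simp
  qed (simp_all add: i2 tw)
  then show ?thesis unfolding w_def by blast
qed

lemma exists_sqrt_minus_one: "\<exists>i :: 'a::alg_closed_field. i * i = - 1"
proof -
  have "Polynomial.degree [:1, 0, 1 :: 'a:] > 0" by simp
  then obtain i where "poly [:1, 0, 1 :: 'a:] i = 0"
    using alg_closed_imp_poly_has_root by blast
  then show ?thesis
    by (intro exI[of _ i]) (simp add: eq_neg_iff_add_eq_0 add.commute)
qed

lemma no_curve_N2:
  fixes a1 a2 a3 b1 a4 a5 a6 a7 b2 a8 a9 a10 :: "'k::field" and \<xi> :: "4 \<Rightarrow> 'k cochain"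
  defines "fs \<equiv> [(2, 1, 0, 0, 1), (1, 0, 2, 0, 0), (1, 0, 0, 2, 0)]"
    and "gs \<equiv> terms_N2 a1 a2 a3 b1 a4 a5 a6 a7 b2 a8 a9 a10"
  assumes card: "CARD('k) = 3" and nz: "(a1, a2) \<noteq> (0, 0)" and b: "b1 \<in> {0, 1}" "b2 \<in> {0, 1}"
    and smooth: "smooth_curve (poly_of fs) (poly_of gs)"
    and H1: "H1_basis (poly_of fs) (poly_of gs) \<xi>"
    "p_rank (hasse_witt (poly_of fs) (poly_of gs) \<xi>) = 0"
    "a_number (hasse_witt (poly_of fs) (poly_of gs) \<xi>) = 3"
  shows False
proof -
  note three = three_elements(2)[OF card] and cube = cube_three_elements[OF card]
  note two = numeral_mod_3(1)[OF three]
  have three_ac: "(3 :: 'k alg_closure) = 0" by (metis three to_ac_0 to_ac_numeral)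
  have trit: "x \<in> {0, 1, - 1}" for x :: 'k
    using three_elements(1)[OF card] by blast
  have not_singular_ac: "\<not> N2_singular (to_ac a1) (to_ac a2) (to_ac a3) (to_ac b1) (to_ac a4) (to_ac a5)
      (to_ac a6) (to_ac a7) (to_ac b2) (to_ac a8) (to_ac a9) (to_ac a10) x y z w t" for x y z w t
    using N2_singular_not_smooth[OF three] smooth unfolding fs_def gs_def by blast
  have not_singular: "\<not> N2_singular a1 a2 a3 b1 a4 a5 a6 a7 b2 a8 a9 a10 x y z w t" for x y z w t
    using N2_singular_to_ac[of a1 a2 a3 b1 a4 a5 a6 a7 b2 a8 a9 a10 x y z w t] not_singular_ac by blast
  define n where "n = a1 * a1 + a2 * a2"
  \<comment> \<open>-1 is not a square, so the norm n of the nonzero a1 + a2 i is a unit.\<close>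
  have n2: "n * n = 1"
    using trit[of a1] trit[of a2] nz by (auto simp: n_def two)
  have nn: "n * (n * x) = x" for x using n2 by (simp flip: mult.assoc)
  define m31 where "m31 = a1 * (a6 - b2) - a2 * a7 + a3 * a4"
  define m32 where "m32 = - (a1 * a7) - a2 * (a6 - b2) - a3 * a5"
  define m00 where "m00 = - (a1 * b1) - a3 * a3"
  define m33 where "m33 = a10 * a3 - a6 * b2 + a7 * a7 - a8 * b1"
  define P where "P = - (n * a1 * a3 * m31) - a3 * (a6 - b2) + a4 * b1 + b1 * b1"
  define Q where "Q = n * a2 * a3 * m31 - a3 * a7"
  note eqs = N2_equations[OF three n_def n2 rank_one_N2[OF card nz H1[unfolded fs_def gs_def]]
      m00_def m31_def m32_def m33_def P_def Q_def]
  have s1: "\<not> (a10 = 0 \<and> a8 = 0 \<and> a9 = 0)"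
    using not_singular[of 0 0 0 1 0] by (auto simp: N2_singular_def)
  have s2: "\<not> (a4 + (a6 - b2) * p - a7 * q + a8 * (p * p - q * q) + a9 * p * q + a10 * p = 0 \<and>
         a5 + (a6 - b2) * q + a7 * p - a8 * p * q + a9 * (p * p - q * q) - a10 * q = 0 \<and>
         a6 - b2 - a8 * p + a9 * q = 0 \<and> a7 - a8 * q - a9 * p = 0 \<and>
         (p = 0 \<and> q = 0 \<or> a8 * (p * p - q * q) - b1 - a6 * p - a7 * q = 0 \<and> a7 * p - a6 * q - a8 * p * q = 0))"
    for p q :: 'k
  proof
    assume *: "a4 + (a6 - b2) * p - a7 * q + a8 * (p * p - q * q) + a9 * p * q + a10 * p = 0 \<and>
         a5 + (a6 - b2) * q + a7 * p - a8 * p * q + a9 * (p * p - q * q) - a10 * q = 0 \<and>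
         a6 - b2 - a8 * p + a9 * q = 0 \<and> a7 - a8 * q - a9 * p = 0 \<and>
         (p = 0 \<and> q = 0 \<or> a8 * (p * p - q * q) - b1 - a6 * p - a7 * q = 0 \<and> a7 * p - a6 * q - a8 * p * q = 0)"
    obtain i :: "'k alg_closure" where i: "i * i = - 1" using exists_sqrt_minus_one by blast
    have "\<exists>t. N2_singular (to_ac a1) (to_ac a2) (to_ac a3) (to_ac b1) (to_ac a4) (to_ac a5)
      (to_ac a6) (to_ac a7) (to_ac b2) (to_ac a8) (to_ac a9) (to_ac a10) 0 1 i (to_ac p + to_ac q * i) t"
      by (rule N2_singular_line[OF three_ac i])
        (use * in \<open>simp_all add: cube flip: to_ac_add to_ac_mult to_ac_power to_ac_diff\<close>)
    then show False using not_singular_ac by blast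
  qed
  have s3: "\<not> (a1 * y + a2 * z + a3 * w + (b1 + a4) * y + b1 * y * z * z - a5 * z
           + w * (a6 * y * y + a7 * y * z + b2 * z * z) + w * w * (a8 * y + a9 * z) + a10 * w = 0 \<and>
        a1 - a3 * y + b1 * z * z + w * (a7 * z - a6 * y) + a8 * w * w = y * Gw \<and>
        a2 - a3 * z - b1 * y * z + w * (a7 * y - b2 * z) + a9 * w * w = z * Gw)"
    if w: "w = y * y + z * z"
      and Gw: "Gw = a6 * y * y + a7 * y * z + b2 * z * z - w * (a8 * y + a9 * z)" for y z w Gw
  proof (rule notI, elim conjE)
    assume G: "a1 * y + a2 * z + a3 * w + (b1 + a4) * y + b1 * y * z * z - a5 * z
           + w * (a6 * y * y + a7 * y * z + b2 * z * z) + w * w * (a8 * y + a9 * z) + a10 * w = 0"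
      and Gy: "a1 - a3 * y + b1 * z * z + w * (a7 * z - a6 * y) + a8 * w * w = y * Gw"
      and Gz: "a2 - a3 * z - b1 * y * z + w * (a7 * y - b2 * z) + a9 * w * w = z * Gw"
    have "N2_singular a1 a2 a3 b1 a4 a5 a6 a7 b2 a8 a9 a10 1 y z w Gw"
    proof (rule N2_singular_affine[OF three], goal_cases)
      case 1
      show ?case by (simp add: w power2_eq_square)
    next
      case 2
      show ?case using Gw by (simp add: power2_eq_square algebra_simps)
    next
      case 3
      show ?case using G by (simp add: cube power2_eq_square mult.assoc)
    next
      case 4
      show ?case using Gy by (simp add: power2_eq_square algebra_simps)
    next
      case 5
      show ?case using Gz by (simp add: power2_eq_square algebra_simps)
    qed
    then show False using not_singular by blast
  qed
  have "a3 \<noteq> 0"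
  proof
    assume a3: "a3 = 0"
    have b1: "b1 * b1 = b1" using b by auto
    have 1: "a4 * b1 = 0" "a5 * b1 = 0"
      using eqs(1,2) by (simp_all add: a3)
    have 2: "a8 = n * a1 * b1" "a9 = - (n * a2 * b1)"
      using eqs(5,6) by (simp_all add: P_def Q_def a3 1 b1 mult.assoc)
    have m00: "m00 = - (a1 * b1)" by (simp add: m00_def a3)
    have 3: "m33 = a1 * b1" using eqs(7) by (simp add: m00 1)
    have 4: "a7 * a7 = a6 * b2 + a8 * b1 + a1 * b1"
      using 3 by (simp add: m33_def a3 algebra_simps)
    have 5: "a6 * b1 - a4 * (a6 + b2) - b1 * b2 = - (n * a1 * b1 * (a1 * (a6 - b2) - a2 * a7))"
      using eqs(3) by (simp add: m00 m31_def a3 mult.assoc)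
    have 6: "a5 * (a6 + b2) - a7 * b1 = n * a1 * b1 * (a1 * a7 + a2 * (a6 - b2))"
      using eqs(4) by (simp add: m00 m32_def a3 algebra_simps)
    have "n * m00 * m33 = - (n * a1 * a1 * (b1 * b1))"
      by (simp add: m00 3 mult_ac)
    then have 7: "a8 * a8 + a9 * a9 - a10 * (a6 + b2) = - (n * a1 * a1 * b1)"
      unfolding eqs(8) by (simp only: b1)
    have 8: "a10 * b1 + a7 * a9 + a8 * b2 = 0" "a6 * a9 + a7 * a8 = 0"
      using eqs(9,10) by (simp_all add: a3 algebra_simps eq_neg_iff_add_eq_0 neg_eq_iff_add_eq_0)
    show False
      by (rule N2_solutions_degenerate[OF three trit trit nz b a3 trit trit trit trit trit
            n_def 1 2 4 5 6 7 8 s1 s2 s3])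
  qed
  then have a3: "a3 \<in> {1, - 1}" using trit[of a3] by blast
  then have a3_sq: "a3 * a3 = 1" by auto
  have a33: "a3 * (a3 * x) = x" for x using a3_sq by (simp flip: mult.assoc)
  \<comment> \<open>The first two relations form a linear system for m31 and m32 of determinant -n
    up to a unit; it is inverted here and solved in terms of a4 b1 and a5 b1.\<close>
  have "n * m31 = a1 * (a1 * m31 + a2 * m32) + a2 * (a2 * m31 - a1 * m32)"
    "n * m32 = a2 * (a1 * m31 + a2 * m32) - a1 * (a2 * m31 - a1 * m32)"
    by (simp_all add: n_def algebra_simps)
  moreover have "n * a3 * (a4 * b1) = a1 * m31 + a2 * m32" "n * a3 * (a5 * b1) = a2 * m31 - a1 * m32"
    unfolding eqs(1,2) by (simp_all add: mult_ac n2 nn a33 right_diff_distrib distrib_left)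
  ultimately have "n * (n * m31) = n * (a1 * (n * a3 * (a4 * b1)) + a2 * (n * a3 * (a5 * b1)))"
    "n * (n * m32) = n * (a2 * (n * a3 * (a4 * b1)) - a1 * (n * a3 * (a5 * b1)))"
    by simp_all
  then have m: "m31 = a3 * b1 * (a1 * a4 + a2 * a5)" "m32 = a3 * b1 * (a2 * a4 - a1 * a5)"
    by (simp_all add: algebra_simps nn n2)
  \<comment> \<open>Multiplication by the conjugate of a1 + a2 i turns the definitions of m31 and
    m32 into formulas for a6 - b2 and a7.\<close>
  have "a1 * (m31 - a3 * a4) - a2 * (m32 + a3 * a5) = n * (a6 - b2)"
    "a2 * (m31 - a3 * a4) + a1 * (m32 + a3 * a5) = - (n * a7)"
    by (simp_all add: m31_def m32_def n_def algebra_simps)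
  then have a67: "a6 = b2 + n * (a1 * (m31 - a3 * a4) - a2 * (m32 + a3 * a5))"
    "a7 = - (n * (a2 * (m31 - a3 * a4) + a1 * (m32 + a3 * a5)))"
    by (simp_all add: nn)
  have m33: "m33 = a4 * b1 - m00"
    using eqs(7) by (simp add: algebra_simps eq_neg_iff_add_eq_0)
  have "a3 * (m33 + a6 * b2 - a7 * a7 + a8 * b1) = a3 * (a3 * a10)"
    by (simp add: m33_def mult.commute)
  then have a10: "a10 = a3 * (m33 + a6 * b2 - a7 * a7 + a8 * b1)"
    by (simp add: a33)
  have "\<exists>p\<in>{1, - 1}. \<exists>q\<in>{1, - 1}. (a1, a2, a3, b1, a4, a5, a6, a7, b2, a8, a9, a10) \<in>
    {(0, q, 1, 0, p, - q, - 1, p * q, 1, - p, q, - 1), (p, 0, - 1, 0, p, q, - 1, p * q, 1, p, q, 1),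
     (p, q, 1, 0, 0, q, - 1, p * q, 1, - p, 0, - 1), (p, q, - 1, 0, - p, 0, - 1, - (p * q), 1, 0, - q, 1)}"
    by (rule N2_solutions_nondegenerate[OF three trit trit nz b a3 trit trit n_def m a67 m00_def
          eqs(3,4) P_def Q_def eqs(5,6) m33 a10 eqs(8-10) s1 s2 s3])
  then show False
  proof (elim bexE)
    fix p q :: 'k
    assume p: "p \<in> {1, - 1}" and q: "q \<in> {1, - 1}"
      and tuple: "(a1, a2, a3, b1, a4, a5, a6, a7, b2, a8, a9, a10) \<in>
    {(0, q, 1, 0, p, - q, - 1, p * q, 1, - p, q, - 1), (p, 0, - 1, 0, p, q, - 1, p * q, 1, p, q, 1),
     (p, q, 1, 0, 0, q, - 1, p * q, 1, - p, 0, - 1), (p, q, - 1, 0, - p, 0, - 1, - (p * q), 1, 0, - q, 1)}"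
    obtain t :: "'k alg_closure" where t: "t ^ 3 = t - 1" using exists_artin_schreier_root by blast
  have "\<exists>y z w s. N2_singular (to_ac a1) (to_ac a2) (to_ac a3) (to_ac b1) (to_ac a4) (to_ac a5)
      (to_ac a6) (to_ac a7) (to_ac b2) (to_ac a8) (to_ac a9) (to_ac a10) 1 y z w s"
    proof (rule N2_exceptional[OF three_ac t, of "to_ac p" "to_ac q"])
      show "to_ac p \<in> {1, - 1}" "to_ac q \<in> {1, - 1 :: 'k alg_closure}"
        using p q by auto
    qed (use tuple in \<open>elim insertE emptyE; simp\<close>)
    then show False using not_singular_ac by blast
  qed
qed

theorem corollary5p2:
  fixes \<epsilon> :: "'k::field" and R :: "'k set"
  assumes "CARD('k) = 3"
    and "\<not> (\<exists>c. \<epsilon> = c ^ 2)"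
    and "square_class_reps R"
  shows "\<not> (\<exists>(F :: 'k poly4) G (\<xi> :: 4 \<Rightarrow> 'k cochain).
            standard_form \<epsilon> R F G \<and> H1_basis F G \<xi> \<and>
            p_rank (hasse_witt F G \<xi>) = 0 \<and> a_number (hasse_witt F G \<xi>) = 3)"
proof
  assume "\<exists>(F :: 'k poly4) G (\<xi> :: 4 \<Rightarrow> 'k cochain).
            standard_form \<epsilon> R F G \<and> H1_basis F G \<xi> \<and>
            p_rank (hasse_witt F G \<xi>) = 0 \<and> a_number (hasse_witt F G \<xi>) = 3"
  then obtain F G :: "'k poly4" and \<xi> :: "4 \<Rightarrow> 'k cochain" where std: "standard_form \<epsilon> R F G"
    and H1: "H1_basis F G \<xi>" "p_rank (hasse_witt F G \<xi>) = 0" "a_number (hasse_witt F G \<xi>) = 3"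
    by blast
  have smooth: "smooth_curve F G"
    and cases: "case_D F G \<or> case_N1i R F G \<or> case_N1ii R F G \<or> case_N2 \<epsilon> F G"
    using std by (simp_all add: standard_form_def)
  have "\<epsilon> \<noteq> 0" "\<epsilon> \<noteq> 1"
    using assms(2) by (metis zero_power2, metis one_power2)
  \<comment> \<open>The only nonsquare among 0, 1, -1, which fixes the nonsplit quadric.\<close>
  then have \<epsilon>: "\<epsilon> = - 1"
    using three_elements(1)[OF assms(1)] by blast
  from cases show False
  proof (elim disjE)
    assume "case_D F G"
    from case_D_poly_of[OF this] show False
    proof (elim exE conjE)
      fix a0 a1 a2 a3 a4 a5 a6 a7 a8 a9 b1 b2 :: 'k
      assume a0: "a0 \<noteq> 0" and F: "F = poly_of [(2, 0, 1, 0, 1), (1, 0, 0, 2, 0)]"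
        and G: "G = poly_of (terms_D a0 a1 a2 a3 a4 a5 a6 a7 a8 a9 b1 b2)"
      show False
        by (rule no_curve_D[OF assms(1) a0 smooth[unfolded F G] H1[unfolded F G]])
    qed
  next
    assume "case_N1i R F G"
    from case_N1i_poly_of[OF this] show False
    proof (elim exE conjE)
      fix a1 a2 a3 a4 b1 a5 a6 a7 b2 a8 a9 a10 :: 'k
      assume a: "a1 \<noteq> 0" "a2 \<noteq> 0" "b2 \<in> {0, 1}" and F: "F = poly_of [(2, 1, 0, 0, 1), (2, 0, 1, 1, 0)]"
        and G: "G = poly_of (terms_N1 a1 a2 a3 1 a4 b1 a5 a6 a7 b2 a8 a9 a10)"
      show False
        by (rule no_curve_N1i[OF assms(1) a smooth[unfolded F G] H1[unfolded F G]])
    qed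
  next
    assume "case_N1ii R F G"
    from case_N1ii_poly_of[OF this] show False
    proof (elim exE conjE)
      fix a1 a2 a3 b1 a5 a6 a7 b2 a8 a9 a10 :: 'k
      assume a: "a1 \<noteq> 0" "a2 \<noteq> 0" and F: "F = poly_of [(2, 1, 0, 0, 1), (2, 0, 1, 1, 0)]"
        and G: "G = poly_of (terms_N1 a1 a2 a3 0 0 b1 a5 a6 a7 b2 a8 a9 a10)"
      show False
        by (rule no_curve_N1ii[OF assms(1) a smooth[unfolded F G] H1[unfolded F G]])
    qed
  next
    assume "case_N2 \<epsilon> F G"
    then have "case_N2 (- 1) F G" by (simp only: \<epsilon>)
    from case_N2_poly_of[OF this three_elements(2)[OF assms(1)]] show False
    proof (elim exE conjE)
      fix a1 a2 a3 b1 a4 a5 a6 a7 b2 a8 a9 a10 :: 'k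
      assume a: "(a1, a2) \<noteq> (0, 0)" "b1 \<in> {0, 1}" "b2 \<in> {0, 1}"
        and F: "F = poly_of [(2, 1, 0, 0, 1), (1, 0, 2, 0, 0), (1, 0, 0, 2, 0)]"
        and G: "G = poly_of (terms_N2 a1 a2 a3 b1 a4 a5 a6 a7 b2 a8 a9 a10)"
      show False
        by (rule no_curve_N2[OF assms(1) a smooth[unfolded F G] H1[unfolded F G]])
    qed
  qed
qed

end
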